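(* Let $\varphi$ be an anisotropic quasilinear $p$-form over $F$ of dimension $\geq 2$, and let $\psi$ be a subform of $\varphi$. Then $\psi_{F(\varphi)}$ is isotropic if and only if $\mathrm{codim}_{\varphi}(\psi) \leq \mathfrak{i}_1(\varphi) - 1$. In the case where $\mathrm{codim}_{\varphi}(\psi) = \mathfrak{i}_1(\varphi) - 1$, there is exactly one rational morphism $X_\varphi \dashrightarrow X_\psi$, and moreover it is dominant.
   Context: $p$ is a prime and $F$ is a non-perfect field of characteristic $p$. Rational morphisms are over the base field and need not be dominant. A quasilinear $p$-form over a field $E$ of characteristic $p$ is a map $\varphi\colon V_\varphi \to E$ on a finite-dimensional $E$-vector space $V_\varphi$ with $\varphi(\lambda v)=\lambda^p\varphi(v)$ and $\varphi(v+w)=\varphi(v)+\varphi(w)$ for all $\lambda\in E$, $v,w\in V_\varphi$ (in coordinates, $a_1x_1^p+\dots+a_nx_n^p$). Its dimension is $\dim V_\varphi$, and $\varphi_L$ denotes its scalar extension to a field $L\supset E$. It is isotropic if $\varphi(v)=0$ for some $v\ne 0$, and anisotropic otherwise. The isotropic vectors form a subspace of $V_\varphi$, whose dimension is the defect index $\mathfrak{i}_0(\varphi)$. A subform $\psi\subset\varphi$ is the restriction of $\varphi$ to a subspace $V_\psi\subset V_\varphi$; $\mathrm{codim}_\varphi(\psi)=\dim(\varphi)-\dim(\psi)$. For a quasilinear $p$-form $\varphi$ over $F$ of dimension $d+2\ge 2$, $X_\varphi=\{\varphi=0\}\subset\mathbb{P}(V_\varphi)$ is the associated projective hypersurface, of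 dimension $d$. If $\varphi$ is anisotropic, then $X_\varphi$ is integral, $F(\varphi)$ denotes its function field, and $\mathfrak{i}_1(\varphi):=\mathfrak{i}_0(\varphi_{F(\varphi)})$. *)

theory Defs
  imports
    "Jordan_Normal_Form.VS_Connect"
    "HOL-Algebra.QuotRing"
    "HOL-Library.Poly_Mapping"
    "HOL-Computational_Algebra.Fraction_Field"
begin

text \<open>
  Fields of definition and their extensions are HOL-Algebra rings, because the function field
  \<open>F(\<phi>)\<close> depends on the form \<open>\<phi>\<close> and so cannot be a type.  The base field \<open>F\<close> is a type of class
  \<open>field\<close>, turned into a HOL-Algebra ring by \<^const>\<open>class_ring\<close>.
\<close>

section \<open>Quasilinear forms\<close>

definition quasilinear_form ::
    "nat \<Rightarrow> ('k, 'm) ring_scheme \<Rightarrow> ('k, 'v, 'n) module_scheme \<Rightarrow> ('v \<Rightarrow> 'k) \<Rightarrow> bool" where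
  "quasilinear_form p K V \<phi> \<longleftrightarrow>
     vectorspace K V \<and> vectorspace.fin_dim K V \<and>
     \<phi> \<in> carrier V \<rightarrow> carrier K \<and>
     (\<forall>a\<in>carrier K. \<forall>v\<in>carrier V. \<phi> (a \<odot>\<^bsub>V\<^esub> v) = (a [^]\<^bsub>K\<^esub> p) \<otimes>\<^bsub>K\<^esub> \<phi> v) \<and>
     (\<forall>v\<in>carrier V. \<forall>w\<in>carrier V. \<phi> (v \<oplus>\<^bsub>V\<^esub> w) = \<phi> v \<oplus>\<^bsub>K\<^esub> \<phi> w)"

definition isotropic ::
    "('k, 'm) ring_scheme \<Rightarrow> ('k, 'v, 'n) module_scheme \<Rightarrow> ('v \<Rightarrow> 'k) \<Rightarrow> bool" where
  "isotropic K V \<phi> \<longleftrightarrow> (\<exists>v\<in>carrier V. v \<noteq> \<zero>\<^bsub>V\<^esub> \<and> \<phi> v = \<zero>\<^bsub>K\<^esub>)"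

abbreviation anisotropic ::
    "('k, 'm) ring_scheme \<Rightarrow> ('k, 'v, 'n) module_scheme \<Rightarrow> ('v \<Rightarrow> 'k) \<Rightarrow> bool" where
  "anisotropic K V \<phi> \<equiv> \<not> isotropic K V \<phi>"

definition defect_index ::
    "('k, 'm) ring_scheme \<Rightarrow> ('k, 'v, 'n) module_scheme \<Rightarrow> ('v \<Rightarrow> 'k) \<Rightarrow> nat" where
  "defect_index K V \<phi> =
     vectorspace.dim K (V\<lparr>carrier := {v \<in> carrier V. \<phi> v = \<zero>\<^bsub>K\<^esub>}\<rparr>)"

text \<open>\<open>\<psi>\<close> is the restriction of the form \<open>\<phi>\<close> on \<open>V\<close> to the subspace \<open>U\<close>, that is, a form
  on the vector space \<open>V\<lparr>carrier := U\<rparr>\<close>.\<close>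

definition subform ::
    "('k, 'm) ring_scheme \<Rightarrow> 'v set \<Rightarrow> ('v \<Rightarrow> 'k) \<Rightarrow> ('k, 'v, 'n) module_scheme \<Rightarrow> ('v \<Rightarrow> 'k) \<Rightarrow> bool"
  where
  "subform K U \<psi> V \<phi> \<longleftrightarrow> subspace K U V \<and> (\<forall>u\<in>U. \<psi> u = \<phi> u)"

definition codim ::
    "('k, 'm) ring_scheme \<Rightarrow> 'v set \<Rightarrow> ('k, 'v, 'n) module_scheme \<Rightarrow> nat" where
  "codim K U V = vectorspace.dim K V - vectorspace.dim K (V\<lparr>carrier := U\<rparr>)"

definition ordered_basis ::
    "('k, 'm) ring_scheme \<Rightarrow> ('k, 'v, 'n) module_scheme \<Rightarrow> 'v list \<Rightarrow> bool" where
  "ordered_basis K V bs \<longleftrightarrow> distinct bs \<and> vectorspace.basis K V (set bs)"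

text \<open>
  Scalar extension along \<open>\<iota> : K \<rightarrow> L\<close>, in the coordinates given by an ordered basis
  \<open>bs = [b\<^sub>0, \<dots>]\<close> of \<open>V\<close>.  The space \<open>L \<otimes> V\<close> becomes \<open>L\<^sup>n\<close>, where \<open>n = length bs\<close>,
  and \<open>\<phi>\<^sub>L(x) = \<Sum> \<iota>(\<phi>(b\<^sub>i)) x\<^sub>i\<^sup>p\<close>.
\<close>

definition ext_space :: "('l, 'm) ring_scheme \<Rightarrow> 'v list \<Rightarrow> ('l, nat \<Rightarrow> 'l) module" where
  "ext_space L bs = ring.func_space L {..<length bs}"

definition ext_form ::
    "nat \<Rightarrow> ('l, 'm) ring_scheme \<Rightarrow> ('k \<Rightarrow> 'l) \<Rightarrow> ('v \<Rightarrow> 'k) \<Rightarrow> 'v list \<Rightarrow> (nat \<Rightarrow> 'l) \<Rightarrow> 'l" where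
  "ext_form p L \<iota> \<phi> bs x =
     (\<Oplus>\<^bsub>L\<^esub>i\<in>{..<length bs}. \<iota> (\<phi> (bs ! i)) \<otimes>\<^bsub>L\<^esub> (x i [^]\<^bsub>L\<^esub> p))"

section \<open>Polynomials\<close>

text \<open>Polynomials in countably many variables; an exponent vector is a finitely supported map.\<close>

type_synonym 'a mpoly = "(nat \<Rightarrow>\<^sub>0 nat) \<Rightarrow>\<^sub>0 'a"

definition const_poly :: "'a::zero \<Rightarrow> 'a mpoly" where
  "const_poly c = Poly_Mapping.single 0 c"

text \<open>Homogeneous of degree \<open>d\<close> in the first \<open>n\<close> variables; as usual, \<open>0\<close> is homogeneous of
  every degree.\<close>

definition homogeneous :: "nat \<Rightarrow> nat \<Rightarrow> 'a::zero mpoly \<Rightarrow> bool" where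
  "homogeneous n d f \<longleftrightarrow>
     (\<forall>m\<in>Poly_Mapping.keys f.
        Poly_Mapping.keys m \<subseteq> {..<n} \<and> (\<Sum>i<n. Poly_Mapping.lookup m i) = d)"

definition subst_poly :: "(nat \<Rightarrow> 'a mpoly) \<Rightarrow> 'a::comm_semiring_1 mpoly \<Rightarrow> 'a mpoly" where
  "subst_poly f g =
     (\<Sum>m\<in>Poly_Mapping.keys g. const_poly (Poly_Mapping.lookup g m) *
        (\<Prod>i\<in>Poly_Mapping.keys m. f i ^ Poly_Mapping.lookup m i))"

section \<open>The hypersurface of a form and its function field\<close>

text \<open>The equation \<open>\<Sum> \<phi>(b\<^sub>i) x\<^sub>i\<^sup>p\<close> of \<open>X\<^sub>\<phi>\<close> in the homogeneous coordinates
  of \<open>\<bbbP>(V)\<close> given by \<open>bs\<close>.\<close>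

definition form_poly :: "nat \<Rightarrow> ('v \<Rightarrow> 'a::comm_semiring_1) \<Rightarrow> 'v list \<Rightarrow> 'a mpoly" where
  "form_poly p \<phi> bs =
     (\<Sum>i<length bs. Poly_Mapping.single (Poly_Mapping.single i p) (\<phi> (bs ! i)))"

text \<open>
  For anisotropic \<open>\<phi>\<close> of dimension at least two, \<open>X\<^sub>\<phi>\<close> is integral.  Its generic point, as a
  point of \<open>\<bbbP>(V)\<close>, is the homogeneous prime ideal \<open>(\<Phi>)\<close>, \<open>\<Phi>\<close> being the equation of
  \<open>X\<^sub>\<phi>\<close>.  The local ring of \<open>\<bbbP>(V)\<close> there consists of the fractions \<open>f/g\<close> of
  homogeneous polynomials of equal degree with \<open>\<Phi>\<close> not dividing \<open>g\<close>; the fractions with \<open>\<Phi>\<close>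
  dividing \<open>f\<close> form its maximal ideal, which is also the ideal of \<open>X\<^sub>\<phi>\<close>.  Hence the quotient
  is the local ring of \<open>X\<^sub>\<phi>\<close> at its generic point, that is, the function field.
\<close>

definition generic_local_ring ::
    "nat \<Rightarrow> ('v \<Rightarrow> 'a::field) \<Rightarrow> 'v list \<Rightarrow> 'a mpoly fract ring" where
  "generic_local_ring p \<phi> bs =
     \<lparr> carrier = {Fract f g | f g d. homogeneous (length bs) d f \<and> homogeneous (length bs) d g \<and>
                                    \<not> form_poly p \<phi> bs dvd g},
       mult = (*), one = 1, zero = 0, add = (+) \<rparr>"

definition generic_ideal ::
    "nat \<Rightarrow> ('v \<Rightarrow> 'a::field) \<Rightarrow> 'v list \<Rightarrow> 'a mpoly fract set" where
  "generic_ideal p \<phi> bs =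
     {Fract f g | f g d. homogeneous (length bs) d f \<and> homogeneous (length bs) d g \<and>
                         \<not> form_poly p \<phi> bs dvd g \<and> form_poly p \<phi> bs dvd f}"

definition function_field ::
    "nat \<Rightarrow> ('v \<Rightarrow> 'a::field) \<Rightarrow> 'v list \<Rightarrow> 'a mpoly fract set ring" where
  "function_field p \<phi> bs = generic_local_ring p \<phi> bs Quot generic_ideal p \<phi> bs"

definition function_field_embed ::
    "nat \<Rightarrow> ('v \<Rightarrow> 'a::field) \<Rightarrow> 'v list \<Rightarrow> 'a \<Rightarrow> 'a mpoly fract set" where
  "function_field_embed p \<phi> bs c =
     generic_ideal p \<phi> bs +>\<^bsub>generic_local_ring p \<phi> bs\<^esub> Fract (const_poly c) 1"

definition first_defect_index :: "nat \<Rightarrow> ('v \<Rightarrow> 'a::field) \<Rightarrow> 'v list \<Rightarrow> nat" where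
  "first_defect_index p \<phi> bs =
     defect_index (function_field p \<phi> bs) (ext_space (function_field p \<phi> bs) bs)
       (ext_form p (function_field p \<phi> bs) (function_field_embed p \<phi> bs) \<phi> bs)"

definition isotropic_over_function_field ::
    "nat \<Rightarrow> ('v \<Rightarrow> 'a::field) \<Rightarrow> 'v list \<Rightarrow> ('w \<Rightarrow> 'a) \<Rightarrow> 'w list \<Rightarrow> bool" where
  "isotropic_over_function_field p \<phi> bs \<psi> cs \<longleftrightarrow>
     isotropic (function_field p \<phi> bs) (ext_space (function_field p \<phi> bs) cs)
       (ext_form p (function_field p \<phi> bs) (function_field_embed p \<phi> bs) \<psi> cs)"

section \<open>Rational morphisms between hypersurfaces\<close>

text \<open>
  As \<open>X\<^sub>\<phi>\<close> is integral, a rational morphism from \<open>X\<^sub>\<phi>\<close> to the projective space containing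
  \<open>X\<^sub>\<psi>\<close> is given by a tuple of homogeneous polynomials of equal degree, not all vanishing on
  \<open>X\<^sub>\<phi>\<close>; it is defined over the base field since the polynomials are.  It maps to \<open>X\<^sub>\<psi>\<close> if the
  equation of \<open>X\<^sub>\<psi>\<close> pulls back to \<open>0\<close> on \<open>X\<^sub>\<phi>\<close>.  Two tuples give the same rational morphism
  if they agree on a nonempty open subset, that is, if they are proportional on \<open>X\<^sub>\<phi>\<close>.
\<close>

definition rational_tuples ::
    "nat \<Rightarrow> ('v \<Rightarrow> 'a::field) \<Rightarrow> 'v list \<Rightarrow> ('w \<Rightarrow> 'a) \<Rightarrow> 'w list \<Rightarrow> 'a mpoly list set" where
  "rational_tuples p \<phi> bs \<psi> cs =
     {fs. length fs = length cs \<and>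
          (\<exists>d. \<forall>f\<in>set fs. homogeneous (length bs) d f) \<and>
          (\<exists>f\<in>set fs. \<not> form_poly p \<phi> bs dvd f) \<and>
          form_poly p \<phi> bs dvd subst_poly ((!) fs) (form_poly p \<psi> cs)}"

definition same_rational_morphism ::
    "nat \<Rightarrow> ('v \<Rightarrow> 'a::field) \<Rightarrow> 'v list \<Rightarrow> ('w \<Rightarrow> 'a) \<Rightarrow> 'w list
       \<Rightarrow> ('a mpoly list \<times> 'a mpoly list) set" where
  "same_rational_morphism p \<phi> bs \<psi> cs =
     {(fs, gs). fs \<in> rational_tuples p \<phi> bs \<psi> cs \<and> gs \<in> rational_tuples p \<phi> bs \<psi> cs \<and>
        (\<forall>i<length cs. \<forall>j<length cs. form_poly p \<phi> bs dvd fs ! i * gs ! j - fs ! j * gs ! i)}"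

definition rational_morphisms ::
    "nat \<Rightarrow> ('v \<Rightarrow> 'a::field) \<Rightarrow> 'v list \<Rightarrow> ('w \<Rightarrow> 'a) \<Rightarrow> 'w list \<Rightarrow> 'a mpoly list set set" where
  "rational_morphisms p \<phi> bs \<psi> cs =
     rational_tuples p \<phi> bs \<psi> cs // same_rational_morphism p \<phi> bs \<psi> cs"

text \<open>
  The image is dense if every hypersurface \<open>{h = 0}\<close> containing it contains \<open>X\<^sub>\<psi>\<close>.  The image
  lies in \<open>{h = 0}\<close> iff \<open>h\<close> pulls back to \<open>0\<close> on the reduced scheme \<open>X\<^sub>\<phi>\<close>, and \<open>X\<^sub>\<psi>\<close> lies in
  \<open>{h = 0}\<close>, as a set, iff \<open>h\<close> is nilpotent modulo the equation of \<open>X\<^sub>\<psi>\<close>.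
\<close>

definition dominant ::
    "nat \<Rightarrow> ('v \<Rightarrow> 'a::field) \<Rightarrow> 'v list \<Rightarrow> ('w \<Rightarrow> 'a) \<Rightarrow> 'w list \<Rightarrow> 'a mpoly list set \<Rightarrow> bool" where
  "dominant p \<phi> bs \<psi> cs r \<longleftrightarrow>
     (\<forall>fs\<in>r. \<forall>h d. homogeneous (length cs) d h \<longrightarrow>
        form_poly p \<phi> bs dvd subst_poly ((!) fs) h \<longrightarrow>
        (\<exists>k. form_poly p \<psi> cs dvd h ^ k))"

end

theory Submission
  imports
    "HOL-Algebra.Algebraic_Closure_Type"
    "Jordan_Normal_Form.Char_Poly"
    "Jordan_Normal_Form.DL_Rank"
    Defs
begin

text \<open>
  Over an algebraic closure of \<open>F\<close> the equation \<open>\<Phi>\<close> of \<open>X\<^sub>\<phi>\<close> is the \<open>p\<close>-th power of a linear form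
  \<open>lin = \<Sum> \<alpha>\<^sub>i x\<^sub>i\<close>, and a polynomial over \<open>F\<close> divisible by \<open>lin\<close> is already divisible by \<open>\<Phi>\<close>.  So
  \<open>F(\<phi>)\<close> is a subfield of the function field of the hyperplane \<open>lin = 0\<close>, and the isotropic vectors of
  \<open>\<psi>\<close> over \<open>F(\<phi>)\<close> are the \<open>F(\<phi>)\<close>-linear relations between the \<open>p\<close>-th roots \<open>\<gamma>\<^sub>j\<close> of the
  coefficients of \<open>\<psi>\<close>.

  After clearing denominators such a relation is a tuple \<open>u\<close> of forms over \<open>F\<close>, not all divisible by
  \<open>\<Phi>\<close>, such that \<open>lin\<close> divides \<open>\<Sum> \<gamma>\<^sub>j u\<^sub>j\<close>.  As \<open>lin\<^sup>p\<close> does not, repeated differentiation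
  leads to a tuple with \<open>\<Sum> \<gamma>\<^sub>j u\<^sub>j = lin * g\<close> and \<open>g\<close> not divisible by \<open>lin\<close>.  One more derivative
  gives \<open>\<Sum> \<gamma>\<^sub>j \<partial>\<^sub>i u\<^sub>j = \<alpha>\<^sub>i g\<close> on the hyperplane, so that the \<open>F(\<phi>)\<close>-span of the \<open>\<gamma>\<^sub>j\<close>
  contains a multiple of the span of the \<open>\<alpha>\<^sub>i\<close>.  It is also contained in that span because \<open>\<psi>\<close> is a
  subform of \<open>\<phi>\<close>; hence both have the same dimension, which is the criterion for isotropy.

  If the codimension of \<open>\<psi>\<close> is the first defect index minus one, the relation is unique up to a
  factor, and with it the rational morphism.  The vectors \<open>\<partial>\<^sub>i u\<close> and \<open>u\<close> then span the whole space,
  since the images of the \<open>\<partial>\<^sub>i u\<close> under \<open>\<gamma>\<close> span the image of \<open>\<gamma>\<close> and \<open>u\<close> spans its kernel.  By the chain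
  rule and Euler's identity, a form \<open>H\<close> with \<open>H(u) = 0\<close> on the hyperplane therefore has a gradient at \<open>u\<close>
  proportional to \<open>\<gamma>\<close>.  Eliminating one variable by \<open>\<Sum> \<gamma>\<^sub>j y\<^sub>j = 0\<close> makes this gradient vanish; by
  induction on the degree \<open>H\<close> is then a \<open>p\<close>-th power of a form vanishing at \<open>u\<close>, and by induction again
  it is \<open>0\<close>.  So \<open>\<Sum> \<gamma>\<^sub>j y\<^sub>j\<close> divides every form vanishing at \<open>u\<close>, and the equation of \<open>X\<^sub>\<psi>\<close> divides
  those over \<open>F\<close>, which is dominance.
\<close>

hide_const (open) Divisibility.prime

section \<open>Polynomials and partial derivatives\<close>

abbreviation (input) var :: "nat \<Rightarrow> 'a::zero_neq_one mpoly" where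
  "var i \<equiv> Poly_Mapping.single (Poly_Mapping.single i 1) 1"

lemma mpoly_eq_sum_single:
  "f = (\<Sum>m\<in>Poly_Mapping.keys f. Poly_Mapping.single m (Poly_Mapping.lookup f m))"
proof (rule poly_mapping_eqI)
  fix k
  show "Poly_Mapping.lookup f k =
    Poly_Mapping.lookup (\<Sum>m\<in>Poly_Mapping.keys f. Poly_Mapping.single m (Poly_Mapping.lookup f m)) k"
    by (simp add: lookup_sum lookup_single when_def in_keys_iff)
qed

text \<open>The key type is left arbitrary so that the rule serves both for polynomials and for the
  exponent vectors of their terms, which are themselves finitely supported maps.\<close>

lemma mpoly_single_induct [case_names single add]:
  fixes f :: "'b \<Rightarrow>\<^sub>0 'a::comm_monoid_add"
  assumes single: "\<And>m c. P (Poly_Mapping.single m c)"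
    and add: "\<And>f g. P f \<Longrightarrow> P g \<Longrightarrow> P (f + g)"
  shows "P f"
proof -
  have "P (\<Sum>m\<in>A. Poly_Mapping.single m (Poly_Mapping.lookup f m))" if "finite A" for A
    using that
  proof induct
    case empty
    show ?case using single[of undefined 0] by simp
  next
    case (insert x F)
    then show ?case by (simp add: single add)
  qed
  from this[OF finite_keys, of f] show ?thesis
    unfolding mpoly_eq_sum_single[of f, symmetric] .
qed

lemma single_one_neq_0 [simp]: "Poly_Mapping.single m (1::'a::zero_neq_one) \<noteq> 0"
  by (metis lookup_single_eq lookup_zero zero_neq_one)

lemma const_poly_0 [simp]: "const_poly 0 = 0"
  and const_poly_1 [simp]: "const_poly 1 = 1"
  by (simp_all add: const_poly_def)

lemma const_poly_add: "const_poly (a + b) = const_poly a + const_poly b"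
  and const_poly_mult: "const_poly (a * b) = const_poly a * const_poly b" for a b :: "'a::comm_semiring_1"
  by (simp_all add: const_poly_def single_add mult_single)

interpretation const_poly: comm_ring_hom "const_poly :: 'a::comm_ring_1 \<Rightarrow> 'a mpoly"
  by unfold_locales (simp_all add: const_poly_add const_poly_mult)

lemma single_Suc_exponent:
  "Poly_Mapping.single (Poly_Mapping.single i (Suc n) + m) c
     = var i * Poly_Mapping.single (Poly_Mapping.single i n + m) (c::'a::comm_semiring_1)"
proof -
  have "Poly_Mapping.single i (Suc n) = Poly_Mapping.single i 1 + Poly_Mapping.single i n"
    by (simp flip: single_add)
  then show ?thesis by (simp add: mult_single add.assoc)
qed

lemma mpoly_induct [case_names const var add mult]:
  fixes f :: "'a::comm_semiring_1 mpoly"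
  assumes const: "\<And>c. P (const_poly c)" and var: "\<And>i. P (var i)"
    and add: "\<And>f g. P f \<Longrightarrow> P g \<Longrightarrow> P (f + g)"
    and mult: "\<And>f g. P f \<Longrightarrow> P g \<Longrightarrow> P (f * g)"
  shows "P f"
proof (induct f rule: mpoly_single_induct)
  case (single m c)
  show ?case
  proof (induct m arbitrary: c rule: mpoly_single_induct)
    case (single i n)
    show ?case
    proof (induct n)
      case 0
      then show ?case using const by (simp add: const_poly_def)
    next
      case (Suc n)
      show ?case
        using single_Suc_exponent[of i n 0 c] mult[OF var[of i] Suc] by simp
    qed
  next
    case (add m m')
    have "Poly_Mapping.single (m + m') c = Poly_Mapping.single m c * Poly_Mapping.single m' 1" for c :: 'a
      by (simp add: mult_single)
    then show ?case using add by (auto intro: mult)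
  qed
qed (rule add)

section \<open>Evaluation homomorphisms\<close>

definition mp_eval :: "('a \<Rightarrow> 'b) \<Rightarrow> (nat \<Rightarrow> 'b) \<Rightarrow> 'a::zero mpoly \<Rightarrow> 'b::comm_semiring_1" where
  "mp_eval h x f = (\<Sum>m\<in>Poly_Mapping.keys f. h (Poly_Mapping.lookup f m) *
     (\<Prod>i\<in>Poly_Mapping.keys m. x i ^ Poly_Mapping.lookup m i))"

lemma subst_poly_eq_mp_eval: "subst_poly = mp_eval const_poly"
  by (simp add: fun_eq_iff subst_poly_def mp_eval_def)

lemma mp_eval_cong:
  assumes "\<And>m i. m \<in> Poly_Mapping.keys f \<Longrightarrow> i \<in> Poly_Mapping.keys m \<Longrightarrow> x i = y i"
  shows "mp_eval h x f = mp_eval h y f"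
  unfolding mp_eval_def using assms by (intro sum.cong prod.cong refl arg_cong2[where f = "(*)"]) auto

lemma prod_keys_superset:
  assumes "finite S" "Poly_Mapping.keys m \<subseteq> S"
  shows "(\<Prod>i\<in>Poly_Mapping.keys m. (x i :: 'b::comm_semiring_1) ^ Poly_Mapping.lookup m i)
    = (\<Prod>i\<in>S. x i ^ Poly_Mapping.lookup m i)"
  by (rule prod.mono_neutral_left) (use assms in \<open>auto simp: in_keys_iff\<close>)

lemma prod_keys_add:
  "(\<Prod>i\<in>Poly_Mapping.keys (m + m'). (x i :: 'b::comm_semiring_1) ^ Poly_Mapping.lookup (m + m') i)
    = (\<Prod>i\<in>Poly_Mapping.keys m. x i ^ Poly_Mapping.lookup m i) *
      (\<Prod>i\<in>Poly_Mapping.keys m'. x i ^ Poly_Mapping.lookup m' i)"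
proof -
  let ?S = "Poly_Mapping.keys m \<union> Poly_Mapping.keys m'"
  have S: "finite ?S" "Poly_Mapping.keys (m + m') \<subseteq> ?S" by (simp_all add: keys_add)
  show ?thesis
    by (subst (1 2 3) prod_keys_superset[where S = ?S])
       (use S in \<open>auto simp: lookup_add power_add prod.distrib\<close>)
qed

text \<open>Substitution, restriction to a hyperplane and evaluation in a field of fractions are all
  instances of \<open>mp_eval\<close>; they differ only in the coefficient map \<open>h\<close> and
  the point \<open>x\<close>.\<close>

locale mp_evaluation = comm_ring_hom h
  for h :: "'a::comm_ring_1 \<Rightarrow> 'b::comm_ring_1" and x :: "nat \<Rightarrow> 'b"
begin

lemma eval_single:
  "mp_eval h x (Poly_Mapping.single m c)
     = h c * (\<Prod>i\<in>Poly_Mapping.keys m. x i ^ Poly_Mapping.lookup m i)"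
  by (simp add: mp_eval_def)

lemma eval_const: "mp_eval h x (const_poly c) = h c"
  by (simp add: const_poly_def eval_single)

lemma eval_var: "mp_eval h x (var i) = x i"
  by (simp add: eval_single)

lemma eval_add: "mp_eval h x (f + g) = mp_eval h x f + mp_eval h x g"
  unfolding mp_eval_def
  by (rule setsum_keys_plus_distrib) (simp_all add: hom_add distrib_right)

lemma eval_mult: "mp_eval h x (f * g) = mp_eval h x f * mp_eval h x g"
proof (induct f rule: mpoly_single_induct)
  case (single m c)
  show ?case
  proof (induct g rule: mpoly_single_induct)
    case (single m' c')
    show ?case by (simp add: mult_single eval_single prod_keys_add hom_mult)
  qed (simp add: algebra_simps eval_add)
qed (simp add: algebra_simps eval_add)

sublocale eval: comm_ring_hom "mp_eval h x"
  by unfold_locales (use eval_const[of 0] eval_const[of 1] in \<open>simp_all add: eval_add eval_mult\<close>)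

end

lemma mp_evaluationI: "comm_ring_hom h \<Longrightarrow> mp_evaluation h"
  by (simp add: mp_evaluation_def)

text \<open>Constants and variables generate the polynomial ring. Identities between composed
  evaluations are obtained from this.\<close>

lemma mpoly_hom_eqI:
  fixes h k :: "'a::comm_ring_1 mpoly \<Rightarrow> 'b::comm_ring_1"
  assumes "comm_ring_hom h" "comm_ring_hom k"
    and "\<And>c. h (const_poly c) = k (const_poly c)" "\<And>i. h (var i) = k (var i)"
  shows "h f = k f"
proof -
  interpret h: comm_ring_hom h by fact
  interpret k: comm_ring_hom k by fact
  show ?thesis
    by (induct f rule: mpoly_induct) (simp_all add: assms(3,4) h.hom_add k.hom_add h.hom_mult k.hom_mult del: One_nat_def)
qed

lemma comm_ring_hom_comp: "comm_ring_hom h \<Longrightarrow> comm_ring_hom k \<Longrightarrow> comm_ring_hom (\<lambda>x. h (k x))"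
  unfolding comm_ring_hom_def ring_hom_def semiring_hom_def comm_monoid_add_hom_def monoid_add_hom_def
    monoid_mult_hom_def one_hom_def zero_hom_def semigroup_mult_hom_def semigroup_add_hom_def
    times_hom_def plus_hom_def by simp

text \<open>Evaluation respects congruence modulo \<open>d\<close>. For products the difference
  telescopes as \<open>f(x)g(x) - f(y)g(y) = (f(x) - f(y))g(x) + f(y)(g(x) - g(y))\<close>.\<close>

lemma dvd_diff_mp_eval:
  fixes x y :: "nat \<Rightarrow> 'b::comm_ring_1"
  assumes h: "comm_ring_hom h" and d: "\<And>i. d dvd x i - y i"
  shows "d dvd mp_eval h x f - mp_eval h y f"
proof -
  interpret x: mp_evaluation h x by (rule mp_evaluationI) fact
  interpret y: mp_evaluation h y by (rule mp_evaluationI) fact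
  show ?thesis
  proof (induct f rule: mpoly_induct)
    case (const c)
    show ?case by (simp add: x.eval_const y.eval_const)
  next
    case (var i)
    show ?case using d[of i] by (simp only: x.eval_var y.eval_var)
  next
    case (add f g)
    then have "d dvd (mp_eval h x f - mp_eval h y f) + (mp_eval h x g - mp_eval h y g)" by (rule dvd_add)
    then show ?case by (simp add: x.eval_add y.eval_add algebra_simps)
  next
    case (mult f g)
    have "mp_eval h x (f * g) - mp_eval h y (f * g) = (mp_eval h x f - mp_eval h y f) * mp_eval h x g
        + mp_eval h y f * (mp_eval h x g - mp_eval h y g)"
      by (simp add: x.eval_mult y.eval_mult algebra_simps)
    then show ?case using mult by (metis dvd_add dvd_mult dvd_mult2)
  qed
qed

lemma mp_eval_comp:
  assumes "comm_ring_hom h" "comm_ring_hom k"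
  shows "k (mp_eval h x f) = mp_eval (\<lambda>c. k (h c)) (\<lambda>i. k (x i)) f"
proof -
  interpret k: comm_ring_hom k by fact
  interpret x: mp_evaluation h x by (rule mp_evaluationI) fact
  interpret y: mp_evaluation "\<lambda>c. k (h c)" "\<lambda>i. k (x i)" by (rule mp_evaluationI[OF comm_ring_hom_comp[OF assms(2,1)]])
  show ?thesis
    by (rule mpoly_hom_eqI[where h = "\<lambda>f. k (mp_eval h x f)", OF comm_ring_hom_comp[OF assms(2) x.eval.comm_ring_hom_axioms]
          y.eval.comm_ring_hom_axioms])
       (simp_all only: x.eval_const y.eval_const x.eval_var y.eval_var)
qed

lemma mp_eval_id: "mp_eval const_poly var f = (f :: 'a::comm_ring_1 mpoly)"
proof -
  interpret mp_evaluation const_poly "var :: nat \<Rightarrow> 'a mpoly"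
    by (rule mp_evaluationI) (rule const_poly.comm_ring_hom_axioms)
  have "comm_ring_hom (\<lambda>f :: 'a mpoly. f)" by unfold_locales simp_all
  then show ?thesis
    by (rule mpoly_hom_eqI[where k = "\<lambda>f. f", OF eval.comm_ring_hom_axioms])
       (simp_all only: eval_const eval_var)
qed

section \<open>Formal partial derivatives\<close>

definition pd :: "nat \<Rightarrow> 'a::comm_semiring_1 mpoly \<Rightarrow> 'a mpoly" where
  "pd i f = (\<Sum>m\<in>Poly_Mapping.keys f.
     Poly_Mapping.single (m - Poly_Mapping.single i 1) (of_nat (Poly_Mapping.lookup m i) * Poly_Mapping.lookup f m))"

lemma pd_single:
  "pd i (Poly_Mapping.single m c)
     = Poly_Mapping.single (m - Poly_Mapping.single i 1) (of_nat (Poly_Mapping.lookup m i) * c)"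
  by (simp add: pd_def)

lemma pd_add: "pd i (f + g) = pd i f + pd i g"
  unfolding pd_def
  by (rule setsum_keys_plus_distrib) (simp_all add: distrib_left single_add)

lemma pd_0 [simp]: "pd i 0 = 0" by (simp add: pd_def)

lemma pd_sum: "pd i (sum f A) = (\<Sum>a\<in>A. pd i (f a))"
  by (induct A rule: infinite_finite_induct) (simp_all add: pd_add)

lemma pd_const [simp]: "pd i (const_poly c) = 0"
  by (simp add: const_poly_def pd_single)

lemma pd_var: "pd i (var j) = (if i = j then 1 else 0)"
  by (auto simp: pd_single lookup_single when_def)

text \<open>Subtraction of exponents is truncated; positivity of the exponent is what lets it
  commute with the shift by \<open>m'\<close>.\<close>

lemma single_diff_add:
  assumes "Poly_Mapping.lookup m i > (0::nat)"
  shows "(m + m') - Poly_Mapping.single i 1 = (m - Poly_Mapping.single i 1) + m'"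
  by (rule poly_mapping_eqI) (use assms in \<open>auto simp: lookup_minus lookup_add lookup_single when_def\<close>)

lemma pd_mult: "pd i (f * g) = pd i f * g + f * pd i g"
proof (induct f rule: mpoly_single_induct)
  case (single m c)
  show ?case
  proof (induct g rule: mpoly_single_induct)
    case (single m' c')
    \<comment> \<open>A factor free of variable \<open>i\<close> has derivative \<open>0\<close>.
      Otherwise \<open>single_diff_add\<close> makes the truncated subtraction exact, and if both
      factors contain the variable the coefficient splits additively.\<close>
    consider "Poly_Mapping.lookup m i = 0" "Poly_Mapping.lookup m' i = 0" | "Poly_Mapping.lookup m i > 0" "Poly_Mapping.lookup m' i = 0"
      | "Poly_Mapping.lookup m i = 0" "Poly_Mapping.lookup m' i > 0" | "Poly_Mapping.lookup m i > 0" "Poly_Mapping.lookup m' i > 0"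
      by auto
    moreover have diff: "m + m' - Poly_Mapping.single i 1 = m + (m' - Poly_Mapping.single i 1)"
      if "Poly_Mapping.lookup m' i > 0"
      using single_diff_add[OF that, of m] by (simp add: add.commute)
    ultimately show ?case
    proof cases
      case 1
      then show ?thesis by (simp add: mult_single pd_single lookup_add)
    next
      case 2
      then show ?thesis
        by (simp add: mult_single pd_single lookup_add single_diff_add mult.assoc del: One_nat_def)
    next
      case 3
      then show ?thesis
        by (simp add: mult_single pd_single lookup_add diff mult.left_commute del: One_nat_def)
    next
      case 4
      have "pd i (Poly_Mapping.single m c * Poly_Mapping.single m' c')
          = Poly_Mapping.single (m + m' - Poly_Mapping.single i 1) (of_nat (Poly_Mapping.lookup m i) * (c * c'))
            + Poly_Mapping.single (m + m' - Poly_Mapping.single i 1) (of_nat (Poly_Mapping.lookup m' i) * (c * c'))"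
        by (simp add: mult_single pd_single lookup_add distrib_right flip: single_add)
      also have "\<dots> = pd i (Poly_Mapping.single m c) * Poly_Mapping.single m' c'
          + Poly_Mapping.single m c * pd i (Poly_Mapping.single m' c')"
        using 4 by (subst single_diff_add, simp, subst diff)
          (simp_all add: mult_single pd_single mult.assoc mult.left_commute del: One_nat_def)
      finally show ?thesis .
    qed
  qed (simp add: algebra_simps pd_add)
qed (simp add: algebra_simps pd_add)

text \<open>Only \<open>m\<close> plus the unit exponent of variable \<open>i\<close> can contribute
  to \<open>m\<close>. This formula later turns vanishing derivatives into divisibility of
  exponents.\<close>

lemma lookup_pd:
  "Poly_Mapping.lookup (pd i f) m
     = of_nat (Suc (Poly_Mapping.lookup m i)) * Poly_Mapping.lookup f (m + Poly_Mapping.single i 1)"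
proof (induct f rule: mpoly_single_induct)
  case (single m' c)
  let ?e = "Poly_Mapping.single i (1::nat)"
  consider "m' = m + ?e" | "m' \<noteq> m + ?e" "Poly_Mapping.lookup m' i = 0"
    | "m' \<noteq> m + ?e" "Poly_Mapping.lookup m' i > 0" by (cases "Poly_Mapping.lookup m' i") auto
  then show ?case
  proof cases
    case 1
    then show ?thesis by (simp add: pd_single lookup_add lookup_single)
  next
    case 2
    then show ?thesis by (simp add: pd_single lookup_single del: One_nat_def)
  next
    case 3
    have "m' = (m' - ?e) + ?e"
      by (rule poly_mapping_eqI) (use 3(2) in \<open>auto simp: lookup_minus lookup_add lookup_single when_def\<close>)
    with 3(1) have "m' - ?e \<noteq> m" by metis
    with 3 show ?thesis by (simp add: pd_single lookup_single del: One_nat_def)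
  qed
qed (simp add: pd_add lookup_add algebra_simps)

section \<open>Homogeneous polynomials\<close>

lemma homogeneous_0 [simp]: "homogeneous n d 0"
  by (simp add: homogeneous_def)

lemma homogeneous_add: "homogeneous n d f \<Longrightarrow> homogeneous n d g \<Longrightarrow> homogeneous n d (f + g)"
  using keys_add[of f g] by (auto simp: homogeneous_def)

lemma homogeneous_sum: "(\<And>i. i \<in> A \<Longrightarrow> homogeneous n d (f i)) \<Longrightarrow> homogeneous n d (sum f A)"
  by (induct A rule: infinite_finite_induct) (auto intro: homogeneous_add)

lemma homogeneous_uminus: "homogeneous n d f \<Longrightarrow> homogeneous n d (- f :: 'a::ab_group_add mpoly)"
  by (simp add: homogeneous_def in_keys_iff)

lemma homogeneous_mult:
  assumes "homogeneous n d f" "homogeneous n e g"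
  shows "homogeneous n (d + e) (f * g :: 'a::semiring_0 mpoly)"
  unfolding homogeneous_def
proof
  fix m assume "m \<in> Poly_Mapping.keys (f * g)"
  then obtain a b where m: "m = a + b" "a \<in> Poly_Mapping.keys f" "b \<in> Poly_Mapping.keys g"
    using keys_mult by blast
  then show "Poly_Mapping.keys m \<subseteq> {..<n} \<and> (\<Sum>i<n. Poly_Mapping.lookup m i) = d + e"
    using assms keys_add[of a b] by (fastforce simp: homogeneous_def lookup_add sum.distrib)
qed

lemma homogeneous_const [simp]: "homogeneous n 0 (const_poly c)"
  by (simp add: homogeneous_def const_poly_def)

lemma homogeneous_one [simp]: "homogeneous n 0 (1 :: 'a::comm_semiring_1 mpoly)"
  using homogeneous_const[of n "1 :: 'a"] by simp

lemma homogeneous_single_var: "i < n \<Longrightarrow> homogeneous n d (Poly_Mapping.single (Poly_Mapping.single i d) c)"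
  by (simp add: homogeneous_def lookup_single when_def)

lemma homogeneous_power: "homogeneous n d f \<Longrightarrow> homogeneous n (d * k) (f ^ k :: 'a::comm_semiring_1 mpoly)"
  by (induct k) (auto intro: homogeneous_mult)

lemma homogeneous_prod:
  "(\<And>i. i \<in> A \<Longrightarrow> homogeneous n (d i) (f i :: 'a::comm_semiring_1 mpoly)) \<Longrightarrow> homogeneous n (sum d A) (prod f A)"
  by (induct A rule: infinite_finite_induct) (auto intro: homogeneous_mult)

lemma homogeneous_mp_eval:
  assumes f: "homogeneous m e f" and x: "\<And>j. j < m \<Longrightarrow> homogeneous n d (x j)"
  shows "homogeneous n (d * e) (mp_eval (\<lambda>c. const_poly (h c)) x f :: 'a::comm_semiring_1 mpoly)"
  unfolding mp_eval_def
proof (rule homogeneous_sum)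
  fix k assume "k \<in> Poly_Mapping.keys f"
  then have k: "Poly_Mapping.keys k \<subseteq> {..<m}" "(\<Sum>i<m. Poly_Mapping.lookup k i) = e"
    using f by (auto simp: homogeneous_def)
  have "homogeneous n (\<Sum>i<m. d * Poly_Mapping.lookup k i) (\<Prod>i<m. x i ^ Poly_Mapping.lookup k i)"
    by (intro homogeneous_prod homogeneous_power x) simp
  then have "homogeneous n (d * e) (\<Prod>i<m. x i ^ Poly_Mapping.lookup k i)"
    using k by (simp flip: sum_distrib_left)
  from homogeneous_mult[OF homogeneous_const this]
  show "homogeneous n (d * e) (const_poly (h (Poly_Mapping.lookup f k)) *
      (\<Prod>i\<in>Poly_Mapping.keys k. x i ^ Poly_Mapping.lookup k i))"
    using k(1) by (simp add: prod_keys_superset[of "{..<m}"])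
qed

text \<open>Each term of \<open>f\<close> has \<open>e\<close> factors, all among the first
  \<open>m\<close> coordinates. The lemma transfers vanishing at a tuple to every proportional
  one.\<close>

lemma mp_eval_scale:
  fixes x :: "nat \<Rightarrow> 'b::comm_semiring_1"
  assumes "homogeneous m e f" "\<forall>j<m. x j = c * y j"
  shows "mp_eval h x f = c ^ e * mp_eval h y f"
  unfolding mp_eval_def sum_distrib_left
proof (rule sum.cong)
  fix k assume "k \<in> Poly_Mapping.keys f"
  then have k: "Poly_Mapping.keys k \<subseteq> {..<m}" "(\<Sum>i<m. Poly_Mapping.lookup k i) = e"
    using assms(1) by (auto simp: homogeneous_def)
  have "(\<Sum>i\<in>Poly_Mapping.keys k. Poly_Mapping.lookup k i) = e"
    unfolding k(2)[symmetric] by (rule sum.mono_neutral_left) (use k(1) in \<open>auto simp: in_keys_iff\<close>)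
  then have "(\<Prod>i\<in>Poly_Mapping.keys k. x i ^ Poly_Mapping.lookup k i)
      = c ^ e * (\<Prod>i\<in>Poly_Mapping.keys k. y i ^ Poly_Mapping.lookup k i)"
    using k(1) assms(2) by (simp add: subset_iff power_mult_distrib prod.distrib flip: power_sum cong: prod.cong)
  then show "h (Poly_Mapping.lookup f k) * (\<Prod>i\<in>Poly_Mapping.keys k. x i ^ Poly_Mapping.lookup k i)
      = c ^ e * (h (Poly_Mapping.lookup f k) * (\<Prod>i\<in>Poly_Mapping.keys k. y i ^ Poly_Mapping.lookup k i))"
    by (simp add: ac_simps)
qed simp

text \<open>For \<open>d = 0\<close> the truncated \<open>d - 1\<close> does no harm: a monomial of
  the derivative would come from one of positive degree, so the derivative is
  \<open>0\<close>.\<close>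

lemma homogeneous_pd:
  assumes "homogeneous n d f"
  shows "homogeneous n (d - 1) (pd i f)"
  unfolding homogeneous_def
proof
  fix m assume "m \<in> Poly_Mapping.keys (pd i f)"
  then have "Poly_Mapping.lookup f (m + Poly_Mapping.single i 1) \<noteq> 0"
    by (auto simp: in_keys_iff lookup_pd)
  then have 1: "Poly_Mapping.keys (m + Poly_Mapping.single i 1) \<subseteq> {..<n}"
      "(\<Sum>j<n. Poly_Mapping.lookup (m + Poly_Mapping.single i 1) j) = d"
    using assms unfolding homogeneous_def by (metis in_keys_iff)+
  have "Poly_Mapping.lookup (m + Poly_Mapping.single i 1) i \<noteq> 0" by (simp add: lookup_add)
  then have "i \<in> Poly_Mapping.keys (m + Poly_Mapping.single i 1)" by (simp only: in_keys_iff not_False_eq_True)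
  then have i: "i < n" using 1(1) by auto
  have "(\<Sum>j<n. Poly_Mapping.lookup m j) + 1 = d"
    using 1(2) i by (simp add: lookup_add sum.distrib lookup_single when_def)
  moreover have "Poly_Mapping.keys m \<subseteq> {..<n}"
    using 1(1) by (auto simp: in_keys_iff lookup_add subset_iff)
  ultimately show "Poly_Mapping.keys m \<subseteq> {..<n} \<and> (\<Sum>j<n. Poly_Mapping.lookup m j) = d - 1" by auto
qed

text \<open>Multiplying \<open>pd i\<close> of a monomial by variable \<open>i\<close> restores the
  monomial with its exponent as a factor; the exponents add up to the degree.\<close>

lemma euler_identity:
  assumes f: "homogeneous n d f"
  shows "(\<Sum>i<n. var i * pd i f) = of_nat d * f"
proof -
  have "(\<Sum>i<n. var i * pd i (Poly_Mapping.single m c)) = of_nat d * Poly_Mapping.single m c"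
    if "(\<Sum>i<n. Poly_Mapping.lookup m i) = d" for m and c :: 'a
  proof -
    have "var i * pd i (Poly_Mapping.single m c) = of_nat (Poly_Mapping.lookup m i) * Poly_Mapping.single m c" for i
    proof (cases "Poly_Mapping.lookup m i = 0")
      case True
      then show ?thesis by (simp add: pd_single)
    next
      case False
      have "Poly_Mapping.single i 1 + (m - Poly_Mapping.single i 1) = m"
        by (rule poly_mapping_eqI) (use False in \<open>auto simp: lookup_minus lookup_add lookup_single when_def\<close>)
      then show ?thesis by (simp add: pd_single mult_single flip: single_of_nat del: One_nat_def)
    qed
    then show ?thesis using that by (simp flip: sum_distrib_right of_nat_sum)
  qed
  then have "(\<Sum>i<n. var i * pd i (\<Sum>m\<in>Poly_Mapping.keys f. Poly_Mapping.single m (Poly_Mapping.lookup f m)))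
    = of_nat d * (\<Sum>m\<in>Poly_Mapping.keys f. Poly_Mapping.single m (Poly_Mapping.lookup f m))"
    unfolding pd_sum sum_distrib_left
    by (subst sum.swap, intro sum.cong refl) (use f in \<open>simp add: homogeneous_def sum_distrib_left\<close>)
  then show ?thesis unfolding mpoly_eq_sum_single[of f, symmetric] .
qed

section \<open>Change of coefficients\<close>

definition coeff_map :: "('a \<Rightarrow> 'b) \<Rightarrow> 'a::zero mpoly \<Rightarrow> 'b::zero mpoly" where
  "coeff_map h f = Poly_Mapping.map h f"

lemma lookup_coeff_map: "h 0 = 0 \<Longrightarrow> Poly_Mapping.lookup (coeff_map h f) m = h (Poly_Mapping.lookup f m)"
  by (simp add: coeff_map_def map.rep_eq when_def)

lemma coeff_map_single: "h 0 = 0 \<Longrightarrow> coeff_map h (Poly_Mapping.single m c) = Poly_Mapping.single m (h c)"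
  by (rule poly_mapping_eqI) (simp add: lookup_coeff_map lookup_single when_def)

lemma coeff_map_add:
  assumes "h 0 = 0" "\<And>a b. h (a + b) = h a + h b"
  shows "coeff_map h (f + g) = coeff_map h f + coeff_map h g"
  by (rule poly_mapping_eqI) (simp add: lookup_coeff_map lookup_add assms)

lemma coeff_map_0: "h 0 = 0 \<Longrightarrow> coeff_map h 0 = 0"
  by (rule poly_mapping_eqI) (simp add: lookup_coeff_map)

lemma coeff_map_sum:
  assumes "h 0 = 0" "\<And>a b. h (a + b) = h a + h b"
  shows "coeff_map h (sum f A) = (\<Sum>i\<in>A. coeff_map h (f i))"
  by (induct A rule: infinite_finite_induct) (simp_all add: coeff_map_add coeff_map_0 assms)

lemma keys_coeff_map: "h 0 = 0 \<Longrightarrow> Poly_Mapping.keys (coeff_map h f) \<subseteq> Poly_Mapping.keys f"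
  by (auto simp: in_keys_iff lookup_coeff_map)

lemma homogeneous_coeff_map: "h 0 = 0 \<Longrightarrow> homogeneous n d f \<Longrightarrow> homogeneous n d (coeff_map h f)"
  using keys_coeff_map[of h f] by (auto simp: homogeneous_def)

text \<open>\<open>L\<close> maps the large ring down to the small one and is linear over the image
  of \<open>h\<close>; applied coefficientwise it is linear over polynomials from the small ring.
  With linear functionals for \<open>L\<close> this isolates single components of sums such as
  \<open>tuple_sum\<close>.\<close>

lemma coeff_map_semilinear:
  fixes h :: "'a::comm_semiring_1 \<Rightarrow> 'b::comm_semiring_1" and L :: "'b \<Rightarrow> 'a"
  assumes "L 0 = 0" "h 0 = 0" "\<And>a b. L (a + b) = L a + L b" "\<And>a b. h (a + b) = h a + h b"
    and "\<And>c w. L (h c * w) = c * L w"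
  shows "coeff_map L (coeff_map h f * g) = f * coeff_map L g"
proof (induct f rule: mpoly_single_induct)
  case (single m c)
  show ?case
    by (induct g rule: mpoly_single_induct)
      (simp_all add: coeff_map_single coeff_map_add assms mult_single distrib_left)
qed (simp add: coeff_map_add assms distrib_right)

lemma (in comm_ring_hom) coeff_map_hom: "comm_ring_hom (coeff_map hom)"
proof
  show "coeff_map hom 0 = 0" "coeff_map hom 1 = 1"
    using coeff_map_single[of hom 0 0] coeff_map_single[of hom 0 1] by simp_all
  show add: "coeff_map hom (f + g) = coeff_map hom f + coeff_map hom g" for f g
    by (simp add: coeff_map_add hom_add)
  show "coeff_map hom (f * g) = coeff_map hom f * coeff_map hom g" for f g
  proof (induct f rule: mpoly_single_induct)
    case (single m c)
    show ?case
      by (induct g rule: mpoly_single_induct)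
        (simp_all add: coeff_map_single add mult_single hom_mult distrib_left)
  qed (simp add: add distrib_right)
qed

lemma (in comm_ring_hom) coeff_map_const: "coeff_map hom (const_poly c) = const_poly (hom c)"
  by (simp add: const_poly_def coeff_map_single)

lemma (in comm_ring_hom) coeff_map_var: "coeff_map hom (var i) = var i"
  by (simp add: coeff_map_single)

lemma (in comm_ring_hom) pd_coeff_map: "pd i (coeff_map hom f) = coeff_map hom (pd i f)"
  by (rule poly_mapping_eqI) (simp add: lookup_pd lookup_coeff_map hom_mult hom_add hom_of_nat)

lemma (in comm_ring_hom) mp_eval_coeff_map:
  assumes k: "comm_ring_hom k"
  shows "mp_eval k x (coeff_map hom f) = mp_eval (\<lambda>c. k (hom c)) x f"
proof -
  interpret k: mp_evaluation k x by (rule mp_evaluationI) fact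
  have kh: "comm_ring_hom (\<lambda>c. k (hom c))" by (rule comm_ring_hom_comp[OF k comm_ring_hom_axioms])
  interpret kh: mp_evaluation "\<lambda>c. k (hom c)" x by (rule mp_evaluationI) fact
  show ?thesis
    by (rule mpoly_hom_eqI[where h = "\<lambda>f. mp_eval k x (coeff_map hom f)",
          OF comm_ring_hom_comp[OF k.eval.comm_ring_hom_axioms coeff_map_hom] kh.eval.comm_ring_hom_axioms])
      (simp_all only: coeff_map_const coeff_map_var k.eval_const kh.eval_const k.eval_var kh.eval_var)
qed

lemma CHAR_mpoly: "CHAR('a::comm_semiring_1 mpoly) = CHAR('a)"
proof (rule CHAR_eqI)
  show "of_nat (CHAR('a)) = (0 :: 'a mpoly)" using single_of_nat[of "CHAR('a)", where ?'b = 'a] by (metis of_nat_CHAR single_zero)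
next
  fix n assume "of_nat n = (0 :: 'a mpoly)"
  then have "Poly_Mapping.lookup (of_nat n :: 'a mpoly) 0 = 0" by simp
  then show "CHAR('a) dvd n" by (simp add: lookup_of_nat of_nat_eq_0_iff_char_dvd)
qed

text \<open>The chain rule. The tuple is \<open>0\<close> from \<open>n\<close> on, which bounds the
  sum although \<open>f\<close> may contain any variable.\<close>

lemma pd_mp_eval:
  fixes u :: "nat \<Rightarrow> 'a::comm_ring_1 mpoly"
  assumes u: "\<And>j. j \<ge> n \<Longrightarrow> u j = 0"
  shows "pd i (mp_eval const_poly u f) = (\<Sum>j<n. mp_eval const_poly u (pd j f) * pd i (u j))"
proof -
  interpret mp_evaluation const_poly u by (rule mp_evaluationI) (rule const_poly.comm_ring_hom_axioms)
  show ?thesis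
  proof (induct f rule: mpoly_induct)
    case (const c)
    then show ?case by (simp add: eval_const)
  next
    case (var k)
    have "(\<Sum>j<n. mp_eval const_poly u (pd j (var k)) * pd i (u j)) = (\<Sum>j<n. if j = k then pd i (u j) else 0)"
      by (rule sum.cong) (simp_all add: pd_var del: One_nat_def)
    also have "\<dots> = pd i (u k)" using u[of k] by (auto simp: not_less)
    finally show ?case by (simp add: eval_var del: One_nat_def)
  next
    case (add f g)
    then show ?case by (simp add: eval_add pd_add distrib_right sum.distrib)
  next
    case (mult f g)
    then show ?case
      by (simp add: eval_mult eval_add pd_mult distrib_right distrib_left sum.distrib sum_distrib_left sum_distrib_right ac_simps)
  qed
qed

section \<open>Hyperplanes and power forms\<close>

text \<open>An element whose \<open>p\<close>-th power lies in the base ring and which is not in its fraction field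
  has degree \<open>p\<close>: a polynomial \<open>G\<close> of minimal degree \<open>r\<close> vanishing at \<open>t\<close> pseudo-divides
  \<open>(Y - t)\<^sup>p\<close> and has \<open>t\<close> as a simple root, so the cofactor vanishes at \<open>t\<close> to order \<open>p - 1\<close>
  although its degree is \<open>p - r\<close>.\<close>

lemma poly_purely_inseparable_neq_0:
  fixes h :: "'a::idom \<Rightarrow> 'b::idom" and t :: 'b
  assumes h: "inj_idom_hom h" and p: "prime p" and char: "CHAR('b) = p" and t: "t ^ p = h b"
    and notin: "\<And>f g. h f * t = h g \<Longrightarrow> f = 0"
    and G: "G \<noteq> 0" "degree G < p"
  shows "poly (map_poly h G) t \<noteq> 0"
proof
  assume G0: "poly (map_poly h G) t = 0"
  interpret h: inj_idom_hom h by fact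
  interpret mh: map_poly_inj_idom_hom h ..
  have char_a: "CHAR('a) = p"
  proof (rule CHAR_eqI)
    have "h (of_nat p) = 0" using char by (simp add: h.hom_of_nat of_nat_eq_0_iff_char_dvd)
    then show "of_nat p = (0::'a)" by simp
  next
    fix k assume "of_nat k = (0::'a)"
    then have "h (of_nat k) = 0" by simp
    then show "p dvd k" using char by (simp add: h.hom_of_nat of_nat_eq_0_iff_char_dvd)
  qed
  \<comment> \<open>The polynomial of minimal degree in the argument is \<open>H\<close>, chosen
    below; \<open>G\<close> itself may have larger degree.\<close>
  define Q where "Q H \<longleftrightarrow> H \<noteq> 0 \<and> poly (map_poly h H) t = 0" for H
  have "Q G" using G G0 by (simp add: Q_def)
  then obtain H where H: "Q H" and least: "\<And>H'. Q H' \<Longrightarrow> degree H \<le> degree H'"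
    using ex_has_least_nat[of Q G degree] by blast
  define r where "r = degree H"
  have "r < p" using least[OF \<open>Q G\<close>] G by (simp add: r_def)
  have "r \<noteq> 0"
  proof
    assume "r = 0"
    then obtain c where "H = [:c:]" by (auto simp: r_def elim: degree_eq_zeroE)
    with H show False by (auto simp: Q_def)
  qed
  define Z where "Z = [:-t, 1:]"
  define P where "P = monom 1 p - [:b:]"
  have Z0: "Z \<noteq> 0" by (simp add: Z_def)
  have "Z ^ p = map_poly h P"
  proof -
    have ch: "CHAR('b poly) = p" using char by simp
    have "Z = monom 1 1 + [:-t:]" by (simp add: Z_def monom_altdef)
    then have "Z ^ p = monom 1 1 ^ p + [:-t:] ^ p"
      using freshmans_dream[where ?'a = "'b poly", OF _ ch[symmetric]] p by (simp only: ch)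
    \<comment> \<open>Reading the sign off from \<open>(- t + t) ^ p = 0\<close> avoids a separate
      case for \<open>p = 2\<close>.\<close>
    moreover have "(- t) ^ p = - h b"
    proof -
      have "(- t) ^ p + t ^ p = (- t + t) ^ p"
        using freshmans_dream[where ?'a = 'b, OF _ char[symmetric]] p by (simp only: char)
      also have "\<dots> = 0" using prime_gt_0_nat[OF p] by simp
      finally show ?thesis unfolding t by (rule eq_neg_iff_add_eq_0[THEN iffD2])
    qed
    ultimately show ?thesis
      by (simp add: P_def mh.hom_minus monom_power poly_const_pow map_poly_monom h.map_poly_pCons_hom)
  qed
  obtain q R where qR: "pseudo_divmod P H = (q, R)" using prod.exhaust by blast
  have "H \<noteq> 0" using H by (simp add: Q_def)
  note pd = pseudo_divmod[OF this qR]
  define c where "c = coeff H (degree H) ^ (Suc (degree P) - degree H)"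
  have "c \<noteq> 0" using \<open>H \<noteq> 0\<close> by (simp add: c_def)
  have eq: "smult c P = H * q + R" using pd(1) by (simp add: c_def)
  \<comment> \<open>\<open>P\<close> and \<open>H\<close> vanish at \<open>t\<close>, hence so does
    \<open>R\<close>, and its degree is too small for a nonzero polynomial with this
    property.\<close>
  have "R = 0"
  proof (rule ccontr)
    assume "R \<noteq> 0"
    have "poly (map_poly h (smult c P)) t = 0"
    proof -
      have "poly Z t = 0" by (simp add: Z_def)
      then have "poly (Z ^ p) t = 0" unfolding poly_power using prime_gt_0_nat[OF p] by simp
      then show ?thesis unfolding h.map_poly_hom_smult \<open>Z ^ p = map_poly h P\<close> poly_smult by simp
    qed
    then have "poly (map_poly h H) t * poly (map_poly h q) t + poly (map_poly h R) t = 0"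
      unfolding eq by (simp only: mh.hom_add mh.hom_mult poly_add poly_mult)
    moreover have "poly (map_poly h H) t = 0" using H unfolding Q_def by (rule conjunct2)
    ultimately have "poly (map_poly h R) t = 0" by (simp only: mult_zero_left add_0_left)
    with \<open>R \<noteq> 0\<close> have "Q R" unfolding Q_def by (rule conjI)
    from least[OF this] pd(2) \<open>R \<noteq> 0\<close> show False by linarith
  qed
  with eq have cP: "smult c P = H * q" by (simp only: add_0_right)
  have degP: "degree P = p"
  proof -
    have m: "degree (monom (1::'a) p) = p" by (rule degree_monom_eq) simp
    have "degree (- [:b:]) < degree (monom (1::'a) p)" unfolding m using prime_gt_0_nat[OF p] by simp
    from degree_add_eq_left[OF this] show ?thesis unfolding P_def diff_conv_add_uminus m .
  qed
  have "q \<noteq> 0"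
  proof
    assume "q = 0"
    then have "smult c P = 0" unfolding cP by (simp only: mult_zero_right)
    then have "P = 0" using \<open>c \<noteq> 0\<close> by simp
    with degP prime_gt_0_nat[OF p] show False by simp
  qed
  have "p = degree (smult c P)" using \<open>c \<noteq> 0\<close> degP by simp
  also have "\<dots> = r + degree q"
    unfolding cP r_def using \<open>H \<noteq> 0\<close> \<open>q \<noteq> 0\<close> by (rule degree_mult_eq)
  finally have degq: "p = r + degree q" .
  define H' where "H' = map_poly h H"
  obtain H1 where H1: "H' = Z * H1"
    using H unfolding Q_def H'_def Z_def poly_eq_0_iff_dvd dvd_def by blast
  \<comment> \<open>The top coefficient of the derivative is \<open>r\<close> times that of
    \<open>H\<close>, and \<open>0 < r < p\<close>. By minimality the derivative then cannot vanish
    at \<open>t\<close>, so \<open>t\<close> is a simple root of \<open>H\<close>.\<close>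
  have "pderiv H \<noteq> 0"
  proof
    assume "pderiv H = 0"
    then have "of_nat (Suc (r - 1)) * coeff H (Suc (r - 1)) = 0"
      using coeff_pderiv[of H "r - 1"] by (simp only: coeff_0)
    moreover have "Suc (r - 1) = r" using \<open>r \<noteq> 0\<close> by simp
    moreover have "coeff H r \<noteq> 0" using \<open>H \<noteq> 0\<close> unfolding r_def by (rule leading_coeff_neq_0)
    ultimately have "of_nat r = (0::'a)" by (simp only: mult_eq_0_iff) simp
    then have "p dvd r" by (simp only: of_nat_eq_0_iff_char_dvd char_a)
    then show False using \<open>r \<noteq> 0\<close> \<open>r < p\<close> by (simp add: nat_dvd_not_less)
  qed
  have "poly (map_poly h (pderiv H)) t \<noteq> 0"
  proof
    assume "poly (map_poly h (pderiv H)) t = 0"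
    with \<open>pderiv H \<noteq> 0\<close> have "Q (pderiv H)" unfolding Q_def by (rule conjI)
    from least[OF this] degree_pderiv_le[of H] have "r \<le> r - 1" unfolding r_def by (rule le_trans)
    with \<open>r \<noteq> 0\<close> show False by simp
  qed
  then have "poly (pderiv (Z * H1)) t \<noteq> 0"
    unfolding H1[symmetric] H'_def h.map_poly_pderiv .
  moreover have "poly (pderiv (Z * H1)) t = poly H1 t"
    unfolding pderiv_mult poly_add poly_mult by (simp add: Z_def pderiv_pCons)
  ultimately have "poly H1 t \<noteq> 0" by simp
  have "smult (h c) (Z ^ p) = map_poly h (smult c P)"
    by (simp only: h.map_poly_hom_smult \<open>Z ^ p = map_poly h P\<close>)
  also have "\<dots> = map_poly h H * map_poly h q" unfolding cP by (rule mh.hom_mult)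
  also have "map_poly h H = Z * H1" using H1 unfolding H'_def .
  finally have "smult (h c) (Z ^ p) = Z * H1 * map_poly h q" .
  moreover have "Z ^ p = Z * Z ^ (p - 1)"
    using power_minus_mult[OF prime_gt_0_nat[OF p], of Z] by (simp only: mult.commute)
  ultimately have "Z * smult (h c) (Z ^ (p - 1)) = Z * (H1 * map_poly h q)"
    by (simp only: mult_smult_right mult.assoc)
  then have "smult (h c) (Z ^ (p - 1)) = H1 * map_poly h q" by (rule mult_left_cancel[THEN iffD1, OF Z0])
  \<comment> \<open>As \<open>H1\<close> does not vanish at \<open>t\<close>, the whole order
    \<open>p - 1\<close> falls on the cofactor: \<open>p - 1 \<le> degree q = p - r\<close>, so
    \<open>r = 1\<close>. A linear \<open>H\<close> is excluded by \<open>notin\<close>.\<close>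
  then have "order t (H1 * map_poly h q) = order t (smult (h c) (Z ^ (p - 1)))" by (simp only:)
  also have "\<dots> = p - 1"
    using order_power_n_n[of t "p - 1"] \<open>c \<noteq> 0\<close> unfolding Z_def by (subst order_smult) simp_all
  finally have "p - 1 = order t (H1 * map_poly h q)" by (rule sym)
  also have "\<dots> = order t (map_poly h q)"
  proof -
    have "H1 \<noteq> 0" using \<open>poly H1 t \<noteq> 0\<close> by (metis poly_0)
    moreover have "map_poly h q \<noteq> 0" using \<open>q \<noteq> 0\<close> by (simp only: mh.hom_0_iff not_False_eq_True)
    ultimately show ?thesis using order_mult[of H1 "map_poly h q" t] order_0I[OF \<open>poly H1 t \<noteq> 0\<close>]
      by (simp only: mult_eq_0_iff) simp
  qed
  also have "\<dots> \<le> degree (map_poly h q)" 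
    using \<open>q \<noteq> 0\<close> by (intro order_degree) (simp only: mh.hom_0_iff not_False_eq_True)
  also have "\<dots> \<le> degree q" by (rule degree_map_poly_le)
  finally have "r = 1" using degq \<open>r \<noteq> 0\<close> by simp
  then obtain g0 g1 where g: "H = [:g0, g1:]"
    using degree1_coeffs[of H] unfolding r_def by blast
  then have "h g1 * t = h (- g0)"
    using H by (simp add: Q_def h.hom_uminus eq_neg_iff_add_eq_0 h.map_poly_pCons_hom algebra_simps)
  then have "g1 = 0" by (rule notin)
  with g \<open>r = 1\<close> show False by (simp add: r_def)
qed

section \<open>Hyperplanes and elimination of a variable\<close>

definition linear_form :: "nat \<Rightarrow> (nat \<Rightarrow> 'b) \<Rightarrow> 'b::field mpoly" where
  "linear_form n \<alpha> = (\<Sum>i<n. const_poly (\<alpha> i) * var i)"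

text \<open>Solving the equation \<open>linear_form n \<alpha> = 0\<close> for the variable \<open>0\<close>.\<close>

definition hyperplane_point :: "nat \<Rightarrow> (nat \<Rightarrow> 'b) \<Rightarrow> nat \<Rightarrow> 'b::field mpoly" where
  "hyperplane_point n \<alpha> i =
     (if i = 0 then - (\<Sum>j\<in>{1..<n}. const_poly (\<alpha> j / \<alpha> 0) * var j) else var i)"

abbreviation hyperplane_restrict :: "nat \<Rightarrow> (nat \<Rightarrow> 'b) \<Rightarrow> 'b mpoly \<Rightarrow> 'b::field mpoly" where
  "hyperplane_restrict n \<alpha> \<equiv> mp_eval const_poly (hyperplane_point n \<alpha>)"

lemma sum_lessThan_split_0:
  "0 < n \<Longrightarrow> (\<Sum>i<n::nat. f i) = f 0 + (\<Sum>i\<in>{1..<n}. f i :: 'c::comm_monoid_add)"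
  using sum.atLeast_Suc_lessThan[of 0 n f] by (simp add: lessThan_atLeast0)

lemma const_poly_inverse: "c \<noteq> 0 \<Longrightarrow> const_poly (inverse c) * const_poly c = (1 :: 'b::field mpoly)"
  by (simp flip: const_poly_mult)

lemma pd_linear_form: "i < n \<Longrightarrow> pd i (linear_form n \<alpha>) = const_poly (\<alpha> i)"
proof -
  assume "i < n"
  have "pd i (linear_form n \<alpha>) = (\<Sum>j<n. if i = j then const_poly (\<alpha> j) else 0)"
    unfolding linear_form_def pd_sum by (intro sum.cong refl) (simp add: pd_mult pd_var del: One_nat_def)
  with \<open>i < n\<close> show ?thesis by simp
qed

lemma pd_uminus: "pd i (- f) = - pd i (f :: 'a::comm_ring_1 mpoly)"
  using pd_add[of i f "- f"] by (metis add.right_inverse minus_unique pd_0)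

lemma pd_power: "pd i (f ^ k) = of_nat k * f ^ (k - 1) * pd i f"
proof (induct k)
  case 0
  show ?case using pd_const[of i 1] by simp
next
  case (Suc k)
  then show ?case by (cases k) (simp_all add: pd_mult algebra_simps)
qed

lemma homogeneous_var [simp]: "i < n \<Longrightarrow> homogeneous n 1 (var i)"
  by (rule homogeneous_single_var)

locale hyperplane =
  fixes n :: nat and \<alpha> :: "nat \<Rightarrow> 'b::field"
  assumes n_pos: "0 < n" and \<alpha>0: "\<alpha> 0 \<noteq> 0"
begin

abbreviation "lin \<equiv> linear_form n \<alpha>"
abbreviation "red \<equiv> hyperplane_restrict n \<alpha>"

sublocale restr: mp_evaluation const_poly "hyperplane_point n \<alpha>"
  by (rule mp_evaluationI) (rule const_poly.comm_ring_hom_axioms)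

lemma linear_form_eq:
  "lin = const_poly (\<alpha> 0) * (var 0 - hyperplane_point n \<alpha> 0)"
proof -
  have "const_poly (\<alpha> 0) * (const_poly (\<alpha> j / \<alpha> 0) * var j) = const_poly (\<alpha> j) * var j" for j
    unfolding mult.assoc[symmetric] const_poly_mult[symmetric] using \<alpha>0 by simp
  then have "const_poly (\<alpha> 0) * (\<Sum>j\<in>{1..<n}. const_poly (\<alpha> j / \<alpha> 0) * var j)
      = (\<Sum>j\<in>{1..<n}. const_poly (\<alpha> j) * var j)"
    by (simp only: sum_distrib_left)
  then show ?thesis
    using n_pos by (simp add: linear_form_def hyperplane_point_def sum_lessThan_split_0 distrib_left del: One_nat_def)
qed

lemma hyperplane_point_dvd: "lin dvd var i - hyperplane_point n \<alpha> i"
proof (cases "i = 0")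
  case True
  have "const_poly (inverse (\<alpha> 0)) * lin = var 0 - hyperplane_point n \<alpha> 0"
    unfolding linear_form_eq using const_poly_inverse[OF \<alpha>0] by (simp flip: mult.assoc)
  then show ?thesis using True by (metis dvd_triv_right)
qed (simp add: hyperplane_point_def)

text \<open>Restriction moves each variable by a multiple of \<open>lin\<close>, so it moves every
  polynomial by one.\<close>

lemma restrict_dvd_diff: "lin dvd f - red f"
  using dvd_diff_mp_eval[OF const_poly.comm_ring_hom_axioms, of lin var "hyperplane_point n \<alpha>" f]
    hyperplane_point_dvd by (simp only: mp_eval_id)

lemma restrict_hyperplane_point: "red (hyperplane_point n \<alpha> i) = hyperplane_point n \<alpha> i"
proof (cases "i = 0")
  case True
  have "red (\<Sum>j\<in>{1..<n}. const_poly (\<alpha> j / \<alpha> 0) * var j) = (\<Sum>j\<in>{1..<n}. const_poly (\<alpha> j / \<alpha> 0) * var j)"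
    unfolding restr.eval.hom_sum restr.eval_mult restr.eval_const restr.eval_var
    by (intro sum.cong) (auto simp: hyperplane_point_def)
  then show ?thesis using True by (simp add: hyperplane_point_def restr.eval.hom_uminus)
next
  case False
  then show ?thesis by (simp add: hyperplane_point_def restr.eval_var del: One_nat_def)
qed

lemma restrict_linear_form: "red lin = 0"
  unfolding linear_form_eq restr.eval_mult restr.eval.hom_minus restr.eval_var restrict_hyperplane_point by simp

lemma linear_form_dvd_iff: "lin dvd f \<longleftrightarrow> red f = 0"
proof
  assume "lin dvd f"
  then obtain g where "f = lin * g" ..
  then show "red f = 0" by (simp add: restr.eval_mult restrict_linear_form)
next
  assume "red f = 0"
  with restrict_dvd_diff[of f] show "lin dvd f" by simp
qed

text \<open>\<open>red\<close> is a homomorphism into a domain and its kernel is generated by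
  \<open>lin\<close>, so \<open>lin\<close> is prime.\<close>

lemma linear_form_dvd_mult_iff: "lin dvd f * g \<longleftrightarrow> lin dvd f \<or> lin dvd g"
  by (simp add: linear_form_dvd_iff restr.eval_mult)

lemma linear_form_neq_0: "lin \<noteq> 0"
proof
  assume "lin = 0"
  then have "pd 0 lin = 0" by simp
  then have "const_poly (\<alpha> 0) = 0" using pd_linear_form[OF n_pos, of \<alpha>] by simp
  then show False using const_poly_inverse[OF \<alpha>0] by simp
qed

lemma linear_form_not_dvd_const: "c \<noteq> 0 \<Longrightarrow> \<not> lin dvd const_poly c"
  unfolding linear_form_dvd_iff restr.eval_const using const_poly_inverse[of c] by force

text \<open>Restriction eliminates variable \<open>0\<close>. For dominance, this vanishing
  derivative forces the proportionality factor of a gradient to be \<open>0\<close>.\<close>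

lemma pd_0_restrict: "pd 0 (red f) = 0"
proof -
  have "pd 0 (hyperplane_point n \<alpha> i) = 0" for i
  proof (cases "i = 0")
    case True
    have "pd 0 (\<Sum>j\<in>{1..<n}. const_poly (\<alpha> j / \<alpha> 0) * var j) = 0"
      unfolding pd_sum by (rule sum.neutral) (auto simp: pd_mult pd_var simp del: One_nat_def)
    then show ?thesis using True by (simp add: hyperplane_point_def pd_uminus del: One_nat_def)
  next
    case False
    then show ?thesis by (simp add: hyperplane_point_def pd_var del: One_nat_def)
  qed
  then show ?thesis
    by (induct f rule: mpoly_induct) (simp_all add: restr.eval_const restr.eval_var restr.eval_add restr.eval_mult pd_add pd_mult del: One_nat_def)
qed

lemma homogeneous_restrict: "homogeneous n d f \<Longrightarrow> homogeneous n d (red f)"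
proof -
  have "homogeneous n 1 (hyperplane_point n \<alpha> i)" if "i < n" for i
    unfolding hyperplane_point_def using that homogeneous_mult[OF homogeneous_const homogeneous_var]
    by (auto intro!: homogeneous_uminus homogeneous_sum simp del: One_nat_def)
  then show "homogeneous n d f \<Longrightarrow> homogeneous n d (red f)"
    using homogeneous_mp_eval[of n d f n 1 _ "\<lambda>c. c"] by simp
qed

end

section \<open>Power forms and their roots\<close>

definition lin_indep_over :: "('a::field \<Rightarrow> 'b::field) \<Rightarrow> nat \<Rightarrow> (nat \<Rightarrow> 'b) \<Rightarrow> bool" where
  "lin_indep_over \<iota> n \<gamma> \<longleftrightarrow>
     (\<forall>c. (\<Sum>i<n. \<iota> (c i) * \<gamma> i) = 0 \<longrightarrow> (\<forall>i<n. c i = 0))"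

lemma lin_indep_overD:
  "lin_indep_over \<iota> n \<gamma> \<Longrightarrow> (\<Sum>i<n. \<iota> (c i) * \<gamma> i) = 0 \<Longrightarrow> i < n \<Longrightarrow> c i = 0"
  unfolding lin_indep_over_def by (drule spec[of _ c]) blast

definition power_form :: "nat \<Rightarrow> nat \<Rightarrow> (nat \<Rightarrow> 'a) \<Rightarrow> 'a::comm_semiring_1 mpoly" where
  "power_form p n a = (\<Sum>i<n. Poly_Mapping.single (Poly_Mapping.single i p) (a i))"

lemma single_var_power:
  "Poly_Mapping.single (Poly_Mapping.single i k) (c::'a::comm_semiring_1) = const_poly c * var i ^ k"
proof (induct k)
  case (Suc k)
  then show ?case using single_Suc_exponent[of i k 0 c] by (simp add: ac_simps)
qed (simp add: const_poly_def)

text \<open>An independent family extends to a basis of the large field over the small one, on which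
  the values of a linear map may be prescribed freely.\<close>

lemma (in field_hom) ex_linear_functional:
  fixes d :: "nat \<Rightarrow> 'a"
  assumes "lin_indep_over hom n \<gamma>"
  shows "\<exists>L. (\<forall>x y. L (x + y) = L x + L y) \<and> (\<forall>c w. L (hom c * w) = c * L w) \<and> (\<forall>i<n. L (\<gamma> i) = d i)"
proof -
  interpret vector_space_pair "\<lambda>c w. hom c * w" "(*) :: 'a \<Rightarrow> 'a \<Rightarrow> 'a"
    by unfold_locales (simp_all add: algebra_simps hom_add hom_mult)
  have ind: "c i = 0" if "(\<Sum>i<n. hom (c i) * \<gamma> i) = 0" "i < n" for c i
    using assms that unfolding lin_indep_over_def by blast
  \<comment> \<open>Independence is a property of sets, so the family must first be free of
    repetitions: two equal members would satisfy the relation with coefficients \<open>1\<close> and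
    \<open>-1\<close>.\<close>
  have inj: "inj_on \<gamma> {..<n}"
  proof (rule inj_onI, rule ccontr)
    fix i j assume ij: "i \<in> {..<n}" "j \<in> {..<n}" "\<gamma> i = \<gamma> j" "i \<noteq> j"
    define c :: "nat \<Rightarrow> 'a" where "c k = (if k = i then 1 else if k = j then -1 else 0)" for k
    have "(\<Sum>k<n. hom (c k) * \<gamma> k) = (\<Sum>k\<in>{i, j}. hom (c k) * \<gamma> k)"
      by (rule sum.mono_neutral_right) (use ij in \<open>auto simp: c_def\<close>)
    also have "\<dots> = 0" using ij by (simp add: c_def hom_uminus)
    finally have "c i = 0" by (rule ind) (use ij in simp)
    then show False by (simp add: c_def)
  qed
  have "vs1.independent (\<gamma> ` {..<n})"
  proof (rule vs1.independent_if_scalars_zero)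
    fix f x assume *: "(\<Sum>x\<in>\<gamma> ` {..<n}. hom (f x) * x) = 0" "x \<in> \<gamma> ` {..<n}"
    have "(\<Sum>i<n. hom (f (\<gamma> i)) * \<gamma> i) = 0" using *(1) by (simp add: sum.reindex[OF inj])
    from ind[OF this] *(2) show "f x = 0" by auto
  qed simp
  from linear_independent_extend[OF this, of "\<lambda>x. d (the_inv_into {..<n} \<gamma> x)"]
  obtain L where L: "Vector_Spaces.linear (\<lambda>c w. hom c * w) (*) L"
    "\<forall>x\<in>\<gamma> ` {..<n}. L x = d (the_inv_into {..<n} \<gamma> x)" by blast
  interpret L: Vector_Spaces.linear "\<lambda>c w. hom c * w" "(*)" L by fact
  have "L (\<gamma> i) = d i" if "i < n" for i
    using L(2) that by (simp add: the_inv_into_f_f[OF inj])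
  then show ?thesis using L.add L.scale by blast
qed

text \<open>\<open>\<iota>\<close> embeds the base field in a perfect field of characteristic
  \<open>p\<close>, where coefficients have \<open>p\<close>-th roots. The final theorem takes the
  algebraic closure.\<close>

locale frobenius_extension = field_hom \<iota>
  for \<iota> :: "'a::field \<Rightarrow> 'b::field" +
  fixes p :: nat
  assumes p: "prime p" and char: "CHAR('b) = p" and perfect: "\<exists>z. z ^ p = (y::'b)"
begin

abbreviation "emb \<equiv> coeff_map \<iota>"

sublocale emb: comm_ring_hom emb
  by (rule coeff_map_hom)

lemma emb_eq_0_iff [simp]: "emb f = 0 \<longleftrightarrow> f = 0"
  by (simp add: poly_mapping_eq_iff fun_eq_iff lookup_coeff_map)

sublocale emb: inj_idom_hom emb
  by unfold_locales simp

lemma p_pos: "0 < p"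
  using p by (rule prime_gt_0_nat)

lemma of_nat_neq_0: "0 < k \<Longrightarrow> k < p \<Longrightarrow> of_nat k \<noteq> (0 :: 'b)"
  unfolding of_nat_eq_0_iff_char_dvd char by (rule nat_dvd_not_less)

lemma frobenius_sum_mpoly: "sum f A ^ p = (\<Sum>i\<in>A. (f i :: 'b mpoly) ^ p)"
  by (rule freshmans_dream_sum) (simp_all only: CHAR_mpoly char p)

text \<open>Freshman's dream, applied to the linear form in the \<open>p\<close>-th roots of the
  coefficients.\<close>

lemma emb_power_form:
  assumes "\<And>i. i < n \<Longrightarrow> \<alpha> i ^ p = \<iota> (a i)"
  shows "emb (power_form p n a) = linear_form n \<alpha> ^ p"
proof -
  have "linear_form n \<alpha> ^ p = (\<Sum>i<n. (const_poly (\<alpha> i) * var i) ^ p)"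
    unfolding linear_form_def by (rule frobenius_sum_mpoly)
  also have "\<dots> = (\<Sum>i<n. emb (Poly_Mapping.single (Poly_Mapping.single i p) (a i)))"
    unfolding single_var_power[of _ p] emb.hom_mult emb.hom_power coeff_map_const coeff_map_var power_mult_distrib
    by (intro sum.cong refl) (simp only: lessThan_iff assms[symmetric] const_poly.hom_power)
  finally show ?thesis by (simp add: power_form_def emb.hom_sum)
qed

end

text \<open>\<open>indep\<close> is anisotropy in disguise:
  \<open>\<Sum> \<iota>(c\<^sub>i) \<alpha>\<^sub>i\<close> is the \<open>p\<close>-th root of
  \<open>\<iota>(\<Sum> a\<^sub>i c\<^sub>i\<^sup>p)\<close>.\<close>

locale anisotropic_data = frobenius_extension \<iota> p
  for \<iota> :: "'a::field \<Rightarrow> 'b::field" and p :: nat +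
  fixes n :: nat and \<alpha> :: "nat \<Rightarrow> 'b" and a :: "nat \<Rightarrow> 'a"
  assumes n2: "2 \<le> n" and root: "\<And>i. i < n \<Longrightarrow> \<alpha> i ^ p = \<iota> (a i)"
    and indep: "lin_indep_over \<iota> n \<alpha>"
begin

lemma \<alpha>_neq_0: "i < n \<Longrightarrow> \<alpha> i \<noteq> 0"
proof
  assume i: "i < n" and "\<alpha> i = 0"
  then have "(\<Sum>j<n. \<iota> (if j = i then 1 else 0) * \<alpha> j) = 0"
    by (intro sum.neutral) auto
  from lin_indep_overD[OF indep this i] show False by simp
qed

sublocale hyperplane n \<alpha>
  by unfold_locales (use n2 \<alpha>_neq_0 in auto)

abbreviation "\<Phi> \<equiv> power_form p n a"

lemma emb_\<Phi>: "emb \<Phi> = lin ^ p"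
  by (rule emb_power_form) (rule root)

lemma a0_neq_0: "a 0 \<noteq> 0"
proof
  assume "a 0 = 0"
  with root[of 0] n_pos have "\<alpha> 0 ^ p = 0" by simp
  with \<alpha>0 show False by simp
qed

text \<open>Clearing the denominator gives
  \<open>emb f * lin = emb (f * var 0 - g) * const_poly (\<alpha> 0)\<close>. A functional that is
  \<open>1\<close> at \<open>\<alpha> 1\<close> and \<open>0\<close> at the other
  \<open>\<alpha> i\<close> sends the left side to \<open>f * var 1\<close> and the right side to
  \<open>0\<close>. Variable \<open>1\<close> is available because \<open>n \<ge> 2\<close>.\<close>

lemma hyperplane_point_0_not_rational:
  assumes "emb f * hyperplane_point n \<alpha> 0 = emb g"
  shows "f = 0"
proof -
  from ex_linear_functional[OF indep, of "\<lambda>i. if i = 1 then 1 else 0"]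
  obtain L where L: "\<And>x y. L (x + y) = L x + L y" "\<And>c w. L (\<iota> c * w) = c * L w"
      "\<And>i. i < n \<Longrightarrow> L (\<alpha> i) = (if i = 1 then 1 else 0)"
    by blast
  have L0: "L 0 = 0" using L(2)[of 0 0] by simp
  have semi: "coeff_map L (emb f * q) = f * coeff_map L q" for f q
    by (rule coeff_map_semilinear) (simp_all add: L(1,2) L0 hom_add)
  have sum: "coeff_map L (sum f A) = (\<Sum>i\<in>A. coeff_map L (f i))" for f and A :: "nat set"
    by (rule coeff_map_sum) (simp_all add: L(1) L0)
  have lin_L: "coeff_map L lin = var 1"
  proof -
    have "coeff_map L (const_poly (\<alpha> i) * var i) = (if i = 1 then var i else 0)" if "i < n" for i
      using L(3)[OF that] by (simp add: const_poly_def mult_single coeff_map_single L0 del: One_nat_def)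
    then have "coeff_map L lin = (\<Sum>i<n. if i = 1 then var i else 0)"
      unfolding linear_form_def sum by (intro sum.cong refl) simp
    also have "\<dots> = var 1" using n2 by simp
    finally show ?thesis .
  qed
  have const_L: "coeff_map L (const_poly (\<alpha> 0)) = 0"
    using L(3)[OF n_pos] by (simp add: const_poly_def coeff_map_single L0)
  have "emb f * lin = emb (f * var 0 - g) * const_poly (\<alpha> 0)"
    unfolding linear_form_eq emb.hom_minus emb.hom_mult coeff_map_var assms[symmetric]
    by (simp add: algebra_simps)
  then have "f * var 1 = (f * var 0 - g) * coeff_map L (const_poly (\<alpha> 0))"
    by (metis semi lin_L)
  then have "f * var 1 = 0" unfolding const_L by simp
  then show "f = 0" by simp
qed

text \<open>As a polynomial in variable \<open>0\<close>, \<open>\<Phi>\<close> is up to a unit the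
  monic \<open>Y\<^sup>p + b\<close>, and restriction to the hyperplane is evaluation at its root
  \<open>t\<close>. The remainder of \<open>f\<close> vanishes at \<open>t\<close> and has degree
  below \<open>p\<close>, so \<open>poly_purely_inseparable_neq_0\<close> makes it
  \<open>0\<close>.\<close>

lemma linear_form_dvd_imp_\<Phi>_dvd:
  assumes "lin dvd emb f"
  shows "\<Phi> dvd f"
proof -
  define b where "b = (\<Sum>j\<in>{1..<n}. const_poly (a j / a 0) * var j ^ p)"
  have \<Phi>_eq: "\<Phi> = const_poly (a 0) * (var 0 ^ p + b)"
  proof -
    have "const_poly (a 0) * (const_poly (a j / a 0) * var j ^ p) = const_poly (a j) * var j ^ p" for j
      unfolding mult.assoc[symmetric] const_poly_mult[symmetric] using a0_neq_0 by simp
    then have "const_poly (a 0) * b = (\<Sum>j\<in>{1..<n}. const_poly (a j) * var j ^ p)"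
      unfolding b_def by (simp only: sum_distrib_left)
    then show ?thesis
      unfolding power_form_def single_var_power[of _ p] sum_lessThan_split_0[OF n_pos] distrib_left by simp
  qed
  define t where "t = hyperplane_point n \<alpha> 0"
  have t_p: "t ^ p = emb (- b)"
  proof -
    have "red (emb \<Phi>) = 0" 
      unfolding emb_\<Phi> restr.eval.hom_power restrict_linear_form using p_pos by simp
    then have "red (const_poly (\<iota> (a 0))) * (red (emb (var 0)) ^ p + red (emb b)) = 0"
      by (simp only: \<Phi>_eq emb.hom_mult emb.hom_add emb.hom_power restr.eval.hom_power restr.eval_mult restr.eval_add
          coeff_map_const)
    then have "const_poly (\<iota> (a 0)) * (t ^ p + red (emb b)) = 0"
      by (simp only: coeff_map_var restr.eval_var restr.eval_const t_def)
    moreover have "const_poly (\<iota> (a 0)) \<noteq> 0"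
      using const_poly_inverse[of "\<iota> (a 0)"] a0_neq_0 by force
    ultimately have "t ^ p = - red (emb b)" by (simp add: eq_neg_iff_add_eq_0)
    also have "red (emb b) = emb b"
      unfolding b_def emb.hom_sum restr.eval.hom_sum emb.hom_mult emb.hom_power restr.eval_mult
        restr.eval.hom_power coeff_map_const coeff_map_var restr.eval_const restr.eval_var
      by (intro sum.cong refl) (simp add: hyperplane_point_def)
    finally show ?thesis by (simp only: emb.hom_uminus)
  qed
  \<comment> \<open>\<open>\<rho>\<close> collects powers of variable \<open>0\<close>, with the
    other variables in the coefficients. Evaluation at \<open>t\<close> yields the restriction,
    evaluation at \<open>var 0\<close> the polynomial itself.\<close>
  define \<rho> where "\<rho> = mp_eval (\<lambda>c. [:const_poly c:]) (\<lambda>i. if i = 0 then [:0, 1:] else [:var i:] :: 'a mpoly poly)"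
  have hom_c: "comm_ring_hom (\<lambda>c. [:const_poly c:] :: 'a mpoly poly)"
    by unfold_locales (simp_all add: const_poly_add const_poly_mult one_pCons)
  interpret \<rho>: mp_evaluation "\<lambda>c. [:const_poly c:]" "\<lambda>i. if i = 0 then [:0, 1:] else [:var i:] :: 'a mpoly poly"
    by (rule mp_evaluationI) fact
  interpret map_emb: map_poly_inj_idom_hom emb ..
  have hom_map: "comm_ring_hom (map_poly emb)" by (rule map_emb.comm_ring_hom_axioms)
  have hom_poly: "comm_ring_hom (\<lambda>q. poly q x)" for x :: "'c::comm_ring_1"
    by unfold_locales simp_all
  have red_f: "red (emb g) = poly (map_poly emb (\<rho> g)) t" for g
  proof (rule mpoly_hom_eqI[where h = "\<lambda>g. red (emb g)" and k = "\<lambda>g. poly (map_poly emb (\<rho> g)) t"])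
    show "comm_ring_hom (\<lambda>g. red (emb g))"
      by (rule comm_ring_hom_comp[OF restr.eval.comm_ring_hom_axioms emb.comm_ring_hom_axioms])
    show "comm_ring_hom (\<lambda>g. poly (map_poly emb (\<rho> g)) t)"
      unfolding \<rho>_def
      by (rule comm_ring_hom_comp[OF hom_poly comm_ring_hom_comp[OF hom_map \<rho>.eval.comm_ring_hom_axioms]])
    show "red (emb (const_poly c)) = poly (map_poly emb (\<rho> (const_poly c))) t" for c
      unfolding \<rho>_def \<rho>.eval_const coeff_map_const restr.eval_const
      by (simp add: coeff_map_const emb.map_poly_pCons_hom)
    show "red (emb (var i)) = poly (map_poly emb (\<rho> (var i))) t" for i
      unfolding \<rho>_def \<rho>.eval_var coeff_map_var restr.eval_var
      by (simp add: coeff_map_var t_def hyperplane_point_def emb.map_poly_pCons_hom del: One_nat_def)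
  qed
  have f_eq: "g = poly (\<rho> g) (var 0)" for g
  proof (rule mpoly_hom_eqI[where h = "\<lambda>g. g" and k = "\<lambda>g. poly (\<rho> g) (var 0)"])
    show "comm_ring_hom (\<lambda>g :: 'a mpoly. g)" by unfold_locales simp_all
    show "comm_ring_hom (\<lambda>g. poly (\<rho> g) (var 0))"
      unfolding \<rho>_def by (rule comm_ring_hom_comp[OF hom_poly \<rho>.eval.comm_ring_hom_axioms])
    show "const_poly c = poly (\<rho> (const_poly c)) (var 0)" for c
      unfolding \<rho>_def \<rho>.eval_const by simp
    show "var i = poly (\<rho> (var i)) (var 0)" for i
      unfolding \<rho>_def \<rho>.eval_var by (simp del: One_nat_def)
  qed
  define P where "P = monom 1 p + [:b:]"
  have degP: "degree P = p" and lcP: "coeff P p = 1"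
  proof -
    have m: "degree (monom (1 :: 'a mpoly) p) = p" by (rule degree_monom_eq) simp
    have "degree [:b:] < degree (monom (1 :: 'a mpoly) p)" unfolding m using p_pos by simp
    from degree_add_eq_left[OF this] show "degree P = p" unfolding P_def m .
    show "coeff P p = 1" unfolding P_def using p_pos by (simp add: coeff_pCons split: nat.split)
  qed
  then have "P \<noteq> 0" using p_pos by auto
  obtain q R where qR: "pseudo_divmod (\<rho> f) P = (q, R)" using prod.exhaust by blast
  note pd = pseudo_divmod[OF \<open>P \<noteq> 0\<close> qR]
  \<comment> \<open>\<open>P\<close> is monic, so the factor introduced by pseudo-division is
    \<open>1\<close>.\<close>
  have eq: "\<rho> f = P * q + R" using pd(1) unfolding degP lcP by simp
  have P_t: "poly (map_poly emb P) t = 0"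
    unfolding P_def map_emb.hom_add using t_p
    by (simp add: poly_monom emb.map_poly_pCons_hom map_poly_monom emb.hom_uminus)
  have "poly (map_poly emb R) t = 0"
  proof -
    have "poly (map_poly emb (\<rho> f)) t = 0"
      using assms unfolding linear_form_dvd_iff red_f .
    then show ?thesis
      unfolding eq map_emb.hom_add map_emb.hom_mult poly_add poly_mult P_t by simp
  qed
  have "R = 0"
  proof (rule ccontr)
    assume "R \<noteq> 0"
    have "poly (map_poly emb R) t \<noteq> 0"
    proof (rule poly_purely_inseparable_neq_0[OF emb.inj_idom_hom_axioms p _ t_p _ \<open>R \<noteq> 0\<close>])
      show "CHAR('b mpoly) = p" unfolding CHAR_mpoly by (rule char)
      show "f = 0" if "emb f * t = emb g" for f g
        using that unfolding t_def by (rule hyperplane_point_0_not_rational)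
      show "degree R < p" using pd(2) \<open>R \<noteq> 0\<close> unfolding degP by blast
    qed
    with \<open>poly (map_poly emb R) t = 0\<close> show False by contradiction
  qed
  then have "f = poly (P * q) (var 0)" using f_eq[of f] eq by simp
  also have "\<dots> = (var 0 ^ p + b) * poly q (var 0)"
    unfolding poly_mult P_def by (simp add: poly_monom del: One_nat_def)
  also have "\<dots> = \<Phi> * (const_poly (inverse (a 0)) * poly q (var 0))"
  proof -
    have "\<Phi> * (const_poly (inverse (a 0)) * poly q (var 0))
        = const_poly (inverse (a 0)) * const_poly (a 0) * ((var 0 ^ p + b) * poly q (var 0))"
      unfolding \<Phi>_eq by (simp only: ac_simps)
    then show ?thesis unfolding const_poly_inverse[OF a0_neq_0] by (simp only: mult_1_left)
  qed
  finally show "\<Phi> dvd f" ..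
qed

lemma \<Phi>_dvd_iff: "\<Phi> dvd f \<longleftrightarrow> lin dvd emb f"
proof
  assume "\<Phi> dvd f"
  then have "lin ^ p dvd emb f" using emb.hom_dvd[of \<Phi> f] by (simp only: emb_\<Phi>)
  moreover have "lin dvd lin ^ p" using p_pos by (simp add: dvd_power)
  ultimately show "lin dvd emb f" by (rule dvd_trans[rotated])
qed (rule linear_form_dvd_imp_\<Phi>_dvd)

end

section \<open>Tuples of forms and their order along the hyperplane\<close>

definition tuple_sum :: "('a \<Rightarrow> 'b) \<Rightarrow> nat \<Rightarrow> (nat \<Rightarrow> 'b) \<Rightarrow> (nat \<Rightarrow> 'a::field mpoly) \<Rightarrow> 'b::field mpoly" where
  "tuple_sum \<iota> m \<gamma> u = (\<Sum>j<m. const_poly (\<gamma> j) * coeff_map \<iota> (u j))"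

lemma (in field_hom) pd_tuple_sum:
  "pd i (tuple_sum hom m \<gamma> u) = tuple_sum hom m \<gamma> (\<lambda>j. pd i (u j))"
  by (simp add: tuple_sum_def pd_sum pd_mult pd_coeff_map)

context anisotropic_data
begin

text \<open>\<open>lin ^ p\<close> is \<open>emb \<Phi>\<close>, so applying the functional dual to
  \<open>\<gamma> k\<close> coefficientwise keeps the factor \<open>\<Phi>\<close> and leaves only
  \<open>u k\<close> of the sum.\<close>

lemma \<Phi>_dvd_tuple:
  assumes \<gamma>: "lin_indep_over \<iota> m \<gamma>" and dvd: "lin ^ p dvd tuple_sum \<iota> m \<gamma> u" and k: "k < m"
  shows "\<Phi> dvd u k"
proof -
  from ex_linear_functional[OF \<gamma>, of "\<lambda>i. if i = k then 1 else 0"]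
  obtain L where L: "\<And>x y. L (x + y) = L x + L y" "\<And>c w. L (\<iota> c * w) = c * L w"
      "\<And>i. i < m \<Longrightarrow> L (\<gamma> i) = (if i = k then 1 else 0)"
    by blast
  have L0: "L 0 = 0" using L(2)[of 0 0] by simp
  have semi: "coeff_map L (emb f * q) = f * coeff_map L q" for f q
    by (rule coeff_map_semilinear) (simp_all add: L(1,2) L0 hom_add)
  have "coeff_map L (const_poly (\<gamma> j) * emb (u j)) = (if j = k then u j else 0)" if "j < m" for j
    using semi[of "u j" "const_poly (\<gamma> j)"] L(3)[OF that]
    by (simp add: const_poly_def coeff_map_single L0 mult.commute)
  then have "coeff_map L (tuple_sum \<iota> m \<gamma> u) = (\<Sum>j<m. if j = k then u j else 0)"
    unfolding tuple_sum_def by (subst coeff_map_sum) (auto simp: L(1) L0 intro: sum.cong)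
  also have "\<dots> = u k" using k by simp
  finally have "u k = coeff_map L (tuple_sum \<iota> m \<gamma> u)" ..
  moreover obtain q where "tuple_sum \<iota> m \<gamma> u = emb \<Phi> * q" using dvd unfolding emb_\<Phi> ..
  ultimately have "u k = \<Phi> * coeff_map L q" by (simp only: semi)
  then show ?thesis ..
qed

lemma const_poly_unit_dvd:
  "c \<noteq> 0 \<Longrightarrow> lin dvd const_poly c * f \<longleftrightarrow> lin dvd f"
  using linear_form_not_dvd_const linear_form_dvd_mult_iff by blast

text \<open>Differentiating lowers the order of vanishing along the hyperplane by one, as long as it is
  less than \<open>p\<close>, since the derivatives of \<open>lin\<close> are units.\<close>

lemma ex_simple_tuple:
  assumes \<gamma>: "lin_indep_over \<iota> m \<gamma>" and hom: "\<And>j. j < m \<Longrightarrow> homogeneous n d (u j)"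
    and k: "k < m" "\<not> \<Phi> dvd u k" and dvd: "lin dvd tuple_sum \<iota> m \<gamma> u"
  obtains u' d' g where "\<And>j. j < m \<Longrightarrow> homogeneous n d' (u' j)"
    "tuple_sum \<iota> m \<gamma> u' = lin * g" "\<not> lin dvd g"
proof -
  \<comment> \<open>Here \<open>Suc s\<close> is the exact order of vanishing; each application of
    \<open>pd 0\<close> lowers it by one until it is \<open>1\<close>.\<close>
  have descend: "\<exists>u' d' g. (\<forall>j<m. homogeneous n d' (u' j)) \<and> tuple_sum \<iota> m \<gamma> u' = lin * g \<and> \<not> lin dvd g"
    if "Suc s < p" "\<forall>j<m. homogeneous n d (u j)" "tuple_sum \<iota> m \<gamma> u = lin ^ Suc s * g" "\<not> lin dvd g"
    for s u d g
    using that
  proof (induct s arbitrary: u d g)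
    case 0
    then show ?case by auto
  next
    case (Suc s)
    define g' where "g' = of_nat (Suc (Suc s)) * const_poly (\<alpha> 0) * g + lin * pd 0 g"
    have pd_lin: "pd 0 (lin ^ Suc (Suc s)) = of_nat (Suc (Suc s)) * lin ^ Suc s * const_poly (\<alpha> 0)"
      using pd_power[of 0 lin "Suc (Suc s)"] unfolding pd_linear_form[OF n_pos] diff_Suc_1 .
    have "tuple_sum \<iota> m \<gamma> (\<lambda>j. pd 0 (u j)) = lin ^ Suc s * g'"
      unfolding pd_tuple_sum[symmetric] Suc.prems(3) g'_def pd_mult pd_lin
      by (simp only: power_Suc[of lin "Suc s"] distrib_left ac_simps)
    moreover have "\<not> lin dvd g'"
    proof
      assume "lin dvd g'"
      then have "lin dvd of_nat (Suc (Suc s)) * const_poly (\<alpha> 0) * g"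
        unfolding g'_def by (simp only: dvd_add_left_iff dvd_triv_left)
      then have "lin dvd const_poly (of_nat (Suc (Suc s)) * \<alpha> 0) * g"
        by (simp only: const_poly_mult const_poly.hom_of_nat)
      \<comment> \<open>The order is positive and less than \<open>p\<close>, hence nonzero in the
        field.\<close>
      moreover have "of_nat (Suc (Suc s)) * \<alpha> 0 \<noteq> 0"
        using of_nat_neq_0[OF _ Suc.prems(1)] \<alpha>0 by (simp only: mult_eq_0_iff) simp
      ultimately show False using Suc.prems(4) const_poly_unit_dvd by blast
    qed
    moreover have "\<forall>j<m. homogeneous n (d - 1) (pd 0 (u j))"
      using Suc.prems(2) homogeneous_pd by blast
    moreover have "Suc s < p" using Suc.prems(1) by simp
    ultimately show ?case by (intro Suc.hyps[where u = "\<lambda>j. pd 0 (u j)" and d = "d - 1"])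
  qed
  define P where "P s \<longleftrightarrow> lin ^ s dvd tuple_sum \<iota> m \<gamma> u" for s
  \<comment> \<open>Order \<open>p\<close> would make \<open>\<Phi>\<close> divide
    \<open>u k\<close>. This puts the exact order, \<open>s\<close> below, strictly between
    \<open>0\<close> and \<open>p\<close>.\<close>
  have "\<not> P p" using \<Phi>_dvd_tuple[OF \<gamma> _ k(1)] k(2) unfolding P_def by blast
  have "P 1" using dvd by (simp add: P_def)
  have bound: "s \<le> p" if "P s" for s
  proof (rule ccontr)
    assume "\<not> s \<le> p"
    then have "P p" using power_le_dvd[of lin s _ p] that unfolding P_def by simp
    with \<open>\<not> P p\<close> show False by contradiction
  qed
  define s where "s = (GREATEST s. P s)"
  have "P s" unfolding s_def using \<open>P 1\<close> bound by (rule GreatestI_nat)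
  have le: "s' \<le> s" if "P s'" for s'
    unfolding s_def using that bound by (rule Greatest_le_nat)
  have "s < p" using bound[OF \<open>P s\<close>] \<open>P s\<close> \<open>\<not> P p\<close> by (cases "s = p") simp_all
  have "1 \<le> s" using le[OF \<open>P 1\<close>] .
  then obtain s0 where s0: "s = Suc s0" by (cases s) auto
  obtain g where g: "tuple_sum \<iota> m \<gamma> u = lin ^ s * g" using \<open>P s\<close> unfolding P_def ..
  have "\<not> lin dvd g"
  proof
    assume "lin dvd g"
    then have "P (Suc s)" unfolding P_def g power_Suc by (simp only: mult.commute[of lin] mult_dvd_mono dvd_refl)
    from le[OF this] show False by simp
  qed
  with descend[of s0 d u g] \<open>s < p\<close> g hom that show ?thesis unfolding s0 by blast
qed

text \<open>The value at the generic point of the hyperplane \<open>lin = 0\<close>. After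
  elimination of variable \<open>0\<close> the values are ordinary fractions of polynomials, so no
  quotient by \<open>lin\<close> has to be formed.\<close>

definition generic_val :: "'b mpoly \<Rightarrow> 'b mpoly fract" where
  "generic_val f = to_fract (red f)"

sublocale generic_val: comm_ring_hom generic_val
proof -
  have "comm_ring_hom (to_fract :: 'b mpoly \<Rightarrow> 'b mpoly fract)" by unfold_locales simp_all
  from comm_ring_hom_comp[OF this restr.eval.comm_ring_hom_axioms]
  show "comm_ring_hom generic_val" unfolding generic_val_def .
qed

lemma generic_val_eq_0_iff: "generic_val f = 0 \<longleftrightarrow> lin dvd f"
  by (simp add: generic_val_def linear_form_dvd_iff)

abbreviation val :: "'a mpoly \<Rightarrow> 'b mpoly fract" where
  "val f \<equiv> generic_val (emb f)"

sublocale val: comm_ring_hom "\<lambda>f. val f"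
  by (rule comm_ring_hom_comp[OF generic_val.comm_ring_hom_axioms emb.comm_ring_hom_axioms])

lemma val_eq_0_iff: "val f = 0 \<longleftrightarrow> \<Phi> dvd f"
  by (simp only: generic_val_eq_0_iff \<Phi>_dvd_iff)

abbreviation cst :: "'b \<Rightarrow> 'b mpoly fract" where
  "cst c \<equiv> generic_val (const_poly c)"

lemma cst_neq_0: "c \<noteq> 0 \<Longrightarrow> cst c \<noteq> 0"
  unfolding generic_val_eq_0_iff by (rule linear_form_not_dvd_const)

lemma generic_val_tuple_sum: "generic_val (tuple_sum \<iota> m \<gamma> u) = (\<Sum>j<m. cst (\<gamma> j) * val (u j))"
  by (simp only: tuple_sum_def generic_val.hom_sum generic_val.hom_mult)

text \<open>Of the two terms of the product rule, the one with the factor \<open>lin\<close>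
  vanishes on the hyperplane.\<close>

lemma pd_simple_tuple:
  assumes "tuple_sum \<iota> m \<gamma> u = lin * g" "i < n"
  shows "(\<Sum>j<m. cst (\<gamma> j) * val (pd i (u j))) = cst (\<alpha> i) * generic_val g"
proof -
  have "tuple_sum \<iota> m \<gamma> (\<lambda>j. pd i (u j)) = const_poly (\<alpha> i) * g + lin * pd i g"
    unfolding pd_tuple_sum[symmetric] assms(1) by (simp only: pd_mult pd_linear_form[OF assms(2)])
  then have "generic_val (tuple_sum \<iota> m \<gamma> (\<lambda>j. pd i (u j)))
      = cst (\<alpha> i) * generic_val g + generic_val (lin * pd i g)"
    by (simp only: generic_val.hom_add generic_val.hom_mult)
  moreover have "generic_val (lin * pd i g) = 0" unfolding generic_val_eq_0_iff by simp
  ultimately show ?thesis unfolding generic_val_tuple_sum by simp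
qed

text \<open>Powers of variable \<open>1\<close> later serve as denominators of any prescribed
  degree.\<close>

lemma val_var_1_neq_0: "val (var 1) \<noteq> 0"
proof -
  have "red (var 1) = var 1" unfolding restr.eval_var by (simp add: hyperplane_point_def)
  then have "generic_val (var 1) \<noteq> 0" unfolding generic_val_def by simp
  then show ?thesis unfolding coeff_map_var .
qed

end

section \<open>The function field\<close>

lemma form_poly_eq_power_form: "form_poly p \<phi> bs = power_form p (length bs) (\<lambda>i. \<phi> (bs ! i))"
  by (simp add: form_poly_def power_form_def)

locale anisotropic_hypersurface =
  anisotropic_data \<iota> p "length bs" \<alpha> "\<lambda>i. \<phi> (bs ! i)"
  for \<iota> :: "'a::field \<Rightarrow> 'b::field" and p :: nat and bs :: "'v list" and \<alpha> :: "nat \<Rightarrow> 'b" and \<phi> :: "'v \<Rightarrow> 'a"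
begin

abbreviation "local_ring \<equiv> generic_local_ring p \<phi> bs"
abbreviation "local_ideal \<equiv> generic_ideal p \<phi> bs"
abbreviation "FF \<equiv> function_field p \<phi> bs"
abbreviation "hdeg d f \<equiv> homogeneous (length bs) d f"

text \<open>Evaluation of a fraction at the generic point. A fraction has many homogeneous
  representations; \<open>frac_val_Fract\<close> shows that they share one value.\<close>

definition frac_val :: "'a mpoly fract \<Rightarrow> 'b mpoly fract" where
  "frac_val z = (THE k. \<exists>f g d. z = Fract f g \<and> hdeg d f \<and> hdeg d g \<and> \<not> \<Phi> dvd g \<and> k = val f / val g)"

lemma frac_val_Fract:
  assumes "hdeg d f" "hdeg d g" "\<not> \<Phi> dvd g"
  shows "frac_val (Fract f g) = val f / val g"
  unfolding frac_val_def
proof (rule the_equality)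
  show "\<exists>f' g' d. Fract f g = Fract f' g' \<and> hdeg d f' \<and> hdeg d g' \<and> \<not> \<Phi> dvd g' \<and> val f / val g = val f' / val g'"
    using assms by blast
next
  fix k assume "\<exists>f' g' d. Fract f g = Fract f' g' \<and> hdeg d f' \<and> hdeg d g' \<and> \<not> \<Phi> dvd g' \<and> k = val f' / val g'"
  then obtain f' g' d' where *: "Fract f g = Fract f' g'" "\<not> \<Phi> dvd g'" "k = val f' / val g'" by blast
  have "g \<noteq> 0" "g' \<noteq> 0" using assms(3) *(2) by auto
  then have "f * g' = f' * g" using *(1) by (simp add: eq_fract)
  then have "val f * val g' = val f' * val g" by (simp only: val.hom_mult[symmetric])
  moreover have "val g \<noteq> 0" "val g' \<noteq> 0" using assms(3) *(2) by (simp_all only: val_eq_0_iff not_False_eq_True)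
  ultimately show "k = val f / val g" unfolding *(3) by (simp add: frac_eq_eq)
qed

lemma not_\<Phi>_dvd_mult: "\<not> \<Phi> dvd f \<Longrightarrow> \<not> \<Phi> dvd g \<Longrightarrow> \<not> \<Phi> dvd f * g"
  by (simp only: val_eq_0_iff[symmetric] val.hom_mult mult_eq_0_iff) simp

lemma not_\<Phi>_dvd_1: "\<not> \<Phi> dvd 1"
  by (simp only: val_eq_0_iff[symmetric] val.hom_one) simp

lemma local_ringI: "hdeg d f \<Longrightarrow> hdeg d g \<Longrightarrow> \<not> \<Phi> dvd g \<Longrightarrow> Fract f g \<in> carrier local_ring"
  unfolding generic_local_ring_def form_poly_eq_power_form by auto

lemma local_ringE:
  assumes "z \<in> carrier local_ring"
  obtains f g d where "z = Fract f g" "hdeg d f" "hdeg d g" "\<not> \<Phi> dvd g"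
  using assms unfolding generic_local_ring_def form_poly_eq_power_form by auto

lemma local_ring_simps [simp]:
  "x \<otimes>\<^bsub>local_ring\<^esub> y = x * y" "\<one>\<^bsub>local_ring\<^esub> = 1" "\<zero>\<^bsub>local_ring\<^esub> = 0" "x \<oplus>\<^bsub>local_ring\<^esub> y = x + y"
  by (simp_all add: generic_local_ring_def)

lemma
  shows local_ring_0: "0 \<in> carrier local_ring" and local_ring_1: "1 \<in> carrier local_ring"
    and frac_val_1: "frac_val 1 = 1"
  using local_ringI[of 0 0 1] local_ringI[of 0 1 1] frac_val_Fract[of 0 1 1] not_\<Phi>_dvd_1
  by (simp_all flip: Zero_fract_def One_fract_def add: Zero_fract_def[symmetric] One_fract_def[symmetric])

lemma
  assumes "x \<in> carrier local_ring" "y \<in> carrier local_ring"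
  shows local_ring_add: "x + y \<in> carrier local_ring" and local_ring_mult: "x * y \<in> carrier local_ring"
    and frac_val_add: "frac_val (x + y) = frac_val x + frac_val y"
    and frac_val_mult: "frac_val (x * y) = frac_val x * frac_val y"
proof -
  obtain f g d where x: "x = Fract f g" "hdeg d f" "hdeg d g" "\<not> \<Phi> dvd g" using assms(1) by (rule local_ringE)
  obtain f' g' d' where y: "y = Fract f' g'" "hdeg d' f'" "hdeg d' g'" "\<not> \<Phi> dvd g'" using assms(2) by (rule local_ringE)
  have nz: "g \<noteq> 0" "g' \<noteq> 0" using x(4) y(4) by auto
  have vnz: "val g \<noteq> 0" "val g' \<noteq> 0" using x(4) y(4) by (simp_all only: val_eq_0_iff not_False_eq_True)
  have d: "hdeg (d + d') (f * g' + f' * g)" "hdeg (d + d') (g * g')" "hdeg (d + d') (f * f')"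
    using homogeneous_mult[OF x(2) y(3)] homogeneous_mult[OF y(2) x(3)] homogeneous_mult[OF x(3) y(3)] homogeneous_mult[OF x(2) y(2)]
    by (auto intro: homogeneous_add simp: add.commute)
  note ndvd = not_\<Phi>_dvd_mult[OF x(4) y(4)]
  have vx: "frac_val x = val f / val g" and vy: "frac_val y = val f' / val g'"
    unfolding x(1) y(1) by (rule frac_val_Fract[OF x(2-4)], rule frac_val_Fract[OF y(2-4)])
  have add: "x + y = Fract (f * g' + f' * g) (g * g')" using nz by (simp add: x(1) y(1))
  have mult: "x * y = Fract (f * f') (g * g')" by (simp add: x(1) y(1))
  show "x + y \<in> carrier local_ring" unfolding add by (rule local_ringI[OF d(1,2) ndvd])
  show "x * y \<in> carrier local_ring" unfolding mult by (rule local_ringI[OF d(3,2) ndvd])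
  show "frac_val (x + y) = frac_val x + frac_val y"
    unfolding vx vy unfolding add frac_val_Fract[OF d(1,2) ndvd] val.hom_mult val.hom_add using vnz by (simp add: field_simps)
  show "frac_val (x * y) = frac_val x * frac_val y"
    unfolding vx vy unfolding mult frac_val_Fract[OF d(3,2) ndvd] val.hom_mult by simp
qed

lemma local_ring_uminus:
  assumes "x \<in> carrier local_ring"
  shows "- x \<in> carrier local_ring"
proof -
  obtain f g d where x: "x = Fract f g" "hdeg d f" "hdeg d g" "\<not> \<Phi> dvd g" using assms by (rule local_ringE)
  have "- x = Fract (- f) g" by (simp add: x(1))
  then show ?thesis using local_ringI[OF homogeneous_uminus[OF x(2)] x(3,4)] by simp
qed

lemma cring_local_ring: "cring local_ring"
proof (intro cringI abelian_groupI comm_monoidI)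
  fix x assume "x \<in> carrier local_ring"
  then show "\<exists>y\<in>carrier local_ring. y \<oplus>\<^bsub>local_ring\<^esub> x = \<zero>\<^bsub>local_ring\<^esub>"
    using local_ring_uminus by (intro bexI[of _ "- x"]) simp_all
qed (simp_all add: local_ring_0 local_ring_1 local_ring_add local_ring_mult algebra_simps)

abbreviation "KK \<equiv> (class_ring :: 'b mpoly fract ring)"

lemma frac_val_ring_hom: "ring_hom_ring local_ring KK frac_val"
proof (rule ring_hom_ringI2)
  show "ring local_ring" using cring_local_ring by (rule cring.axioms)
  show "ring KK" by (rule class_ring.ring_axioms)
  show "frac_val \<in> Ring.ring_hom local_ring KK"
    by (rule ring_hom_memI) (simp_all add: frac_val_add frac_val_mult frac_val_1)
qed

text \<open>The value of \<open>f/g\<close> is \<open>0\<close> exactly if \<open>lin\<close>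
  divides \<open>emb f\<close>, that is, if \<open>\<Phi>\<close> divides \<open>f\<close>. By the
  homomorphism theorem the quotient \<open>FF\<close> therefore embeds in the field of
  values.\<close>

lemma kernel_frac_val: "a_kernel local_ring KK frac_val = local_ideal"
proof -
  have "a_kernel local_ring KK frac_val = {z \<in> carrier local_ring. frac_val z = 0}"
    by (simp add: a_kernel_def kernel_def)
  also have "\<dots> = local_ideal"
  proof (intro equalityI subsetI)
    fix z assume "z \<in> {z \<in> carrier local_ring. frac_val z = 0}"
    then have z: "z \<in> carrier local_ring" "frac_val z = 0" by auto
    obtain f g d where x: "z = Fract f g" "hdeg d f" "hdeg d g" "\<not> \<Phi> dvd g" using z(1) by (rule local_ringE)
    then have "val f / val g = 0" using z(2) frac_val_Fract by simp
    moreover have "val g \<noteq> 0" using x(4) by (simp only: val_eq_0_iff not_False_eq_True)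
    ultimately have "\<Phi> dvd f" by (simp only: val_eq_0_iff[symmetric] divide_eq_0_iff) simp
    with x show "z \<in> local_ideal" unfolding generic_ideal_def form_poly_eq_power_form by blast
  next
    fix z assume "z \<in> local_ideal"
    then obtain f g d where x: "z = Fract f g" "hdeg d f" "hdeg d g" "\<not> \<Phi> dvd g" "\<Phi> dvd f"
      unfolding generic_ideal_def form_poly_eq_power_form by blast
    then have "val f = 0" by (simp only: val_eq_0_iff)
    then have "frac_val z = 0" using x frac_val_Fract by simp
    moreover have "z \<in> carrier local_ring" unfolding x(1) using x(2-4) by (rule local_ringI)
    ultimately show "z \<in> {z \<in> carrier local_ring. frac_val z = 0}" by simp
  qed
  finally show ?thesis .
qed

section \<open>Embedding of the function field\<close>

lemma FF_eq: "FF = local_ring Quot a_kernel local_ring KK frac_val"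
  by (simp only: function_field_def kernel_frac_val)

text \<open>The map induced on cosets: \<open>frac_val\<close> is constant on each of them, so its
  image is a singleton.\<close>

definition \<theta> :: "'a mpoly fract set \<Rightarrow> 'b mpoly fract" where
  "\<theta> \<xi> = the_elem (frac_val ` \<xi>)"

lemma carrier_FF: "carrier FF = (\<lambda>z. local_ideal +>\<^bsub>local_ring\<^esub> z) ` carrier local_ring"
  unfolding FF_eq kernel_frac_val FactRing_simps by auto

lemma \<theta>_coset:
  assumes "z \<in> carrier local_ring"
  shows "local_ideal +>\<^bsub>local_ring\<^esub> z \<in> carrier FF"
    and "\<theta> (local_ideal +>\<^bsub>local_ring\<^esub> z) = frac_val z"
  using ring_hom_ring.the_elem_simp[OF frac_val_ring_hom assms] assms
  unfolding \<theta>_def kernel_frac_val carrier_FF by blast+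

lemma FF_cases:
  assumes "\<xi> \<in> carrier FF"
  obtains z where "z \<in> carrier local_ring" "\<xi> = local_ideal +>\<^bsub>local_ring\<^esub> z"
  using assms unfolding carrier_FF by blast

lemma \<theta>_hom: "\<theta> \<in> Ring.ring_hom FF KK"
  using ring_hom_ring.the_elem_hom[OF frac_val_ring_hom] unfolding \<theta>_def[abs_def] FF_eq .

lemma \<theta>_add: "\<xi> \<in> carrier FF \<Longrightarrow> \<eta> \<in> carrier FF \<Longrightarrow> \<theta> (\<xi> \<oplus>\<^bsub>FF\<^esub> \<eta>) = \<theta> \<xi> + \<theta> \<eta>"
  and \<theta>_mult: "\<xi> \<in> carrier FF \<Longrightarrow> \<eta> \<in> carrier FF \<Longrightarrow> \<theta> (\<xi> \<otimes>\<^bsub>FF\<^esub> \<eta>) = \<theta> \<xi> * \<theta> \<eta>"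
  and \<theta>_one: "\<theta> \<one>\<^bsub>FF\<^esub> = 1"
  using ring_hom_add[OF \<theta>_hom] ring_hom_mult[OF \<theta>_hom] ring_hom_one[OF \<theta>_hom] by simp_all

lemma \<theta>_inj: "\<xi> \<in> carrier FF \<Longrightarrow> \<eta> \<in> carrier FF \<Longrightarrow> \<theta> \<xi> = \<theta> \<eta> \<Longrightarrow> \<xi> = \<eta>"
  using ring_hom_ring.the_elem_inj[OF frac_val_ring_hom] unfolding \<theta>_def FF_eq by blast

lemma ex_\<theta>:
  assumes "hdeg d f" "hdeg d g" "\<not> \<Phi> dvd g"
  shows "\<exists>\<xi>\<in>carrier FF. \<theta> \<xi> = val f / val g"
  using \<theta>_coset[OF local_ringI[OF assms]] frac_val_Fract[OF assms] by (intro bexI) simp_all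

lemma \<theta>_cases:
  assumes "\<xi> \<in> carrier FF"
  obtains f g d where "hdeg d f" "hdeg d g" "\<not> \<Phi> dvd g" "\<theta> \<xi> = val f / val g"
proof -
  obtain z where z: "z \<in> carrier local_ring" "\<xi> = local_ideal +>\<^bsub>local_ring\<^esub> z" using assms by (rule FF_cases)
  obtain f g d where x: "z = Fract f g" "hdeg d f" "hdeg d g" "\<not> \<Phi> dvd g" using z(1) by (rule local_ringE)
  have "\<theta> \<xi> = val f / val g" using \<theta>_coset(2)[OF z(1)] frac_val_Fract[OF x(2-4)] by (simp add: z(2) x(1))
  with x that show ?thesis by blast
qed

lemma cring_FF: "cring FF"
  unfolding FF_eq by (rule ideal.quotient_is_cring[OF ring_hom_ring.kernel_is_ideal[OF frac_val_ring_hom] cring_local_ring])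

lemma \<theta>_zero: "\<theta> \<zero>\<^bsub>FF\<^esub> = 0"
proof -
  interpret cring FF by (rule cring_FF)
  have "\<theta> (\<zero>\<^bsub>FF\<^esub> \<oplus>\<^bsub>FF\<^esub> \<zero>\<^bsub>FF\<^esub>) = \<theta> \<zero>\<^bsub>FF\<^esub> + \<theta> \<zero>\<^bsub>FF\<^esub>" by (rule \<theta>_add) simp_all
  then have "\<theta> \<zero>\<^bsub>FF\<^esub> + \<theta> \<zero>\<^bsub>FF\<^esub> = \<theta> \<zero>\<^bsub>FF\<^esub> + 0"
    by (simp only: l_zero zero_closed add_0_right)
  then show ?thesis by (rule add_left_imp_eq)
qed

lemma \<theta>_eq_0_iff: "\<xi> \<in> carrier FF \<Longrightarrow> \<theta> \<xi> = 0 \<longleftrightarrow> \<xi> = \<zero>\<^bsub>FF\<^esub>"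
proof -
  assume \<xi>: "\<xi> \<in> carrier FF"
  interpret cring FF by (rule cring_FF)
  show ?thesis using \<theta>_inj[OF \<xi> zero_closed] \<theta>_zero by metis
qed

text \<open>The inverse of \<open>f/g\<close> is \<open>g/f\<close>, an admissible fraction since a
  nonzero value means that \<open>\<Phi>\<close> does not divide \<open>f\<close>.\<close>

lemma field_FF: "field FF"
proof (rule cring.cring_fieldI2[OF cring_FF])
  interpret cring FF by (rule cring_FF)
  show "\<zero>\<^bsub>FF\<^esub> \<noteq> \<one>\<^bsub>FF\<^esub>" using \<theta>_zero \<theta>_one by (metis zero_neq_one)
  fix \<xi> assume \<xi>: "\<xi> \<in> carrier FF" "\<xi> \<noteq> \<zero>\<^bsub>FF\<^esub>"
  obtain f g d where *: "hdeg d f" "hdeg d g" "\<not> \<Phi> dvd g" "\<theta> \<xi> = val f / val g" using \<xi>(1) by (rule \<theta>_cases)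
  have "\<theta> \<xi> \<noteq> 0" using \<xi> \<theta>_eq_0_iff by simp
  then have f: "val f \<noteq> 0" and g: "val g \<noteq> 0" unfolding *(4) by auto
  from f have "\<not> \<Phi> dvd f" by (simp only: val_eq_0_iff not_False_eq_True)
  from ex_\<theta>[OF *(2,1) this] obtain \<eta> where \<eta>: "\<eta> \<in> carrier FF" "\<theta> \<eta> = val g / val f" by blast
  have "\<theta> (\<xi> \<otimes>\<^bsub>FF\<^esub> \<eta>) = \<theta> \<one>\<^bsub>FF\<^esub>" unfolding \<theta>_mult[OF \<xi>(1) \<eta>(1)] *(4) \<eta>(2) \<theta>_one using f g by simp
  then have "\<xi> \<otimes>\<^bsub>FF\<^esub> \<eta> = \<one>\<^bsub>FF\<^esub>" using \<xi> \<eta> by (intro \<theta>_inj) simp_all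
  with \<eta>(1) show "\<exists>\<eta>\<in>carrier FF. \<xi> \<otimes>\<^bsub>FF\<^esub> \<eta> = \<one>\<^bsub>FF\<^esub>" by blast
qed

lemma function_field_embed:
  shows function_field_embed_closed: "function_field_embed p \<phi> bs c \<in> carrier FF"
    and \<theta>_function_field_embed: "\<theta> (function_field_embed p \<phi> bs c) = cst (\<iota> c)"
proof -
  have *: "hdeg 0 (const_poly c)" "hdeg 0 (1 :: 'a mpoly)" by simp_all
  have z: "Fract (const_poly c) 1 \<in> carrier local_ring" by (rule local_ringI[OF * not_\<Phi>_dvd_1])
  show "function_field_embed p \<phi> bs c \<in> carrier FF"
    unfolding function_field_embed_def by (rule \<theta>_coset(1)[OF z])
  show "\<theta> (function_field_embed p \<phi> bs c) = cst (\<iota> c)"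
    unfolding function_field_embed_def \<theta>_coset(2)[OF z] frac_val_Fract[OF * not_\<Phi>_dvd_1]
    by (simp add: coeff_map_const val.hom_one)
qed

end

section \<open>Linear relations over a subfield\<close>

context field
begin

text \<open>The standard basis vectors; \<open>restrict\<close> makes them extensional, as the
  carrier of \<open>func_space\<close> requires.\<close>

definition unit_fun :: "nat \<Rightarrow> nat \<Rightarrow> nat \<Rightarrow> 'a" where
  "unit_fun m i = restrict (\<lambda>j. if j = i then \<one> else \<zero>) {..<m}"

lemma vectorspace_func_space: "vectorspace R (func_space S)"
  unfolding vectorspace_def using func_space_is_module field_axioms by blast

lemma func_space_simps [simp]:
  "carrier (func_space S) = S \<rightarrow>\<^sub>E carrier R" "\<zero>\<^bsub>func_space S\<^esub> = restrict (\<lambda>v. \<zero>) S"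
  "f \<oplus>\<^bsub>func_space S\<^esub> g = restrict (\<lambda>v. f v \<oplus> g v) S" "c \<odot>\<^bsub>func_space S\<^esub> f = restrict (\<lambda>v. c \<otimes> f v) S"
  by (simp_all add: func_space_def)

lemma inj_unit_fun: "inj_on (unit_fun m) {..<m}"
proof (rule inj_onI)
  fix i j assume *: "i \<in> {..<m}" "j \<in> {..<m}" "unit_fun m i = unit_fun m j"
  have "unit_fun m i i = unit_fun m j i" using *(3) by simp
  then show "i = j" using *(1) by (auto simp: unit_fun_def split: if_splits)
qed

text \<open>Existence and uniqueness of coordinates both rest on \<open>coord\<close>: entry
  \<open>i\<close> of a combination of unit vectors is the coefficient of unit vector
  \<open>i\<close>.\<close>

lemma func_space_basis:
  "vectorspace.basis R (func_space {..<m}) (unit_fun m ` {..<m})"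
proof -
  let ?V = "func_space {..<m} :: ('a, nat \<Rightarrow> 'a) module" and ?A = "unit_fun m ` {..<m}"
  interpret V: vectorspace R ?V by (rule vectorspace_func_space)
  have e_closed: "unit_fun m i \<in> carrier ?V" for i by (simp add: unit_fun_def)
  have eval: "V.module.lincomb a B i = (\<Oplus>v\<in>B. a v \<otimes> v i)"
    if "finite B" "B \<subseteq> carrier ?V" "a \<in> B \<rightarrow> carrier R" "i < m" for a B i
    using that
  proof (induct B)
    case empty
    then show ?case by simp
  next
    case (insert v B)
    then have "V.module.lincomb a (insert v B) = a v \<odot>\<^bsub>?V\<^esub> v \<oplus>\<^bsub>?V\<^esub> V.module.lincomb a B"
      by (intro V.lincomb_insert2) auto
    moreover have closed: "a w \<otimes> w i \<in> carrier R" if "w \<in> insert v B" for w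
    proof (rule m_closed)
      show "a w \<in> carrier R" using insert.prems(2) that by (rule Pi_mem)
      have "w \<in> {..<m} \<rightarrow>\<^sub>E carrier R" using insert.prems(1) that by auto
      then show "w i \<in> carrier R" using insert.prems(3) by (rule PiE_mem[OF _ lessThan_iff[THEN iffD2]])
    qed
    moreover have "(\<Oplus>w\<in>insert v B. a w \<otimes> w i) = a v \<otimes> v i \<oplus> (\<Oplus>w\<in>B. a w \<otimes> w i)"
      using insert.hyps(1,2) closed by (intro finsum_insert) blast+
    moreover have "V.module.lincomb a B i = (\<Oplus>w\<in>B. a w \<otimes> w i)"
      using insert.prems by (intro insert.hyps(3)) auto
    ultimately show ?case using insert.prems(3) by simp
  qed
  have coord: "V.module.lincomb a ?A i = a (unit_fun m i)" if "a \<in> ?A \<rightarrow> carrier R" "i < m" for a i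
  proof -
    have a_closed: "a (unit_fun m k) \<in> carrier R" if "k < m" for k
      using that \<open>a \<in> ?A \<rightarrow> carrier R\<close> by auto
    have closed: "a (unit_fun m k) \<otimes> unit_fun m k i \<in> carrier R" if "k < m" for k
      using a_closed[OF that] \<open>i < m\<close> by (intro m_closed) (auto simp: unit_fun_def)
    have "V.module.lincomb a ?A i = (\<Oplus>v\<in>?A. a v \<otimes> v i)"
      using that e_closed by (intro eval) auto
    also have "\<dots> = (\<Oplus>k\<in>{..<m}. a (unit_fun m k) \<otimes> unit_fun m k i)"
      using closed by (intro finsum_reindex inj_unit_fun) auto
    also have "\<dots> = (\<Oplus>k\<in>{..<m}. if i = k then a (unit_fun m k) else \<zero>)"
      using that(2) a_closed by (intro finsum_cong') (auto simp: unit_fun_def)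
    also have "\<dots> = a (unit_fun m i)"
      using that(2) a_closed by (intro add.finprod_singleton) auto
    finally show ?thesis .
  qed
  have "\<exists>!a. a \<in> ?A \<rightarrow>\<^sub>E carrier R \<and> V.module.lincomb a ?A = v" if v: "v \<in> carrier ?V" for v
  proof (rule ex1I)
    define a where "a = restrict (\<lambda>w. v (the_inv_into {..<m} (unit_fun m) w)) ?A"
    have a: "a (unit_fun m i) = v i" if "i < m" for i
      using that by (simp add: a_def the_inv_into_f_f[OF inj_unit_fun])
    have a_closed: "a \<in> ?A \<rightarrow>\<^sub>E carrier R"
      using v a by (auto simp: a_def PiE_iff the_inv_into_f_f[OF inj_unit_fun])
    moreover have "V.module.lincomb a ?A = v"
    proof (rule extensionalityI[where A = "{..<m}"])
      have "V.module.lincomb a ?A \<in> carrier ?V"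
        using a_closed e_closed by (intro V.module.lincomb_closed) auto
      then show "V.module.lincomb a ?A \<in> extensional {..<m}" by (simp add: PiE_def)
      show "v \<in> extensional {..<m}" using v by (simp add: PiE_def)
      show "V.module.lincomb a ?A i = v i" if "i \<in> {..<m}" for i
        using coord[of a i] a a_closed that by (auto simp: PiE_def)
    qed
    ultimately show "a \<in> ?A \<rightarrow>\<^sub>E carrier R \<and> V.module.lincomb a ?A = v" by blast
    fix b assume b: "b \<in> ?A \<rightarrow>\<^sub>E carrier R \<and> V.module.lincomb b ?A = v"
    show "b = a"
    proof (rule extensionalityI[where A = ?A])
      show "b w = a w" if "w \<in> ?A" for w
        using that coord[of b] b a by (auto simp: PiE_def)
    qed (use b a_closed in \<open>auto simp: PiE_def\<close>)
  qed
  moreover have "?A \<subseteq> carrier ?V" using e_closed by blast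
  ultimately show ?thesis using V.basis_criterion[of ?A] by blast
qed

lemma func_space_dim:
  shows "vectorspace.dim R (func_space {..<m::nat}) = m" and "vectorspace.fin_dim R (func_space {..<m})"
proof -
  interpret V: vectorspace R "func_space {..<m} :: ('a, nat \<Rightarrow> 'a) module" by (rule vectorspace_func_space)
  show "V.dim = m" using V.dim_basis[OF _ func_space_basis] card_image[OF inj_unit_fun] by simp
  show "V.fin_dim" unfolding V.fin_dim_def
    by (rule exI[of _ "unit_fun m ` {..<m}"]) (use func_space_basis[of m] in \<open>simp only: V.basis_def finite_imageI finite_lessThan\<close>)
qed

end

section \<open>Subspaces of finite-dimensional spaces\<close>

context vectorspace
begin

lemma lin_indpt_singleton:
  assumes "v \<in> carrier V" "v \<noteq> \<zero>\<^bsub>V\<^esub>"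
  shows "lin_indpt {v}"
proof
  assume "lin_dep {v}"
  moreover have "lin_indpt {}" by (rule finite_lin_indpt2) simp_all
  ultimately have "v \<in> span {}"
    using lin_dep_iff_in_span[of "{}" v] assms(1) by simp
  then show False using assms(2) by (simp add: span_empty)
qed

text \<open>Independent sets of the subspace stay independent in the whole space and are thus
  bounded in size; a maximal one is a finite basis.\<close>

lemma fin_dim_subspace:
  assumes W: "subspace K W V" and fd: "fin_dim"
  shows "vectorspace.fin_dim K (vs W)"
proof -
  interpret W: vectorspace K "vs W" by (rule subspace_is_vs[OF W])
  have sub: "submodule K W V" using W by simp
  have WV: "W \<subseteq> carrier V" using sub by (simp add: submodule_def)
  have "finite S \<and> card S \<le> dim" if S: "S \<subseteq> carrier (vs W) \<and> W.lin_indpt S" for S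
  proof -
    have "S \<subseteq> W" using S by simp
    have "lin_indpt S" using span_li_not_depend(2)[OF \<open>S \<subseteq> W\<close> sub] S by simp
    moreover have "S \<subseteq> carrier V" using \<open>S \<subseteq> W\<close> WV by blast
    ultimately show ?thesis using li_le_dim[OF fd] by blast
  qed
  moreover have "{} \<subseteq> carrier (vs W) \<and> W.lin_indpt {}" using W.finite_lin_indpt2[of "{}"] by simp
  ultimately have "\<exists>A. finite A \<and> maximal A (\<lambda>S. S \<subseteq> carrier (vs W) \<and> W.lin_indpt S)"
    by (rule maximal_exists)
  then obtain A where A: "finite A" "W.basis A" using W.max_li_is_basis by blast
  then show ?thesis unfolding W.fin_dim_def W.basis_def by blast
qed

text \<open>A basis of \<open>W\<close> is an independent set of full size, hence a basis of the
  whole space.\<close>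

lemma subspace_eqI:
  assumes W: "subspace K W V" and fd: fin_dim and dim: "vectorspace.dim K (vs W) = dim"
  shows "W = carrier V"
proof -
  interpret W: vectorspace K "vs W" by (rule subspace_is_vs[OF W])
  have sub: "submodule K W V" using W by simp
  obtain B where B: "finite B" "W.basis B"
    using W.finite_basis_exists[OF fin_dim_subspace[OF W fd]] by blast
  then have BW: "B \<subseteq> W" and "W.lin_indpt B" by (simp_all add: W.basis_def)
  then have "lin_indpt B" using span_li_not_depend(2)[OF BW sub] by simp
  moreover have "B \<subseteq> carrier V" using BW sub by (auto simp: submodule_def)
  moreover have "card B \<ge> dim" using W.dim_basis[OF B] dim by simp
  ultimately have "basis B" using dim_li_is_basis[OF fd B(1)] by blast
  then have "carrier V = span B" by (simp add: basis_def)
  also have "\<dots> = W" using span_li_not_depend(1)[OF BW sub] B(2) by (simp add: W.basis_def)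
  finally show ?thesis ..
qed

lemma ordered_basis_subspace:
  assumes U: "subspace K U V" and cs: "ordered_basis K (vs U) cs"
  shows "set cs \<subseteq> U" "lin_indpt (set cs)" "vectorspace.dim K (vs U) = length cs"
proof -
  interpret U: vectorspace K "vs U" by (rule subspace_is_vs[OF U])
  have sub: "submodule K U V" using U by simp
  have basis: "U.basis (set cs)" and dist: "distinct cs" using cs by (simp_all add: ordered_basis_def)
  then show "set cs \<subseteq> U" by (simp add: U.basis_def)
  from span_li_not_depend(2)[OF this sub] basis show "lin_indpt (set cs)" by (simp add: U.basis_def)
  show "U.dim = length cs" using U.dim_basis[OF finite_set basis] distinct_card[OF dist] by simp
qed

lemma dim_0_imp_eq_zero:
  assumes fd: "fin_dim" and "dim = 0" "v \<in> carrier V"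
  shows "v = \<zero>\<^bsub>V\<^esub>"
proof (rule ccontr)
  assume "v \<noteq> \<zero>\<^bsub>V\<^esub>"
  from li_le_dim(2)[OF fd _ lin_indpt_singleton[OF assms(3) this]] assms(2,3) show False by simp
qed

lemma dim_1_imp_multiple:
  assumes fd: "fin_dim" and "dim = 1" "v \<in> carrier V" "v \<noteq> \<zero>\<^bsub>V\<^esub>" "w \<in> carrier V"
  shows "\<exists>c\<in>carrier K. w = c \<odot>\<^bsub>V\<^esub> v"
proof -
  have "basis {v}"
    by (rule dim_li_is_basis[OF fd]) (use assms lin_indpt_singleton in simp_all)
  then have "w \<in> span {v}" using assms(5) by (simp add: basis_def)
  then obtain a where a: "a \<in> {v} \<rightarrow> carrier K" "w = lincomb a {v}"
    using finite_span[of "{v}"] assms(3) by auto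
  have "lincomb a {v} = a v \<odot>\<^bsub>V\<^esub> v" using a(1) assms(3) by (simp add: lincomb_def)
  with a show ?thesis by auto
qed

end

section \<open>Linear relations over an embedded field\<close>

locale field_embedding = field L for L :: "('l, 'm) ring_scheme" (structure) +
  fixes \<theta> :: "'l \<Rightarrow> 'k::field"
  assumes embed_add: "x \<in> carrier L \<Longrightarrow> y \<in> carrier L \<Longrightarrow> \<theta> (x \<oplus> y) = \<theta> x + \<theta> y"
    and embed_mult: "x \<in> carrier L \<Longrightarrow> y \<in> carrier L \<Longrightarrow> \<theta> (x \<otimes> y) = \<theta> x * \<theta> y"
    and embed_one: "\<theta> \<one> = 1"
begin

lemma embed_zero: "\<theta> \<zero> = 0"
proof -
  have "\<theta> (\<zero> \<oplus> \<zero>) = \<theta> \<zero> + \<theta> \<zero>" by (rule embed_add) simp_all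
  then have "\<theta> \<zero> + \<theta> \<zero> = \<theta> \<zero> + 0" by (simp only: l_zero zero_closed add_0_right)
  then show ?thesis by (rule add_left_imp_eq)
qed

lemma embed_eq_0_iff:
  assumes "x \<in> carrier L"
  shows "\<theta> x = 0 \<longleftrightarrow> x = \<zero>"
proof
  assume *: "\<theta> x = 0"
  show "x = \<zero>"
  proof (rule ccontr)
    assume "x \<noteq> \<zero>"
    then have x: "x \<in> Units L" using assms field_Units by blast
    then have "\<theta> x * \<theta> (inv x) = 1"
      using embed_mult[OF assms Units_inv_closed[OF x]] embed_one by simp
    with * show False by simp
  qed
qed (simp add: embed_zero)

lemma embed_finsum:
  "finite A \<Longrightarrow> (\<And>i. i \<in> A \<Longrightarrow> f i \<in> carrier L) \<Longrightarrow> \<theta> (\<Oplus>i\<in>A. f i) = (\<Sum>i\<in>A. \<theta> (f i))"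
proof (induct A rule: finite_induct)
  case (insert x F)
  then have "\<theta> (\<Oplus>i\<in>insert x F. f i) = \<theta> (f x \<oplus> (\<Oplus>i\<in>F. f i))"
    by (subst finsum_insert) auto
  also have "\<dots> = \<theta> (f x) + \<theta> (\<Oplus>i\<in>F. f i)"
    using insert.prems by (intro embed_add finsum_closed) auto
  finally show ?case using insert by simp
qed (simp add: embed_zero)

lemma embed_pow: "x \<in> carrier L \<Longrightarrow> \<theta> (x [^] (k::nat)) = \<theta> x ^ k"
  by (induct k) (simp_all add: embed_one embed_mult mult.commute)

lemma embed_diff:
  assumes "x \<in> carrier L" "y \<in> carrier L"
  shows "\<theta> (x \<ominus> y) = \<theta> x - \<theta> y"
proof -
  have "\<theta> (x \<ominus> y) + \<theta> y = \<theta> (x \<ominus> y \<oplus> y)" using assms by (intro embed_add[symmetric]) simp_all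
  also have "x \<ominus> y \<oplus> y = x" using assms by (simp add: minus_eq a_assoc l_neg)
  finally show ?thesis by (simp add: eq_diff_eq)
qed

text \<open>The large field as a vector space over \<open>L\<close>, which acts through
  \<open>\<theta>\<close>. It makes \<open>combination\<close> a linear map, to which rank-nullity
  applies.\<close>

definition target :: "('l, 'k) module" where
  "target = \<lparr>carrier = UNIV, monoid.mult = (*), one = 1, zero = 0, add = (+), module.smult = (\<lambda>c k. \<theta> c * k)\<rparr>"

lemma target_simps [simp]:
  "carrier target = UNIV" "\<zero>\<^bsub>target\<^esub> = 0" "x \<oplus>\<^bsub>target\<^esub> y = x + y" "c \<odot>\<^bsub>target\<^esub> x = \<theta> c * x"
  by (simp_all add: target_def)

lemma vectorspace_target: "vectorspace L target"
proof (rule vs_criteria)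
  show "\<forall>v\<in>carrier target. \<exists>w\<in>carrier target. v \<oplus>\<^bsub>target\<^esub> w = \<zero>\<^bsub>target\<^esub>"
  proof
    fix v
    show "\<exists>w\<in>carrier target. v \<oplus>\<^bsub>target\<^esub> w = \<zero>\<^bsub>target\<^esub>"
      by (rule bexI[of _ "- v"]) simp_all
  qed
qed (use field_axioms in \<open>auto simp: embed_add embed_mult embed_one algebra_simps\<close>)

definition combination :: "nat \<Rightarrow> (nat \<Rightarrow> 'k) \<Rightarrow> (nat \<Rightarrow> 'l) \<Rightarrow> 'k" where
  "combination m \<gamma> v = (\<Sum>j<m. \<theta> (v j) * \<gamma> j)"

abbreviation coord_space :: "nat \<Rightarrow> ('l, nat \<Rightarrow> 'l) module" where
  "coord_space m \<equiv> func_space {..<m}"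

definition relations :: "nat \<Rightarrow> (nat \<Rightarrow> 'k) \<Rightarrow> (nat \<Rightarrow> 'l) set" where
  "relations m \<gamma> = {v \<in> carrier (coord_space m). combination m \<gamma> v = 0}"

definition relations_dim :: "nat \<Rightarrow> (nat \<Rightarrow> 'k) \<Rightarrow> nat" where
  "relations_dim m \<gamma> = vectorspace.dim L (coord_space m\<lparr>carrier := relations m \<gamma>\<rparr>)"

lemma combination_scale: "combination n (\<lambda>i. h * \<alpha> i) x = h * combination n \<alpha> x"
  by (simp add: combination_def sum_distrib_left ac_simps)

lemma relations_dim_scale: "h \<noteq> 0 \<Longrightarrow> relations_dim n (\<lambda>i. h * \<alpha> i) = relations_dim n \<alpha>"
  by (simp add: relations_dim_def relations_def combination_scale)

lemma linear_map_combination: "linear_map L (coord_space m) target (combination m \<gamma>)"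
proof -
  have "combination m \<gamma> \<in> module_hom L (coord_space m) target"
    unfolding module_hom_def
  proof (intro CollectI conjI allI impI; (elim conjE)?)
    fix v w assume "v \<in> carrier (coord_space m)" "w \<in> carrier (coord_space m)"
    then have "\<theta> (v j \<oplus> w j) = \<theta> (v j) + \<theta> (w j)" if "j < m" for j
      using that by (intro embed_add) (auto simp: PiE_mem)
    then show "combination m \<gamma> (v \<oplus>\<^bsub>coord_space m\<^esub> w) = combination m \<gamma> v \<oplus>\<^bsub>target\<^esub> combination m \<gamma> w"
      by (simp add: combination_def distrib_right sum.distrib)
  next
    fix c v assume "c \<in> carrier L" "v \<in> carrier (coord_space m)"
    then have "\<theta> (c \<otimes> v j) = \<theta> c * \<theta> (v j)" if "j < m" for j
      using that by (intro embed_mult) (auto simp: PiE_mem)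
    then show "combination m \<gamma> (c \<odot>\<^bsub>coord_space m\<^esub> v) = c \<odot>\<^bsub>target\<^esub> combination m \<gamma> v"
      by (simp add: combination_def sum_distrib_left mult.assoc)
  qed simp
  then show ?thesis
    unfolding linear_map_def mod_hom_def mod_hom_axioms_def
    using vectorspace_func_space vectorspace_target by (simp add: vectorspace_def)
qed

lemma relations_subspace: "subspace L (relations m \<gamma>) (coord_space m)"
proof -
  interpret T: linear_map L "coord_space m" target "combination m \<gamma>" by (rule linear_map_combination)
  have "relations m \<gamma> = T.kerT" unfolding relations_def T.ker_def by simp
  then show ?thesis using T.kerT_is_subspace by simp
qed

lemma relations_fin_dim: "vectorspace.fin_dim L (coord_space m\<lparr>carrier := relations m \<gamma>\<rparr>)"
  by (rule vectorspace.fin_dim_subspace[OF vectorspace_func_space relations_subspace func_space_dim(2)])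

lemma relations_vectorspace: "vectorspace L (coord_space m\<lparr>carrier := relations m \<gamma>\<rparr>)"
  by (rule vectorspace.subspace_is_vs[OF vectorspace_func_space relations_subspace])

lemma rank_nullity_combination:
  "vectorspace.dim L (target\<lparr>carrier := combination m \<gamma> ` carrier (coord_space m)\<rparr>) + relations_dim m \<gamma> = m"
proof -
  interpret T: linear_map L "coord_space m" target "combination m \<gamma>" by (rule linear_map_combination)
  have 1: "relations m \<gamma> = T.kerT" unfolding relations_def T.ker_def by simp
  have 2: "combination m \<gamma> ` carrier (coord_space m) = T.imT" unfolding T.im_def by simp
  show ?thesis
    using T.rank_nullity[OF func_space_dim(2)] unfolding 2 relations_dim_def 1 func_space_dim(1) .
qed

lemma image_combination_subspace: "subspace L (combination m \<gamma> ` carrier (coord_space m)) target"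
proof -
  interpret T: linear_map L "coord_space m" target "combination m \<gamma>" by (rule linear_map_combination)
  have 2: "combination m \<gamma> ` carrier (coord_space m) = T.imT" unfolding T.im_def by simp
  show ?thesis unfolding 2 by (rule T.imT_is_subspace)
qed

text \<open>\<open>target\<close> need not have finite dimension, so \<open>combination\<close> is
  corestricted to its image, onto which it is surjective.\<close>

lemma image_combination_fin_dim:
  "vectorspace.fin_dim L (target\<lparr>carrier := combination m \<gamma> ` carrier (coord_space m)\<rparr>)"
proof -
  let ?I = "target\<lparr>carrier := combination m \<gamma> ` carrier (coord_space m)\<rparr>"
  interpret T: linear_map L "coord_space m" target "combination m \<gamma>" by (rule linear_map_combination)
  have I: "vectorspace L ?I"
    by (rule vectorspace.subspace_is_vs[OF vectorspace_target image_combination_subspace])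
  have "combination m \<gamma> \<in> module_hom L (coord_space m) ?I"
    using T.f_hom unfolding module_hom_def by auto
  then interpret S: linear_map L "coord_space m" ?I "combination m \<gamma>"
    unfolding linear_map_def mod_hom_def mod_hom_axioms_def
    using vectorspace_func_space I by (simp add: vectorspace_def)
  show ?thesis by (rule S.rank_nullity_main(2)[OF func_space_dim(2)]) simp
qed

text \<open>A larger image means a larger rank, and rank plus \<open>relations_dim\<close> is the
  number of generators.\<close>

lemma relations_dim_mono:
  assumes "combination m \<gamma> ` carrier (coord_space m) \<subseteq> combination n \<alpha> ` carrier (coord_space n)"
  shows "m + relations_dim n \<alpha> \<le> n + relations_dim m \<gamma>"
proof -
  interpret T: vectorspace L target by (rule vectorspace_target)
  let ?I = "combination n \<alpha> ` carrier (coord_space n)" and ?J = "combination m \<gamma> ` carrier (coord_space m)"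
  interpret I: vectorspace L "target\<lparr>carrier := ?I\<rparr>"
    by (rule T.subspace_is_vs[OF image_combination_subspace])
  have J: "subspace L ?J (target\<lparr>carrier := ?I\<rparr>)"
    by (rule T.nested_subspaces[OF image_combination_subspace image_combination_subspace assms])
  have "I.dim \<ge> vectorspace.dim L (target\<lparr>carrier := ?J\<rparr>)"
    using I.subspace_dim[OF J image_combination_fin_dim] image_combination_fin_dim by simp
  then show ?thesis using rank_nullity_combination[of m \<gamma>] rank_nullity_combination[of n \<alpha>] by linarith
qed

text \<open>The equation in \<open>dim\<close> says that the two ranks agree, and a subspace of full
  finite dimension is everything.\<close>

lemma image_combination_eqI:
  assumes sub: "combination m \<gamma> ` carrier (coord_space m) \<subseteq> combination n \<alpha> ` carrier (coord_space n)"
    and dim: "m + relations_dim n \<alpha> = n + relations_dim m \<gamma>"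
  shows "combination m \<gamma> ` carrier (coord_space m) = combination n \<alpha> ` carrier (coord_space n)"
proof -
  interpret T: vectorspace L target by (rule vectorspace_target)
  let ?I = "combination n \<alpha> ` carrier (coord_space n)" and ?J = "combination m \<gamma> ` carrier (coord_space m)"
  interpret I: vectorspace L "target\<lparr>carrier := ?I\<rparr>"
    by (rule T.subspace_is_vs[OF image_combination_subspace])
  have J: "subspace L ?J (target\<lparr>carrier := ?I\<rparr>)"
    by (rule T.nested_subspaces[OF image_combination_subspace image_combination_subspace sub])
  have "vectorspace.dim L (target\<lparr>carrier := ?J\<rparr>) = I.dim"
    using rank_nullity_combination[of m \<gamma>] rank_nullity_combination[of n \<alpha>] dim by linarith
  then show ?thesis using I.subspace_eqI[OF J image_combination_fin_dim] by simp
qed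

lemma relations_dim_eq_0_iff: "relations_dim m \<gamma> = 0 \<longleftrightarrow> relations m \<gamma> \<subseteq> {\<zero>\<^bsub>coord_space m\<^esub>}"
proof -
  interpret V: vectorspace L "coord_space m" by (rule vectorspace_func_space)
  interpret N: vectorspace L "coord_space m\<lparr>carrier := relations m \<gamma>\<rparr>" by (rule relations_vectorspace)
  show ?thesis
  proof
    assume "relations_dim m \<gamma> = 0"
    then show "relations m \<gamma> \<subseteq> {\<zero>\<^bsub>coord_space m\<^esub>}"
      using N.dim_0_imp_eq_zero[OF relations_fin_dim] unfolding relations_dim_def by auto
  next
    assume *: "relations m \<gamma> \<subseteq> {\<zero>\<^bsub>coord_space m\<^esub>}"
    have "N.gen_set {\<zero>\<^bsub>coord_space m\<lparr>carrier := relations m \<gamma>\<rparr>\<^esub>}"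
    proof (rule equalityI)
      show "N.span {\<zero>\<^bsub>coord_space m\<lparr>carrier := relations m \<gamma>\<rparr>\<^esub>} \<subseteq> carrier (coord_space m\<lparr>carrier := relations m \<gamma>\<rparr>)"
        using N.span_closed[of "{\<zero>\<^bsub>coord_space m\<lparr>carrier := relations m \<gamma>\<rparr>\<^esub>}"] N.zero_closed by blast
      show "carrier (coord_space m\<lparr>carrier := relations m \<gamma>\<rparr>) \<subseteq> N.span {\<zero>\<^bsub>coord_space m\<lparr>carrier := relations m \<gamma>\<rparr>\<^esub>}"
        using * N.span_zero by auto
    qed
    then show "relations_dim m \<gamma> = 0" unfolding relations_dim_def by (rule N.dim0I)
  qed
qed

lemma relations_dim_1_multiple:
  assumes "relations_dim m \<gamma> = 1" "v \<in> relations m \<gamma>" "v \<noteq> \<zero>\<^bsub>coord_space m\<^esub>" "w \<in> relations m \<gamma>"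
  shows "\<exists>c\<in>carrier L. w = c \<odot>\<^bsub>coord_space m\<^esub> v"
proof -
  interpret N: vectorspace L "coord_space m\<lparr>carrier := relations m \<gamma>\<rparr>" by (rule relations_vectorspace)
  show ?thesis
    using N.dim_1_imp_multiple[OF relations_fin_dim, of v w] assms unfolding relations_dim_def by auto
qed

end

section \<open>Isotropy, rational morphisms and dominance\<close>

lemma pd_eq_0_of_homogeneous:
  assumes "homogeneous n d f" "n \<le> i"
  shows "pd i f = 0"
proof (rule poly_mapping_eqI)
  fix m
  have "Poly_Mapping.lookup f (m + Poly_Mapping.single i 1) = 0"
  proof (rule ccontr)
    assume "\<not> ?thesis"
    then have *: "Poly_Mapping.keys (m + Poly_Mapping.single i 1) \<subseteq> {..<n}"
      using assms(1) unfolding homogeneous_def by (metis in_keys_iff)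
    have "Poly_Mapping.lookup (m + Poly_Mapping.single i 1) i \<noteq> 0" by (simp add: lookup_add)
    then have "i \<in> Poly_Mapping.keys (m + Poly_Mapping.single i 1)" by (simp only: in_keys_iff not_False_eq_True)
    with * have "i < n" by auto
    with assms(2) show False by simp
  qed
  then show "Poly_Mapping.lookup (pd i f) m = Poly_Mapping.lookup 0 m" by (simp add: lookup_pd)
qed

lemma homogeneous_degree_0_const:
  assumes "homogeneous n 0 f"
  shows "f = const_poly (Poly_Mapping.lookup f 0)"
proof (rule poly_mapping_eqI)
  fix m
  show "Poly_Mapping.lookup f m = Poly_Mapping.lookup (const_poly (Poly_Mapping.lookup f 0)) m"
  proof (cases "m \<in> Poly_Mapping.keys f")
    case True
    then have "Poly_Mapping.keys m \<subseteq> {..<n}" "\<forall>i<n. Poly_Mapping.lookup m i = 0"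
      using assms by (auto simp: homogeneous_def)
    then have "m = 0" by (intro poly_mapping_eqI) (metis in_keys_iff lessThan_iff lookup_zero subsetD)
    then show ?thesis by (simp add: const_poly_def)
  next
    case False
    then show ?thesis by (cases "m = 0") (simp_all add: const_poly_def lookup_single in_keys_iff)
  qed
qed

lemma single_power:
  "Poly_Mapping.single m (c::'a::comm_semiring_1) ^ k = Poly_Mapping.single (Poly_Mapping.map ((*) k) m) (c ^ k)"
proof (induct k)
  case 0
  have "Poly_Mapping.map ((*) 0) m = 0"
    by (rule poly_mapping_eqI) (simp add: map.rep_eq)
  then show ?case by (simp only: power_0 single_one)
next
  case (Suc k)
  have "m + Poly_Mapping.map ((*) k) m = Poly_Mapping.map ((*) (Suc k)) m"
    by (rule poly_mapping_eqI) (simp add: map.rep_eq lookup_add when_def)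
  then show ?case by (simp only: power_Suc Suc mult_single)
qed

context hyperplane
begin

lemma restrict_idem: "red (red f) = red f"
  by (induct f rule: mpoly_induct)
    (simp_all only: restr.eval_const restr.eval_var restr.eval_add restr.eval_mult restrict_hyperplane_point)

text \<open>Each \<open>hyperplane_point\<close> has constant derivatives, and the product rule
  stays in the image of \<open>red\<close>. In this image divisibility by \<open>lin\<close> means
  being \<open>0\<close>, so a derivative that vanishes on the hyperplane vanishes outright.\<close>

lemma pd_restrict_in_range: "\<exists>g. pd i (red f) = red g"
proof (induct f rule: mpoly_induct)
  case (const c)
  show ?case by (rule exI[of _ 0]) (simp add: restr.eval_const)
next
  case (var j)
  have "\<exists>c. pd i (hyperplane_point n \<alpha> j) = const_poly c"
  proof (cases "j = 0")
    case True
    have "pd i (const_poly (\<alpha> k / \<alpha> 0) * var k) = const_poly (if i = k then \<alpha> k / \<alpha> 0 else 0)" for k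
      by (simp add: pd_mult pd_var del: One_nat_def)
    then have "pd i (\<Sum>k\<in>{1..<n}. const_poly (\<alpha> k / \<alpha> 0) * var k)
        = const_poly (\<Sum>k\<in>{1..<n}. if i = k then \<alpha> k / \<alpha> 0 else 0)"
      unfolding pd_sum const_poly.hom_sum by (intro sum.cong refl)
    then have "pd i (hyperplane_point n \<alpha> j) = const_poly (- (\<Sum>k\<in>{1..<n}. if i = k then \<alpha> k / \<alpha> 0 else 0))"
      unfolding hyperplane_point_def if_P[OF True] pd_uminus const_poly.hom_uminus by (rule arg_cong)
    then show ?thesis by blast
  next
    case False
    then have "pd i (hyperplane_point n \<alpha> j) = const_poly (if i = j then 1 else 0)"
      by (simp add: hyperplane_point_def pd_var del: One_nat_def)
    then show ?thesis by blast
  qed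
  then obtain c where "pd i (hyperplane_point n \<alpha> j) = const_poly c" ..
  then have "pd i (red (var j)) = red (const_poly c)" by (simp only: restr.eval_var restr.eval_const)
  then show ?case ..
next
  case (add f g)
  then obtain f' g' where "pd i (red f) = red f'" "pd i (red g) = red g'" by blast
  then have "pd i (red (f + g)) = red (f' + g')" by (simp only: restr.eval_add pd_add)
  then show ?case ..
next
  case (mult f g)
  then obtain f' g' where "pd i (red f) = red f'" "pd i (red g) = red g'" by blast
  then have "pd i (red (f * g)) = red (f' * g + f * g')"
    by (simp only: restr.eval_mult restr.eval_add pd_mult)
  then show ?case ..
qed

end

context frobenius_extension
begin

text \<open>In characteristic \<open>p\<close> vanishing derivatives force all exponents to be
  multiples of \<open>p\<close>. Dividing them by \<open>p\<close> and taking \<open>p\<close>-th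
  roots of the coefficients gives \<open>g\<close>.\<close>

lemma pd_0_imp_power:
  assumes f: "homogeneous n d f" and pd: "\<And>i. i < n \<Longrightarrow> pd i f = (0 :: 'b mpoly)"
  obtains g where "f = g ^ p" "homogeneous n (d div p) g"
proof -
  have dvd: "p dvd Poly_Mapping.lookup m i" if m: "m \<in> Poly_Mapping.keys f" for m i
  proof (cases "Poly_Mapping.lookup m i = 0")
    case False
    have "pd i f = 0" using pd pd_eq_0_of_homogeneous[OF f] by (cases "i < n") simp_all
    have "m = (m - Poly_Mapping.single i 1) + Poly_Mapping.single i 1"
      by (rule poly_mapping_eqI) (use False in \<open>auto simp: lookup_minus lookup_add lookup_single when_def\<close>)
    moreover have "Suc (Poly_Mapping.lookup (m - Poly_Mapping.single i 1) i) = Poly_Mapping.lookup m i"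
      using False by (simp add: lookup_minus)
    ultimately have "Poly_Mapping.lookup (pd i f) (m - Poly_Mapping.single i 1)
        = of_nat (Poly_Mapping.lookup m i) * Poly_Mapping.lookup f m"
      unfolding lookup_pd by metis
    then have "of_nat (Poly_Mapping.lookup m i) * Poly_Mapping.lookup f m = 0"
      unfolding \<open>pd i f = 0\<close> by simp
    moreover have "Poly_Mapping.lookup f m \<noteq> 0" using m by (simp add: in_keys_iff)
    ultimately have "of_nat (Poly_Mapping.lookup m i) = (0 :: 'b)" by simp
    then show ?thesis unfolding of_nat_eq_0_iff_char_dvd char .
  qed simp
  define rt where "rt y = (SOME z. z ^ p = y)" for y :: 'b
  have rt: "rt y ^ p = y" for y unfolding rt_def by (rule someI_ex[OF perfect])
  define quot where "quot m = Poly_Mapping.map (\<lambda>k. k div p) m" for m :: "nat \<Rightarrow>\<^sub>0 nat"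
  have lookup_quot: "Poly_Mapping.lookup (quot m) i = Poly_Mapping.lookup m i div p" for m i
    by (simp add: quot_def map.rep_eq when_def)
  have quot: "Poly_Mapping.map ((*) p) (quot m) = m" if "m \<in> Poly_Mapping.keys f" for m
  proof (rule poly_mapping_eqI)
    fix i
    show "Poly_Mapping.lookup (Poly_Mapping.map ((*) p) (quot m)) i = Poly_Mapping.lookup m i"
      using dvd_mult_div_cancel[OF dvd[OF that, of i]] by (auto simp: map.rep_eq when_def lookup_quot)
  qed
  define g where "g = (\<Sum>m\<in>Poly_Mapping.keys f. Poly_Mapping.single (quot m) (rt (Poly_Mapping.lookup f m)))"
  have "g ^ p = (\<Sum>m\<in>Poly_Mapping.keys f. Poly_Mapping.single m (Poly_Mapping.lookup f m))"
    unfolding g_def frobenius_sum_mpoly by (rule sum.cong) (simp_all add: single_power quot rt)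
  then have "f = g ^ p" using mpoly_eq_sum_single[of f] by simp
  moreover have "homogeneous n (d div p) g"
    unfolding g_def
  proof (rule homogeneous_sum)
    fix m assume m: "m \<in> Poly_Mapping.keys f"
    then have *: "Poly_Mapping.keys m \<subseteq> {..<n}" "(\<Sum>i<n. Poly_Mapping.lookup m i) = d"
      using f by (auto simp: homogeneous_def)
    have "(\<Sum>i<n. Poly_Mapping.lookup (quot m) i) * p = (\<Sum>i<n. Poly_Mapping.lookup m i)"
      unfolding sum_distrib_right lookup_quot using dvd[OF m] by simp
    then have "(\<Sum>i<n. Poly_Mapping.lookup (quot m) i) = d div p" using *(2) p_pos by auto
    moreover have "Poly_Mapping.keys (quot m) \<subseteq> {..<n}"
    proof
      fix i assume "i \<in> Poly_Mapping.keys (quot m)"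
      then have "Poly_Mapping.lookup m i div p \<noteq> 0" unfolding in_keys_iff lookup_quot .
      then have "Poly_Mapping.lookup m i \<noteq> 0" by (metis div_0)
      then have "i \<in> Poly_Mapping.keys m" unfolding in_keys_iff .
      with *(1) show "i \<in> {..<n}" by blast
    qed
    ultimately show "homogeneous n (d div p) (Poly_Mapping.single (quot m) (rt (Poly_Mapping.lookup f m)))"
      by (simp add: homogeneous_def)
  qed
  ultimately show ?thesis using that by blast
qed

end

lemma CHAR_fract: "CHAR('a::idom fract) = CHAR('a)"
proof (rule CHAR_eqI)
  have hom: "to_fract (of_nat k :: 'a) = of_nat k" for k by (induct k) simp_all
  show "of_nat (CHAR('a)) = (0 :: 'a fract)" using hom[of "CHAR('a)"] by simp
  fix k assume "of_nat k = (0 :: 'a fract)"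
  then have "(of_nat k :: 'a) = 0" using hom[of k] by simp
  then show "CHAR('a) dvd k" by (simp add: of_nat_eq_0_iff_char_dvd)
qed

section \<open>Isotropic vectors as linear relations\<close>

context anisotropic_hypersurface
begin

abbreviation "n \<equiv> length bs"

lemma field_embedding_FF: "field_embedding FF \<theta>"
  unfolding field_embedding_def field_embedding_axioms_def
  using field_FF \<theta>_add \<theta>_mult \<theta>_one by blast

sublocale FF: field_embedding FF \<theta>
  by (rule field_embedding_FF)

lemma frobenius_sum_fract: "sum f A ^ p = (\<Sum>i\<in>A. (f i :: 'b mpoly fract) ^ p)"
  by (rule freshmans_dream_sum) (simp_all only: CHAR_fract CHAR_mpoly char p)

text \<open>By Freshman's dream the extended form becomes the \<open>p\<close>-th power of the
  linear form with coefficients \<open>cst (\<gamma> j)\<close>; its zeros are therefore the linear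
  relations between these.\<close>

lemma ext_form_eq:
  assumes root: "\<forall>j<length cs. \<gamma> j ^ p = \<iota> (\<psi> (cs ! j))"
    and x: "x \<in> carrier (FF.coord_space (length cs))"
  shows "\<theta> (ext_form p FF (function_field_embed p \<phi> bs) \<psi> cs x)
           = FF.combination (length cs) (\<lambda>j. cst (\<gamma> j)) x ^ p"
    and "ext_form p FF (function_field_embed p \<phi> bs) \<psi> cs x \<in> carrier FF"
proof -
  have x': "x j \<in> carrier FF" if "j < length cs" for j
    using x that by (auto simp: PiE_mem)
  have closed: "function_field_embed p \<phi> bs (\<psi> (cs ! j)) \<otimes>\<^bsub>FF\<^esub> (x j [^]\<^bsub>FF\<^esub> p) \<in> carrier FF"
    if "j < length cs" for j
    using x'[OF that] function_field_embed_closed by simp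
  show "ext_form p FF (function_field_embed p \<phi> bs) \<psi> cs x \<in> carrier FF"
    unfolding ext_form_def using closed by (intro FF.finsum_closed) auto
  have "\<theta> (function_field_embed p \<phi> bs (\<psi> (cs ! j)) \<otimes>\<^bsub>FF\<^esub> (x j [^]\<^bsub>FF\<^esub> p)) = (\<theta> (x j) * cst (\<gamma> j)) ^ p"
    if "j < length cs" for j
  proof -
    have "\<theta> (function_field_embed p \<phi> bs (\<psi> (cs ! j)) \<otimes>\<^bsub>FF\<^esub> (x j [^]\<^bsub>FF\<^esub> p))
        = cst (\<iota> (\<psi> (cs ! j))) * \<theta> (x j) ^ p"
      using x'[OF that] function_field_embed_closed
      by (simp only: FF.embed_mult FF.embed_pow FF.nat_pow_closed \<theta>_function_field_embed)
    also have "cst (\<iota> (\<psi> (cs ! j))) = cst (\<gamma> j) ^ p"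
      unfolding root[rule_format, OF that, symmetric] const_poly.hom_power generic_val.hom_power ..
    finally show ?thesis by (simp only: power_mult_distrib mult.commute)
  qed
  then have "\<theta> (ext_form p FF (function_field_embed p \<phi> bs) \<psi> cs x)
      = (\<Sum>j<length cs. (\<theta> (x j) * cst (\<gamma> j)) ^ p)"
    unfolding ext_form_def using closed by (subst FF.embed_finsum) auto
  then show "\<theta> (ext_form p FF (function_field_embed p \<phi> bs) \<psi> cs x)
      = FF.combination (length cs) (\<lambda>j. cst (\<gamma> j)) x ^ p"
    by (simp only: FF.combination_def frobenius_sum_fract)
qed

lemma isotropic_vectors_eq:
  assumes "\<forall>j<length cs. \<gamma> j ^ p = \<iota> (\<psi> (cs ! j))"
  shows "{v \<in> carrier (ext_space FF cs). ext_form p FF (function_field_embed p \<phi> bs) \<psi> cs v = \<zero>\<^bsub>FF\<^esub>}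
           = FF.relations (length cs) (\<lambda>j. cst (\<gamma> j))"
proof -
  have "ext_form p FF (function_field_embed p \<phi> bs) \<psi> cs v = \<zero>\<^bsub>FF\<^esub> \<longleftrightarrow> FF.combination (length cs) (\<lambda>j. cst (\<gamma> j)) v = 0"
    if "v \<in> carrier (FF.coord_space (length cs))" for v
    using FF.embed_eq_0_iff[OF ext_form_eq(2)[OF assms that]] ext_form_eq(1)[OF assms that] p_pos by simp
  then show ?thesis unfolding ext_space_def FF.relations_def by blast
qed

lemma isotropic_over_function_field_iff:
  assumes "\<forall>j<length cs. \<gamma> j ^ p = \<iota> (\<psi> (cs ! j))"
  shows "isotropic_over_function_field p \<phi> bs \<psi> cs \<longleftrightarrow> FF.relations_dim (length cs) (\<lambda>j. cst (\<gamma> j)) \<noteq> 0"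
  unfolding FF.relations_dim_eq_0_iff isotropic_over_function_field_def isotropic_def
    isotropic_vectors_eq[OF assms, symmetric] ext_space_def by blast

lemma first_defect_index_eq: "first_defect_index p \<phi> bs = FF.relations_dim n (\<lambda>i. cst (\<alpha> i))"
proof -
  have roots: "\<forall>j<length bs. \<alpha> j ^ p = \<iota> (\<phi> (bs ! j))" using root by blast
  show ?thesis
  unfolding first_defect_index_def defect_index_def isotropic_vectors_eq[of bs \<alpha> \<phi>, OF roots]
    FF.relations_dim_def unfolding ext_space_def ..
qed

text \<open>\<open>c\<close> is the value of the product of all denominators. Multiplying each
  numerator by the other denominators also brings all components to the same degree, the sum of the
  \<open>d j\<close>.\<close>

lemma clear_denominators:
  assumes "v \<in> carrier (FF.coord_space m)"
  obtains u D c where "c \<noteq> 0" "\<And>j. j < m \<Longrightarrow> hdeg D (u j)" "\<And>j. j < m \<Longrightarrow> val (u j) = c * \<theta> (v j)"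
proof -
  have "\<exists>f g d. hdeg d f \<and> hdeg d g \<and> \<not> \<Phi> dvd g \<and> \<theta> (v j) = val f / val g" if "j < m" for j
  proof -
    have "v j \<in> carrier FF" using assms that by (auto simp: PiE_mem)
    then show ?thesis by (rule \<theta>_cases) blast
  qed
  then obtain f g d where fg: "\<And>j. j < m \<Longrightarrow> hdeg (d j) (f j)" "\<And>j. j < m \<Longrightarrow> hdeg (d j) (g j)"
      "\<And>j. j < m \<Longrightarrow> \<not> \<Phi> dvd g j" "\<And>j. j < m \<Longrightarrow> \<theta> (v j) = val (f j) / val (g j)"
    by metis
  have g0: "val (g j) \<noteq> 0" if "j < m" for j
    using fg(3)[OF that] by (simp only: val_eq_0_iff not_False_eq_True)
  define c where "c = (\<Prod>j<m. val (g j))"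
  define u where "u j = f j * prod g ({..<m} - {j})" for j
  have "c \<noteq> 0" unfolding c_def using g0 by (simp add: prod_zero_iff)
  moreover have "hdeg (sum d {..<m}) (u j)" if "j < m" for j
  proof -
    have "hdeg (d j + sum d ({..<m} - {j})) (u j)"
      unfolding u_def using that fg by (intro homogeneous_mult homogeneous_prod) auto
    then show ?thesis using sum.remove[of "{..<m}" j d] that by simp
  qed
  moreover have "val (u j) = c * \<theta> (v j)" if "j < m" for j
  proof -
    have "c = val (g j) * val (prod g ({..<m} - {j}))"
      unfolding c_def val.hom_prod using prod.remove[of "{..<m}" j "\<lambda>j. val (g j)"] that by simp
    then show ?thesis
      unfolding u_def val.hom_mult fg(4)[OF that] using g0[OF that] by simp
  qed
  ultimately show ?thesis using that by blast
qed

text \<open>A form of positive degree has no value in \<open>FF\<close> by itself; division by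
  \<open>var 1 ^ D\<close> makes it a fraction of degree \<open>0\<close>.\<close>

lemma ex_coord:
  assumes "\<And>j. j < m \<Longrightarrow> hdeg D (u j)"
  shows "\<exists>v\<in>carrier (FF.coord_space m). \<forall>j<m. \<theta> (v j) = val (u j) / val (var 1) ^ D"
proof -
  have "hdeg (1 * D) (var 1 ^ D :: 'a mpoly)"
    by (rule homogeneous_power[OF homogeneous_var]) (use n2 in simp)
  then have hd: "hdeg D (var 1 ^ D :: 'a mpoly)" by (simp only: mult_1_left)
  have nd: "\<not> \<Phi> dvd var 1 ^ D"
    using val_var_1_neq_0 by (simp only: val_eq_0_iff[symmetric] val.hom_power power_eq_0_iff) simp
  have "\<exists>\<xi>\<in>carrier FF. \<theta> \<xi> = val (u j) / val (var 1) ^ D" if "j < m" for j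
    using ex_\<theta>[OF assms[OF that] hd nd] unfolding val.hom_power .
  then obtain w where "\<And>j. j < m \<Longrightarrow> w j \<in> carrier FF \<and> \<theta> (w j) = val (u j) / val (var 1) ^ D" by metis
  then show ?thesis by (intro bexI[of _ "restrict w {..<m}"]) auto
qed

text \<open>\<open>y\<close> combines the derivatives of \<open>u\<close> with coefficients
  \<open>x i\<close>; interchanging the sums and applying \<open>pd_simple_tuple\<close> produces
  the factor \<open>h\<close>. The exponent \<open>d - 1\<close> is the degree of the
  derivatives.\<close>

lemma simple_tuple_multiplier:
  assumes u: "\<forall>j<m. hdeg d (u j)" and g: "tuple_sum \<iota> m \<gamma> u = lin * g" "\<not> lin dvd g"
    and x: "x \<in> carrier (FF.coord_space n)"
  defines "h \<equiv> generic_val g / val (var 1) ^ (d - 1)"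
  shows "h \<noteq> 0"
    and "\<exists>y\<in>carrier (FF.coord_space m). FF.combination m (\<lambda>j. cst (\<gamma> j)) y = h * FF.combination n (\<lambda>i. cst (\<alpha> i)) x
      \<and> (\<forall>j<m. \<theta> (y j) = (\<Sum>i<n. \<theta> (x i) * val (pd i (u j))) / val (var 1) ^ (d - 1))"
proof -
  have "generic_val g \<noteq> 0" using g(2) by (simp only: generic_val_eq_0_iff not_False_eq_True)
  then show "h \<noteq> 0" using val_var_1_neq_0 by (simp add: h_def)
  have "\<exists>v\<in>carrier (FF.coord_space m). \<forall>j<m. \<theta> (v j) = val (pd i (u j)) / val (var 1) ^ (d - 1)" for i
    by (rule ex_coord) (use u homogeneous_pd in blast)
  then obtain w where w: "\<And>i. w i \<in> carrier (FF.coord_space m)"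
      "\<And>i j. j < m \<Longrightarrow> \<theta> (w i j) = val (pd i (u j)) / val (var 1) ^ (d - 1)"
    by metis
  have x': "x i \<in> carrier FF" if "i < n" for i using x that by (auto simp: PiE_mem)
  have w': "w i j \<in> carrier FF" if "j < m" for i j using w(1)[of i] that by (auto simp: PiE_mem)
  define y where "y = restrict (\<lambda>j. \<Oplus>\<^bsub>FF\<^esub>i\<in>{..<n}. x i \<otimes>\<^bsub>FF\<^esub> w i j) {..<m}"
  have y: "y \<in> carrier (FF.coord_space m)"
    using x' w' by (auto simp: y_def intro!: FF.finsum_closed)
  have \<theta>_y: "\<theta> (y j) = (\<Sum>i<n. \<theta> (x i) * val (pd i (u j))) / val (var 1) ^ (d - 1)" if "j < m" for j
  proof -
    have "\<theta> (y j) = (\<Sum>i<n. \<theta> (x i \<otimes>\<^bsub>FF\<^esub> w i j))"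
      using that x' w' by (simp add: y_def) (intro FF.embed_finsum, auto)
    also have "\<dots> = (\<Sum>i<n. \<theta> (x i) * val (pd i (u j)) / val (var 1) ^ (d - 1))"
      using x' w' that by (intro sum.cong refl) (simp add: FF.embed_mult w(2))
    finally show ?thesis by (simp only: sum_divide_distrib)
  qed
  have "FF.combination m (\<lambda>j. cst (\<gamma> j)) y
      = (\<Sum>j<m. \<Sum>i<n. \<theta> (x i) * (cst (\<gamma> j) * val (pd i (u j)) / val (var 1) ^ (d - 1)))"
    unfolding FF.combination_def
  proof (intro sum.cong refl)
    fix j assume "j \<in> {..<m}"
    then have "j < m" by simp
    show "\<theta> (y j) * cst (\<gamma> j) = (\<Sum>i<n. \<theta> (x i) * (cst (\<gamma> j) * val (pd i (u j)) / val (var 1) ^ (d - 1)))"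
      unfolding \<theta>_y[OF \<open>j < m\<close>] sum_divide_distrib sum_distrib_right
      by (intro sum.cong refl) (simp add: ac_simps)
  qed
  also have "\<dots> = (\<Sum>i<n. \<theta> (x i) * ((\<Sum>j<m. cst (\<gamma> j) * val (pd i (u j))) / val (var 1) ^ (d - 1)))"
    unfolding sum_divide_distrib sum_distrib_left by (rule sum.swap)
  also have "\<dots> = (\<Sum>i<n. \<theta> (x i) * (cst (\<alpha> i) * h))"
    by (intro sum.cong refl) (simp add: pd_simple_tuple[OF g(1)] h_def)
  also have "\<dots> = h * FF.combination n (\<lambda>i. cst (\<alpha> i)) x"
    by (simp add: FF.combination_def sum_distrib_left ac_simps)
  finally show "\<exists>y\<in>carrier (FF.coord_space m). FF.combination m (\<lambda>j. cst (\<gamma> j)) y = h * FF.combination n (\<lambda>i. cst (\<alpha> i)) x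
      \<and> (\<forall>j<m. \<theta> (y j) = (\<Sum>i<n. \<theta> (x i) * val (pd i (u j))) / val (var 1) ^ (d - 1))"
    using y \<theta>_y by blast
qed

lemma relation_imp_tuple:
  assumes v: "v \<in> FF.relations m (\<lambda>j. cst (\<gamma> j))" "v \<noteq> \<zero>\<^bsub>FF.coord_space m\<^esub>"
  obtains u D k where "\<And>j. j < m \<Longrightarrow> hdeg D (u j)" "k < m" "\<not> \<Phi> dvd u k" "lin dvd tuple_sum \<iota> m \<gamma> u"
proof -
  have v': "v \<in> carrier (FF.coord_space m)" "FF.combination m (\<lambda>j. cst (\<gamma> j)) v = 0"
    using v(1) by (simp_all add: FF.relations_def)
  obtain u D c where u: "c \<noteq> 0" "\<And>j. j < m \<Longrightarrow> hdeg D (u j)" "\<And>j. j < m \<Longrightarrow> val (u j) = c * \<theta> (v j)"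
    using v'(1) by (rule clear_denominators) (rule that)
  have "generic_val (tuple_sum \<iota> m \<gamma> u) = c * FF.combination m (\<lambda>j. cst (\<gamma> j)) v"
    unfolding generic_val_tuple_sum FF.combination_def sum_distrib_left
    by (intro sum.cong refl) (simp add: u(3))
  then have "lin dvd tuple_sum \<iota> m \<gamma> u" unfolding generic_val_eq_0_iff[symmetric] v'(2) by simp
  moreover have "\<exists>k<m. v k \<noteq> \<zero>\<^bsub>FF\<^esub>"
  proof (rule ccontr)
    assume "\<not> ?thesis"
    then have "v = \<zero>\<^bsub>FF.coord_space m\<^esub>" using v'(1) by (intro ext) (auto simp: PiE_def extensional_def)
    with v(2) show False by contradiction
  qed
  then obtain k where k: "k < m" "v k \<noteq> \<zero>\<^bsub>FF\<^esub>" by blast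
  then have "\<theta> (v k) \<noteq> 0" using FF.embed_eq_0_iff[of "v k"] v'(1) by (auto simp: PiE_mem)
  then have "val (u k) \<noteq> 0" using u(1) u(3)[OF k(1)] by simp
  then have "\<not> \<Phi> dvd u k" by (simp only: val_eq_0_iff not_False_eq_True)
  ultimately show ?thesis using that u(2) k(1) by blast
qed

lemma simple_tuple_image:
  assumes u: "\<forall>j<m. hdeg d (u j)" and g: "tuple_sum \<iota> m \<gamma> u = lin * g" "\<not> lin dvd g"
  defines "h \<equiv> generic_val g / val (var 1) ^ (d - 1)"
  shows "FF.combination n (\<lambda>i. h * cst (\<alpha> i)) ` carrier (FF.coord_space n)
    \<subseteq> FF.combination m (\<lambda>j. cst (\<gamma> j)) ` carrier (FF.coord_space m)"
proof
  fix z assume "z \<in> FF.combination n (\<lambda>i. h * cst (\<alpha> i)) ` carrier (FF.coord_space n)"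
  then obtain x where x: "x \<in> carrier (FF.coord_space n)" and z: "z = FF.combination n (\<lambda>i. h * cst (\<alpha> i)) x"
    by blast
  from simple_tuple_multiplier(2)[OF u g x, folded h_def]
  obtain y where "y \<in> carrier (FF.coord_space m)"
    "FF.combination m (\<lambda>j. cst (\<gamma> j)) y = h * FF.combination n (\<lambda>i. cst (\<alpha> i)) x"
    by blast
  then show "z \<in> FF.combination m (\<lambda>j. cst (\<gamma> j)) ` carrier (FF.coord_space m)"
    unfolding z FF.combination_scale by (intro image_eqI[where x = y]) (rule sym)
qed

text \<open>One nontrivial relation leads to a simple tuple, whose derivatives put a nonzero
  multiple of the span of the \<open>\<alpha> i\<close> inside the span of the
  \<open>\<gamma> j\<close>. Scaling changes no relation, so the ranks compare in the direction
  opposite to \<open>relations_dim_span\<close>.\<close>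

lemma relations_dim_isotropic:
  assumes \<gamma>: "lin_indep_over \<iota> m \<gamma>" and iso: "FF.relations_dim m (\<lambda>j. cst (\<gamma> j)) \<noteq> 0"
  shows "n + FF.relations_dim m (\<lambda>j. cst (\<gamma> j)) \<le> m + FF.relations_dim n (\<lambda>i. cst (\<alpha> i))"
proof -
  obtain v where v: "v \<in> FF.relations m (\<lambda>j. cst (\<gamma> j))" "v \<noteq> \<zero>\<^bsub>FF.coord_space m\<^esub>"
    using iso unfolding FF.relations_dim_eq_0_iff by blast
  obtain u0 D k where u0: "\<And>j. j < m \<Longrightarrow> hdeg D (u0 j)" "k < m" "\<not> \<Phi> dvd u0 k" "lin dvd tuple_sum \<iota> m \<gamma> u0"
    using v by (rule relation_imp_tuple) (rule that)
  obtain u d g where u: "\<And>j. j < m \<Longrightarrow> hdeg d (u j)" and g: "tuple_sum \<iota> m \<gamma> u = lin * g" "\<not> lin dvd g"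
    by (rule ex_simple_tuple[OF \<gamma> u0(1) u0(2-4)]) (assumption, rule that)
  have u': "\<forall>j<m. hdeg d (u j)" using u by blast
  have h: "generic_val g / val (var 1) ^ (d - 1) \<noteq> 0"
    using g(2) val_var_1_neq_0 by (simp add: generic_val_eq_0_iff)
  from FF.relations_dim_mono[OF simple_tuple_image[OF u' g]] show ?thesis
    unfolding FF.relations_dim_scale[OF h] .
qed

section \<open>Rational morphisms\<close>

lemma val_pullback:
  assumes root: "\<forall>j<length cs. \<gamma> j ^ p = \<iota> (\<psi> (cs ! j))"
  shows "val (subst_poly u (form_poly p \<psi> cs)) = (\<Sum>j<length cs. cst (\<gamma> j) * val (u j)) ^ p"
proof -
  interpret subst: mp_evaluation const_poly u by (rule mp_evaluationI) (rule const_poly.comm_ring_hom_axioms)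
  have "val (subst_poly u (form_poly p \<psi> cs)) = (\<Sum>j<length cs. cst (\<iota> (\<psi> (cs ! j))) * val (u j) ^ p)"
    unfolding subst_poly_eq_mp_eval form_poly_eq_power_form power_form_def single_var_power[of _ p]
      subst.eval.hom_sum subst.eval_mult subst.eval.hom_power subst.eval_const subst.eval_var
      val.hom_sum val.hom_mult val.hom_power coeff_map_const ..
  also have "\<dots> = (\<Sum>j<length cs. (cst (\<gamma> j) * val (u j)) ^ p)"
  proof (intro sum.cong refl)
    fix j assume "j \<in> {..<length cs}"
    then have "cst (\<iota> (\<psi> (cs ! j))) = cst (\<gamma> j) ^ p"
      unfolding generic_val.hom_power[symmetric] const_poly.hom_power[symmetric] using root by simp
    then show "cst (\<iota> (\<psi> (cs ! j))) * val (u j) ^ p = (cst (\<gamma> j) * val (u j)) ^ p"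
      by (simp only: power_mult_distrib)
  qed
  finally show ?thesis by (simp only: frobenius_sum_fract)
qed

text \<open>The pulled back equation of \<open>\<psi>\<close> has as its value the
  \<open>p\<close>-th power of the value of \<open>tuple_sum\<close>, and both vanish
  together.\<close>

lemma rational_tuples_iff:
  assumes root: "\<forall>j<length cs. \<gamma> j ^ p = \<iota> (\<psi> (cs ! j))"
  shows "fs \<in> rational_tuples p \<phi> bs \<psi> cs \<longleftrightarrow> length fs = length cs \<and> (\<exists>d. \<forall>f\<in>set fs. hdeg d f) \<and>
    (\<exists>f\<in>set fs. \<not> \<Phi> dvd f) \<and> lin dvd tuple_sum \<iota> (length cs) \<gamma> ((!) fs)"
proof -
  have "\<Phi> dvd subst_poly ((!) fs) (form_poly p \<psi> cs) \<longleftrightarrow> lin dvd tuple_sum \<iota> (length cs) \<gamma> ((!) fs)"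
    unfolding val_eq_0_iff[symmetric] val_pullback[OF root] generic_val_eq_0_iff[symmetric] generic_val_tuple_sum
    using p_pos by simp
  then show ?thesis
    unfolding rational_tuples_def form_poly_eq_power_form[of p \<phi>] mem_Collect_eq by simp
qed

lemma tuple_imp_relation:
  assumes u: "\<forall>j<m. hdeg d (u j)" and k: "k < m" "\<not> \<Phi> dvd u k" and lin: "lin dvd tuple_sum \<iota> m \<gamma> u"
  shows "\<exists>v\<in>FF.relations m (\<lambda>j. cst (\<gamma> j)). v \<noteq> \<zero>\<^bsub>FF.coord_space m\<^esub> \<and> (\<forall>j<m. \<theta> (v j) = val (u j) / val (var 1) ^ d)"
proof -
  obtain v where v: "v \<in> carrier (FF.coord_space m)" "\<forall>j<m. \<theta> (v j) = val (u j) / val (var 1) ^ d"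
    using ex_coord[of m d u] u by blast
  have "FF.combination m (\<lambda>j. cst (\<gamma> j)) v = generic_val (tuple_sum \<iota> m \<gamma> u) / val (var 1) ^ d"
    unfolding FF.combination_def generic_val_tuple_sum sum_divide_distrib
    by (intro sum.cong refl) (use v(2) in simp)
  then have "FF.combination m (\<lambda>j. cst (\<gamma> j)) v = 0" using lin unfolding generic_val_eq_0_iff[symmetric] by simp
  moreover have "v \<noteq> \<zero>\<^bsub>FF.coord_space m\<^esub>"
  proof
    assume "v = \<zero>\<^bsub>FF.coord_space m\<^esub>"
    then have "\<theta> (v k) = 0" using k(1) FF.embed_zero by simp
    then have "val (u k) = 0" using v(2) k(1) val_var_1_neq_0 by simp
    with k(2) show False unfolding val_eq_0_iff by contradiction
  qed
  ultimately show ?thesis using v unfolding FF.relations_def by blast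
qed

text \<open>Both tuples give vectors in a one-dimensional space of relations; powers of
  \<open>var 1\<close> make up for the difference between the degrees \<open>d\<close> and
  \<open>e\<close>.\<close>

lemma tuples_proportional:
  assumes dim: "FF.relations_dim m (\<lambda>j. cst (\<gamma> j)) = 1"
    and u: "\<forall>j<m. hdeg d (u j)" "k < m" "\<not> \<Phi> dvd u k" "lin dvd tuple_sum \<iota> m \<gamma> u"
    and w: "\<forall>j<m. hdeg e (w j)" "l < m" "\<not> \<Phi> dvd w l" "lin dvd tuple_sum \<iota> m \<gamma> w"
  shows "\<exists>c. \<forall>j<m. val (w j) = c * val (u j)"
proof -
  obtain x where x: "x \<in> FF.relations m (\<lambda>j. cst (\<gamma> j))" "x \<noteq> \<zero>\<^bsub>FF.coord_space m\<^esub>"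
      "\<forall>j<m. \<theta> (x j) = val (u j) / val (var 1) ^ d"
    using tuple_imp_relation[OF u] by blast
  obtain y where y: "y \<in> FF.relations m (\<lambda>j. cst (\<gamma> j))" "\<forall>j<m. \<theta> (y j) = val (w j) / val (var 1) ^ e"
    using tuple_imp_relation[OF w] by blast
  obtain b where b: "b \<in> carrier FF" "y = b \<odot>\<^bsub>FF.coord_space m\<^esub> x"
    using FF.relations_dim_1_multiple[OF dim x(1,2) y(1)] by blast
  have "val (w j) = (\<theta> b * val (var 1) ^ e / val (var 1) ^ d) * val (u j)" if "j < m" for j
  proof -
    have "x j \<in> carrier FF" using x(1) that by (auto simp: FF.relations_def PiE_mem)
    then have "\<theta> (y j) = \<theta> b * \<theta> (x j)" using that b by (simp add: FF.embed_mult)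
    then have "val (w j) / val (var 1) ^ e = \<theta> b * (val (u j) / val (var 1) ^ d)" using x(3) y(2) that by simp
    then show ?thesis using val_var_1_neq_0 by (simp add: field_simps)
  qed
  then show ?thesis by blast
qed

lemma rational_tuplesE:
  assumes root: "\<forall>j<length cs. \<gamma> j ^ p = \<iota> (\<psi> (cs ! j))" and fs: "fs \<in> rational_tuples p \<phi> bs \<psi> cs"
  shows "\<exists>d k. (\<forall>j<length cs. hdeg d (fs ! j)) \<and> k < length cs \<and> \<not> \<Phi> dvd fs ! k
    \<and> lin dvd tuple_sum \<iota> (length cs) \<gamma> ((!) fs)"
  using fs unfolding rational_tuples_iff[OF root] by (metis in_set_conv_nth nth_mem)

lemma same_rational_morphism_total:
  assumes root: "\<forall>j<length cs. \<gamma> j ^ p = \<iota> (\<psi> (cs ! j))"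
    and dim: "FF.relations_dim (length cs) (\<lambda>j. cst (\<gamma> j)) = 1"
    and fs: "fs \<in> rational_tuples p \<phi> bs \<psi> cs" and gs: "gs \<in> rational_tuples p \<phi> bs \<psi> cs"
  shows "(fs, gs) \<in> same_rational_morphism p \<phi> bs \<psi> cs"
proof -
  obtain d k where u: "\<forall>j<length cs. hdeg d (fs ! j)" "k < length cs" "\<not> \<Phi> dvd fs ! k"
      "lin dvd tuple_sum \<iota> (length cs) \<gamma> ((!) fs)"
    using rational_tuplesE[OF root fs] by blast
  obtain e l where w: "\<forall>j<length cs. hdeg e (gs ! j)" "l < length cs" "\<not> \<Phi> dvd gs ! l"
      "lin dvd tuple_sum \<iota> (length cs) \<gamma> ((!) gs)"
    using rational_tuplesE[OF root gs] by blast
  obtain c where c: "\<forall>j<length cs. val (gs ! j) = c * val (fs ! j)"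
    using tuples_proportional[OF dim u w] by blast
  have "\<Phi> dvd fs ! i * gs ! j - fs ! j * gs ! i" if "i < length cs" "j < length cs" for i j
  proof -
    have "val (fs ! i * gs ! j - fs ! j * gs ! i) = 0"
      unfolding val.hom_minus val.hom_mult using c that by simp
    then show ?thesis unfolding val_eq_0_iff .
  qed
  then show ?thesis
    unfolding same_rational_morphism_def form_poly_eq_power_form[of p \<phi>] using fs gs by simp
qed

lemma rational_tuples_nonempty:
  assumes root: "\<forall>j<length cs. \<gamma> j ^ p = \<iota> (\<psi> (cs ! j))"
    and dim: "FF.relations_dim (length cs) (\<lambda>j. cst (\<gamma> j)) \<noteq> 0"
  shows "rational_tuples p \<phi> bs \<psi> cs \<noteq> {}"
proof -
  obtain v where v: "v \<in> FF.relations (length cs) (\<lambda>j. cst (\<gamma> j))" "v \<noteq> \<zero>\<^bsub>FF.coord_space (length cs)\<^esub>"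
    using dim unfolding FF.relations_dim_eq_0_iff by blast
  obtain u D k where u: "\<And>j. j < length cs \<Longrightarrow> hdeg D (u j)" "k < length cs" "\<not> \<Phi> dvd u k"
      "lin dvd tuple_sum \<iota> (length cs) \<gamma> u"
    using v by (rule relation_imp_tuple) (rule that)
  have "tuple_sum \<iota> (length cs) \<gamma> ((!) (map u [0..<length cs])) = tuple_sum \<iota> (length cs) \<gamma> u"
    unfolding tuple_sum_def by (intro sum.cong refl) simp
  then have "map u [0..<length cs] \<in> rational_tuples p \<phi> bs \<psi> cs"
    unfolding rational_tuples_iff[OF root] using u by (auto intro!: exI[of _ D])
  then show ?thesis by blast
qed

text \<open>Any two tuples are equivalent by \<open>same_rational_morphism_total\<close>, so the
  only class is the whole nonempty set of tuples.\<close>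

lemma ex1_rational_morphism:
  assumes root: "\<forall>j<length cs. \<gamma> j ^ p = \<iota> (\<psi> (cs ! j))"
    and dim: "FF.relations_dim (length cs) (\<lambda>j. cst (\<gamma> j)) = 1"
  shows "\<exists>!r. r \<in> rational_morphisms p \<phi> bs \<psi> cs"
proof -
  let ?T = "rational_tuples p \<phi> bs \<psi> cs" and ?S = "same_rational_morphism p \<phi> bs \<psi> cs"
  have "?S `` {fs} = ?T" if "fs \<in> ?T" for fs
    using same_rational_morphism_total[OF root dim that] by (auto simp: same_rational_morphism_def)
  then have "rational_morphisms p \<phi> bs \<psi> cs = (\<lambda>fs. ?T) ` ?T"
    unfolding rational_morphisms_def quotient_def by blast
  moreover have "?T \<noteq> {}" using rational_tuples_nonempty[OF root] dim by simp
  ultimately have "rational_morphisms p \<phi> bs \<psi> cs = {?T}" by auto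
  then show ?thesis by simp
qed

lemma rational_morphism_subset: "r \<in> rational_morphisms p \<phi> bs \<psi> cs \<Longrightarrow> fs \<in> r \<Longrightarrow> fs \<in> rational_tuples p \<phi> bs \<psi> cs"
  unfolding rational_morphisms_def quotient_def same_rational_morphism_def by auto

section \<open>Dominance\<close>

lemma simple_tuple_not_dvd:
  assumes g: "tuple_sum \<iota> m \<gamma> u = lin * g" "\<not> lin dvd g"
  shows "\<exists>k<m. \<not> \<Phi> dvd u k"
proof (rule ccontr)
  assume "\<not> ?thesis"
  then have "\<Phi> dvd u j" if "j < m" for j using that by blast
  then have "emb \<Phi> dvd tuple_sum \<iota> m \<gamma> u"
    unfolding tuple_sum_def by (intro dvd_sum dvd_mult emb.hom_dvd) simp
  \<comment> \<open>After cancelling one \<open>lin\<close> from \<open>emb \<Phi> = lin ^ p\<close>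
    a factor \<open>lin\<close> remains, since \<open>p \<ge> 2\<close>.\<close>
  then have "lin * lin ^ (p - 1) dvd lin * g" unfolding emb_\<Phi> g(1) using p_pos by (simp flip: power_Suc)
  then have "lin ^ (p - 1) dvd g" using linear_form_neq_0 by simp
  moreover have "lin dvd lin ^ (p - 1)" using prime_ge_2_nat[OF p] by (intro dvd_power) simp
  ultimately show False using g(2) dvd_trans by blast
qed

text \<open>The derivatives \<open>\<partial>\<^sub>i u\<close> and \<open>u\<close> span: by dimension the former span the image of \<open>\<gamma>\<close>, and the
  latter spans its kernel.\<close>

lemma simple_tuple_spanning:
  assumes u: "\<forall>j<m. hdeg d (u j)" and g: "tuple_sum \<iota> m \<gamma> u = lin * g" "\<not> lin dvd g"
    and dim: "FF.relations_dim m (\<lambda>j. cst (\<gamma> j)) = 1" "m + FF.relations_dim n (\<lambda>i. cst (\<alpha> i)) = n + 1"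
    and pd0: "\<forall>i<n. (\<Sum>j<m. \<zeta> j * val (pd i (u j))) = 0" and u0: "(\<Sum>j<m. \<zeta> j * val (u j)) = 0"
    and k: "k < m"
  shows "\<zeta> k = 0"
proof -
  define h where "h = generic_val g / val (var 1) ^ (d - 1)"
  note mult = simple_tuple_multiplier[OF u g, folded h_def]
  have h: "h \<noteq> 0" using mult(1)[of "\<zero>\<^bsub>FF.coord_space n\<^esub>"] by simp
  let ?a = "\<lambda>i. h * cst (\<alpha> i)" and ?c = "\<lambda>j. cst (\<gamma> j)"
  from FF.image_combination_eqI[OF simple_tuple_image[OF u g, folded h_def]]
  have image: "FF.combination n ?a ` carrier (FF.coord_space n) = FF.combination m ?c ` carrier (FF.coord_space m)"
    unfolding FF.relations_dim_scale[OF h] using dim by simp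
  \<comment> \<open>The unit vector \<open>e\<close> is split as \<open>y + w\<close>:
    \<open>y\<close> is a combination of the derivatives with the same image under
    \<open>\<gamma>\<close> as \<open>e\<close>, and \<open>w\<close> lies in the kernel, so it is a
    multiple of \<open>u\<close>. Pairing with \<open>\<zeta>\<close> kills both parts and leaves
    \<open>\<zeta> k = 0\<close>.\<close>
  define e where "e = FF.unit_fun m k"
  have e: "e \<in> carrier (FF.coord_space m)" unfolding e_def FF.unit_fun_def by simp
  then have "FF.combination m ?c e \<in> FF.combination n ?a ` carrier (FF.coord_space n)" unfolding image by blast
  then obtain x where x: "x \<in> carrier (FF.coord_space n)"
      and ex: "FF.combination m ?c e = h * FF.combination n (\<lambda>i. cst (\<alpha> i)) x"
    unfolding FF.combination_scale by blast
  from mult(2)[OF x] obtain y where y: "y \<in> carrier (FF.coord_space m)"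
      "FF.combination m ?c y = h * FF.combination n (\<lambda>i. cst (\<alpha> i)) x"
      "\<forall>j<m. \<theta> (y j) = (\<Sum>i<n. \<theta> (x i) * val (pd i (u j))) / val (var 1) ^ (d - 1)"
    by blast
  define w where "w = restrict (\<lambda>j. e j \<ominus>\<^bsub>FF\<^esub> y j) {..<m}"
  have closed: "e j \<in> carrier FF" "y j \<in> carrier FF" if "j < m" for j
    using e y(1) that by (auto simp: PiE_mem)
  have \<theta>_w: "\<theta> (w j) = \<theta> (e j) - \<theta> (y j)" if "j < m" for j
    using FF.embed_diff[OF closed[OF that]] that by (simp add: w_def)
  have "FF.combination m ?c w = FF.combination m ?c e - FF.combination m ?c y"
    unfolding FF.combination_def sum_subtractf[symmetric]
    by (intro sum.cong refl) (simp add: \<theta>_w left_diff_distrib)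
  moreover have "w \<in> carrier (FF.coord_space m)" using closed by (simp add: w_def)
  ultimately have w: "w \<in> FF.relations m ?c" using ex y(2) by (simp add: FF.relations_def)
  obtain l where "l < m" "\<not> \<Phi> dvd u l" using simple_tuple_not_dvd[OF g] by blast
  moreover have "lin dvd tuple_sum \<iota> m \<gamma> u" unfolding g(1) by simp
  ultimately obtain v where v: "v \<in> FF.relations m ?c" "v \<noteq> \<zero>\<^bsub>FF.coord_space m\<^esub>"
      "\<forall>j<m. \<theta> (v j) = val (u j) / val (var 1) ^ d"
    using tuple_imp_relation[OF u] by blast
  obtain b where b: "b \<in> carrier FF" "w = b \<odot>\<^bsub>FF.coord_space m\<^esub> v"
    using FF.relations_dim_1_multiple[OF dim(1) v(1,2) w] by blast
  have v': "v j \<in> carrier FF" if "j < m" for j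
    using v(1) that by (auto simp: FF.relations_def PiE_mem)
  have "(\<Sum>j<m. \<zeta> j * \<theta> (w j)) = \<theta> b / val (var 1) ^ d * (\<Sum>j<m. \<zeta> j * val (u j))"
    unfolding sum_distrib_left
    by (intro sum.cong refl) (use v(3) v' b in \<open>simp add: FF.embed_mult\<close>)
  then have "(\<Sum>j<m. \<zeta> j * \<theta> (w j)) = 0" unfolding u0 by simp
  moreover have "(\<Sum>j<m. \<zeta> j * \<theta> (y j)) = 0"
  proof -
    have "(\<Sum>j<m. \<zeta> j * \<theta> (y j))
        = (\<Sum>j<m. \<Sum>i<n. \<theta> (x i) / val (var 1) ^ (d - 1) * (\<zeta> j * val (pd i (u j))))"
      by (intro sum.cong refl) (use y(3) in \<open>simp add: sum_distrib_left sum_divide_distrib ac_simps\<close>)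
    also have "\<dots> = (\<Sum>i<n. \<theta> (x i) / val (var 1) ^ (d - 1) * (\<Sum>j<m. \<zeta> j * val (pd i (u j))))"
      unfolding sum_distrib_left by (rule sum.swap)
    also have "\<dots> = 0" using pd0 by simp
    finally show ?thesis .
  qed
  ultimately have "(\<Sum>j<m. \<zeta> j * \<theta> (e j)) = 0"
    by (simp add: \<theta>_w right_diff_distrib sum_subtractf)
  moreover have "\<zeta> j * \<theta> (e j) = (if k = j then \<zeta> j else 0)" if "j < m" for j
    using that FF.embed_one FF.embed_zero by (simp add: e_def FF.unit_fun_def)
  ultimately show ?thesis using k by simp
qed

text \<open>Induction on the degree. By \<open>simple_tuple_spanning\<close> the gradient at
  \<open>u\<close> of a form vanishing there is a multiple of \<open>\<gamma>\<close>. For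
  \<open>U.red H\<close> the entry for variable \<open>0\<close> is \<open>0\<close>, so all
  derivatives vanish at \<open>u\<close> and, by induction, identically. Hence
  \<open>U.red H\<close> is a \<open>p\<close>-th power, and its root has smaller degree.\<close>

lemma simple_tuple_generic:
  assumes \<gamma>: "hyperplane m \<gamma>"
    and u: "\<forall>j<m. hdeg d (u j)" and g: "tuple_sum \<iota> m \<gamma> u = lin * g" "\<not> lin dvd g"
    and dim: "FF.relations_dim m (\<lambda>j. cst (\<gamma> j)) = 1" "m + FF.relations_dim n (\<lambda>i. cst (\<alpha> i)) = n + 1"
    and H: "homogeneous m e H" "mp_eval (\<lambda>c. cst c) (\<lambda>j. val (u j)) H = 0"
  shows "linear_form m \<gamma> dvd H"
proof -
  interpret U: hyperplane m \<gamma> by fact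
  have cst_hom: "comm_ring_hom (\<lambda>c. cst c)"
    by (rule comm_ring_hom_comp[OF generic_val.comm_ring_hom_axioms const_poly.comm_ring_hom_axioms])
  interpret ev: mp_evaluation "\<lambda>c. cst c" "\<lambda>j. val (u j)" by (rule mp_evaluationI) (rule cst_hom)
  let ?ev = "mp_eval (\<lambda>c. cst c) (\<lambda>j. val (u j))"
  have ev_lin: "?ev U.lin = 0"
  proof -
    have "?ev U.lin = (\<Sum>j<m. cst (\<gamma> j) * val (u j))"
      unfolding linear_form_def ev.eval.hom_sum ev.eval_mult ev.eval_const ev.eval_var ..
    also have "\<dots> = 0" unfolding generic_val_tuple_sum[symmetric] generic_val_eq_0_iff g(1) by simp
    finally show ?thesis .
  qed
  \<comment> \<open>Continued by \<open>0\<close> from \<open>m\<close> on, as the chain rule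
    \<open>pd_mp_eval\<close> demands.\<close>
  define w where "w j = (if j < m then emb (u j) else 0)" for j
  interpret w: mp_evaluation const_poly w by (rule mp_evaluationI) (rule const_poly.comm_ring_hom_axioms)
  have ev_w: "generic_val (mp_eval const_poly w f) = ?ev f" if "homogeneous m k f" for f k
  proof -
    have "generic_val (mp_eval const_poly w f) = mp_eval (\<lambda>c. cst c) (\<lambda>j. generic_val (w j)) f"
      by (rule mp_eval_comp) (rule const_poly.comm_ring_hom_axioms generic_val.comm_ring_hom_axioms)+
    also have "\<dots> = ?ev f"
      by (rule mp_eval_cong) (use that in \<open>auto simp: homogeneous_def w_def\<close>)
    finally show ?thesis .
  qed
  have pd_ev: "\<exists>\<kappa>. \<forall>j<m. ?ev (pd j f) = \<kappa> * cst (\<gamma> j)" if f: "homogeneous m k f" "?ev f = 0" for f k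
  proof -
    have "lin dvd mp_eval const_poly w f" using ev_w[OF f(1)] f(2) by (simp add: generic_val_eq_0_iff)
    then obtain q where q: "mp_eval const_poly w f = lin * q" ..
    have G: "generic_val g \<noteq> 0" using g(2) by (simp add: generic_val_eq_0_iff)
    \<comment> \<open>On the hyperplane the gradient of \<open>f\<close> pairs with
      \<open>\<partial>\<^sub>i u\<close> to \<open>\<alpha>\<^sub>i q\<close> and
      \<open>\<gamma>\<close> pairs with it to \<open>\<alpha>\<^sub>i g\<close>, so the factor must
      be the quotient of \<open>q\<close> by \<open>g\<close>.\<close>
    define \<kappa> where "\<kappa> = generic_val q / generic_val g"
    define \<zeta> where "\<zeta> j = ?ev (pd j f) - \<kappa> * cst (\<gamma> j)" for j
    have "(\<Sum>j<m. \<zeta> j * val (pd i (u j))) = 0" if i: "i < n" for i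
    proof -
      have "pd i (mp_eval const_poly w f) = (\<Sum>j<m. mp_eval const_poly w (pd j f) * pd i (w j))"
        by (rule pd_mp_eval) (simp add: w_def)
      then have "(\<Sum>j<m. mp_eval const_poly w (pd j f) * pd i (w j)) = const_poly (\<alpha> i) * q + lin * pd i q"
        unfolding q pd_mult pd_linear_form[OF i] ..
      then have "generic_val (\<Sum>j<m. mp_eval const_poly w (pd j f) * pd i (w j))
          = cst (\<alpha> i) * generic_val q + generic_val (lin * pd i q)"
        by (simp only: generic_val.hom_add generic_val.hom_mult)
      moreover have "generic_val (lin * pd i q) = 0" unfolding generic_val_eq_0_iff by simp
      moreover have "generic_val (\<Sum>j<m. mp_eval const_poly w (pd j f) * pd i (w j))
          = (\<Sum>j<m. ?ev (pd j f) * val (pd i (u j)))"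
        unfolding generic_val.hom_sum generic_val.hom_mult ev_w[OF homogeneous_pd[OF f(1)]]
        by (intro sum.cong refl) (simp add: w_def pd_coeff_map)
      ultimately have "(\<Sum>j<m. ?ev (pd j f) * val (pd i (u j))) = cst (\<alpha> i) * generic_val q" by simp
      moreover have "(\<Sum>j<m. \<kappa> * cst (\<gamma> j) * val (pd i (u j))) = cst (\<alpha> i) * generic_val q"
        unfolding mult.assoc sum_distrib_left[symmetric] pd_simple_tuple[OF g(1) i] using G by (simp add: \<kappa>_def)
      ultimately show ?thesis by (simp add: \<zeta>_def left_diff_distrib sum_subtractf)
    qed
    moreover have "(\<Sum>j<m. \<zeta> j * val (u j)) = 0"
    proof -
      \<comment> \<open>Euler's identity gives a multiple of the value of \<open>f\<close>, which is
        \<open>0\<close> whether or not \<open>p\<close> divides the degree.\<close>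
      have "?ev (\<Sum>j<m. var j * pd j f) = 0"
        unfolding euler_identity[OF f(1)] ev.eval_mult f(2) by simp
      then have "(\<Sum>j<m. val (u j) * ?ev (pd j f)) = 0"
        unfolding ev.eval.hom_sum ev.eval_mult ev.eval_var .
      moreover have "(\<Sum>j<m. \<kappa> * cst (\<gamma> j) * val (u j)) = 0"
        unfolding mult.assoc sum_distrib_left[symmetric] generic_val_tuple_sum[symmetric]
        using generic_val_eq_0_iff[of "tuple_sum \<iota> m \<gamma> u"] g(1) by simp
      ultimately show ?thesis by (simp add: \<zeta>_def left_diff_distrib right_diff_distrib sum_subtractf ac_simps)
    qed
    ultimately have "\<zeta> j = 0" if "j < m" for j
      using simple_tuple_spanning[OF u g dim, of \<zeta>] that by blast
    then show ?thesis by (auto simp: \<zeta>_def)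
  qed
  show ?thesis using H
  proof (induct e arbitrary: H rule: less_induct)
    case (less e)
    let ?H = "U.red H"
    have hom: "homogeneous m e ?H" by (rule U.homogeneous_restrict[OF less.prems(1)])
    have "?ev (H - ?H) = 0"
    proof -
      obtain q where "H - ?H = U.lin * q" using U.restrict_dvd_diff[of H] ..
      then show ?thesis by (simp only: ev.eval_mult ev_lin mult_zero_left)
    qed
    then have ev: "?ev ?H = 0" unfolding ev.eval.hom_minus less.prems(2) by simp
    have "U.lin dvd ?H"
    proof (cases "e = 0")
      \<comment> \<open>In degree \<open>0\<close> differentiation cannot lower the degree any
        further; a constant that vanishes at \<open>u\<close> is \<open>0\<close>.\<close>
      case True
      then have const: "?H = const_poly (Poly_Mapping.lookup ?H 0)" using hom homogeneous_degree_0_const by blast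
      then have "cst (Poly_Mapping.lookup ?H 0) = 0" using ev by (metis ev.eval_const)
      then have "Poly_Mapping.lookup ?H 0 = 0" using cst_neq_0 by blast
      then have "?H = 0" using const by simp
      then show ?thesis by simp
    next
      case False
      obtain \<kappa> where \<kappa>: "\<forall>j<m. ?ev (pd j ?H) = \<kappa> * cst (\<gamma> j)" using pd_ev[OF hom ev] by blast
      have "\<kappa> * cst (\<gamma> 0) = 0" using \<kappa>[rule_format, OF U.n_pos] unfolding U.pd_0_restrict by simp
      then have "\<kappa> = 0" using cst_neq_0[OF U.\<alpha>0] by simp
      have "pd j ?H = 0" if "j < m" for j
      proof -
        have "U.lin dvd pd j ?H"
          using \<kappa> that \<open>\<kappa> = 0\<close> False by (intro less.hyps[of "e - 1"] homogeneous_pd hom) simp_all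
        moreover obtain q where "pd j ?H = U.red q" using U.pd_restrict_in_range by blast
        ultimately show ?thesis unfolding U.linear_form_dvd_iff by (simp add: U.restrict_idem)
      qed
      then obtain q where q: "?H = q ^ p" "homogeneous m (e div p) q"
        using pd_0_imp_power[OF hom] by metis
      have "?ev q = 0" using ev p_pos unfolding q(1) ev.eval.hom_power by simp
      moreover have "e div p < e" using False prime_ge_2_nat[OF p] by simp
      ultimately have "U.lin dvd q" using q(2) less.hyps by blast
      then show ?thesis unfolding q(1) using p_pos by (simp add: dvd_power_same dvd_trans[OF _ dvd_power])
    qed
    then have "U.lin dvd (H - ?H) + ?H" using U.restrict_dvd_diff[of H] by (rule dvd_add[rotated])
    then show ?case by simp
  qed
qed

text \<open>A tuple in \<open>r\<close> need not be simple. As the relations form a line, it is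
  proportional to a simple tuple, and vanishing of a form carries over to that one.\<close>

lemma dominant_rational_morphism:
  assumes root: "\<forall>j<length cs. \<gamma> j ^ p = \<iota> (\<psi> (cs ! j))" and \<gamma>: "lin_indep_over \<iota> (length cs) \<gamma>"
    and dim: "FF.relations_dim (length cs) (\<lambda>j. cst (\<gamma> j)) = 1"
      "length cs + FF.relations_dim n (\<lambda>i. cst (\<alpha> i)) = n + 1"
    and r: "r \<in> rational_morphisms p \<phi> bs \<psi> cs"
  shows "dominant p \<phi> bs \<psi> cs r"
  unfolding dominant_def
proof (intro ballI allI impI)
  let ?m = "length cs"
  fix fs h e assume fs: "fs \<in> r" and h: "homogeneous ?m e h"
    and pull: "form_poly p \<phi> bs dvd subst_poly ((!) fs) h"
  have fs: "fs \<in> rational_tuples p \<phi> bs \<psi> cs" by (rule rational_morphism_subset[OF r fs])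
  obtain d k where f: "\<forall>j<?m. hdeg d (fs ! j)" "k < ?m" "\<not> \<Phi> dvd fs ! k"
      "lin dvd tuple_sum \<iota> ?m \<gamma> ((!) fs)"
    using rational_tuplesE[OF root fs] by blast
  \<comment> \<open>With a single coordinate the relation would make \<open>\<gamma> 0\<close> times
    a nonzero value vanish. Excluding this lets \<open>\<psi>\<close> itself satisfy
    \<open>anisotropic_data\<close>.\<close>
  have "?m \<noteq> 1"
  proof
    assume m: "?m = 1"
    with f(2) have "k = 0" by simp
    have "cst (\<gamma> 0) * val (fs ! 0) = 0"
      using f(4) unfolding generic_val_eq_0_iff[symmetric] generic_val_tuple_sum m by simp
    moreover have "val (fs ! 0) \<noteq> 0" using f(3) \<open>k = 0\<close> by (simp add: val_eq_0_iff)
    ultimately have "\<gamma> 0 = 0" using cst_neq_0[of "\<gamma> 0"] by auto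
    then have "(\<Sum>j<?m. \<iota> 1 * \<gamma> j) = 0" by (simp add: m)
    from lin_indep_overD[OF \<gamma> this] show False using m by simp
  qed
  then have "2 \<le> ?m" using f(2) by simp
  then interpret U: anisotropic_data \<iota> p ?m \<gamma> "\<lambda>j. \<psi> (cs ! j)"
    using root \<gamma> by unfold_locales simp_all
  obtain u d' g where u: "\<And>j. j < ?m \<Longrightarrow> hdeg d' (u j)" and g: "tuple_sum \<iota> ?m \<gamma> u = lin * g" "\<not> lin dvd g"
    by (rule ex_simple_tuple[OF \<gamma> f(1)[rule_format] f(2-4)]) (assumption, rule that)
  have u': "\<forall>j<?m. hdeg d' (u j)" using u by blast
  obtain l where l: "l < ?m" "\<not> \<Phi> dvd u l" using simple_tuple_not_dvd[OF g] by blast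
  have "lin dvd tuple_sum \<iota> ?m \<gamma> u" unfolding g(1) by simp
  from tuples_proportional[OF dim(1) f u' l this]
  obtain c where c: "\<forall>j<?m. val (u j) = c * val (fs ! j)" by blast
  have cst_hom: "comm_ring_hom (\<lambda>c. cst c)"
    by (rule comm_ring_hom_comp[OF generic_val.comm_ring_hom_axioms const_poly.comm_ring_hom_axioms])
  have "mp_eval (\<lambda>c. cst c) (\<lambda>j. val (fs ! j)) (emb h) = val (subst_poly ((!) fs) h)"
  proof -
    have "val (subst_poly ((!) fs) h) = mp_eval (\<lambda>c. val (const_poly c)) (\<lambda>j. val (fs ! j)) h"
      unfolding subst_poly_eq_mp_eval
      by (rule mp_eval_comp) (rule const_poly.comm_ring_hom_axioms val.comm_ring_hom_axioms)+
    then show ?thesis unfolding mp_eval_coeff_map[OF cst_hom] coeff_map_const ..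
  qed
  also have "\<dots> = 0" using pull unfolding form_poly_eq_power_form[of p \<phi>] val_eq_0_iff .
  finally have ev: "mp_eval (\<lambda>c. cst c) (\<lambda>j. val (fs ! j)) (emb h) = 0" .
  have emb_h: "homogeneous ?m e (emb h)" using hom_zero h by (rule homogeneous_coeff_map)
  have "mp_eval (\<lambda>c. cst c) (\<lambda>j. val (u j)) (emb h) = 0"
    unfolding mp_eval_scale[OF emb_h c] ev by simp
  from simple_tuple_generic[OF U.hyperplane_axioms u' g dim emb_h this]
  have "linear_form ?m \<gamma> dvd emb h" .
  \<comment> \<open>Divisibility by the linear form over the large field descends to divisibility by
    the equation of \<open>\<psi>\<close>, so the exponent \<open>1\<close> suffices.\<close>
  then have "form_poly p \<psi> cs dvd h ^ 1" unfolding U.\<Phi>_dvd_iff[symmetric] form_poly_eq_power_form[of p \<psi>] by simp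
  then show "\<exists>k. form_poly p \<psi> cs dvd h ^ k" ..
qed

text \<open>The coefficients expressing \<open>\<gamma> j\<close> through the
  \<open>\<alpha> i\<close> become constants of \<open>FF\<close>, so the \<open>FF\<close>-span of
  the \<open>cst (\<gamma> j)\<close> lies in that of the \<open>cst (\<alpha> i)\<close>.\<close>

lemma relations_dim_span:
  assumes "\<forall>j<m. \<exists>c. \<gamma> j = (\<Sum>i<n. \<iota> (c i) * \<alpha> i)"
  shows "m + FF.relations_dim n (\<lambda>i. cst (\<alpha> i)) \<le> n + FF.relations_dim m (\<lambda>j. cst (\<gamma> j))"
proof (rule FF.relations_dim_mono, rule subsetI)
  from assms obtain C where C: "\<forall>j<m. \<gamma> j = (\<Sum>i<n. \<iota> (C j i) * \<alpha> i)" by metis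
  let ?C = "\<lambda>j i. function_field_embed p \<phi> bs (C j i)"
  fix z assume "z \<in> FF.combination m (\<lambda>j. cst (\<gamma> j)) ` carrier (FF.coord_space m)"
  then obtain y where y: "y \<in> carrier (FF.coord_space m)" "z = FF.combination m (\<lambda>j. cst (\<gamma> j)) y" by blast
  have y': "y j \<in> carrier FF" if "j < m" for j using y(1) that by (auto simp: PiE_mem)
  define x where "x = restrict (\<lambda>i. \<Oplus>\<^bsub>FF\<^esub>j\<in>{..<m}. y j \<otimes>\<^bsub>FF\<^esub> ?C j i) {..<n}"
  have closed: "y j \<otimes>\<^bsub>FF\<^esub> ?C j i \<in> carrier FF" if "j < m" for j i
    using y'[OF that] function_field_embed_closed by simp
  have \<theta>_x: "\<theta> (x i) = (\<Sum>j<m. \<theta> (y j) * cst (\<iota> (C j i)))" if "i < n" for i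
  proof -
    have "\<theta> (x i) = \<theta> (\<Oplus>\<^bsub>FF\<^esub>j\<in>{..<m}. y j \<otimes>\<^bsub>FF\<^esub> ?C j i)"
      using that by (simp only: x_def restrict_apply lessThan_iff if_True)
    also have "\<dots> = (\<Sum>j<m. \<theta> (y j \<otimes>\<^bsub>FF\<^esub> ?C j i))"
      using closed by (intro FF.embed_finsum) auto
    also have "\<dots> = (\<Sum>j<m. \<theta> (y j) * cst (\<iota> (C j i)))"
      by (intro sum.cong refl) (simp add: FF.embed_mult y' function_field_embed_closed \<theta>_function_field_embed)
    finally show ?thesis .
  qed
  have "z = (\<Sum>j<m. \<Sum>i<n. \<theta> (y j) * cst (\<iota> (C j i)) * cst (\<alpha> i))"
    unfolding y(2) FF.combination_def
    by (intro sum.cong refl) (simp add: C const_poly.hom_sum const_poly.hom_mult generic_val.hom_sum generic_val.hom_mult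
        sum_distrib_left mult.assoc)
  also have "\<dots> = (\<Sum>i<n. \<Sum>j<m. \<theta> (y j) * cst (\<iota> (C j i)) * cst (\<alpha> i))"
    by (rule sum.swap)
  also have "\<dots> = (\<Sum>i<n. \<theta> (x i) * cst (\<alpha> i))"
    by (intro sum.cong refl) (simp add: \<theta>_x sum_distrib_right)
  finally have "z = FF.combination n (\<lambda>i. cst (\<alpha> i)) x" unfolding FF.combination_def .
  moreover have "x \<in> carrier (FF.coord_space n)"
    using closed by (auto simp: x_def intro!: FF.finsum_closed)
  ultimately show "z \<in> FF.combination n (\<lambda>i. cst (\<alpha> i)) ` carrier (FF.coord_space n)" by blast
qed

end

text \<open>Over the perfect field \<open>'b\<close> the form \<open>\<phi>\<close> becomes the \<open>p\<close>-th power of a linear form, which is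
  injective on \<open>V\<close> as \<open>\<phi>\<close> is anisotropic.\<close>

locale anisotropic_form = frobenius_extension \<iota> p + V: vectorspace class_ring V
  for \<iota> :: "'a::field \<Rightarrow> 'b::field" and p :: nat and V :: "('a, 'v) module" +
  fixes \<phi> :: "'v \<Rightarrow> 'a"
  assumes form: "quasilinear_form p class_ring V \<phi>" and aniso: "anisotropic class_ring V \<phi>"
begin

text \<open>The root exists by \<open>perfect\<close> and is unique by
  \<open>frobenius_inj\<close>.\<close>

definition \<rho> :: "'v \<Rightarrow> 'b" where
  "\<rho> v = (SOME z. z ^ p = \<iota> (\<phi> v))"

lemma \<rho>_power: "\<rho> v ^ p = \<iota> (\<phi> v)"
  unfolding \<rho>_def by (rule someI_ex[OF perfect])

lemma frobenius_add: "(x + y) ^ p = x ^ p + (y ^ p :: 'b)"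
  by (rule freshmans_dream) (simp_all only: char p)

lemma frobenius_inj:
  assumes "x ^ p = (y ^ p :: 'b)"
  shows "x = y"
proof -
  have "x ^ p = (x - y) ^ p + y ^ p" using frobenius_add[of "x - y" y] by simp
  then show ?thesis using assms p_pos by simp
qed

text \<open>After raising to the \<open>p\<close>-th power, which is injective, this is additivity
  of \<open>\<phi>\<close>.\<close>

lemma \<rho>_add:
  assumes "v \<in> carrier V" "w \<in> carrier V"
  shows "\<rho> (v \<oplus>\<^bsub>V\<^esub> w) = \<rho> v + \<rho> w"
proof (rule frobenius_inj)
  have "\<forall>v\<in>carrier V. \<forall>w\<in>carrier V. \<phi> (v \<oplus>\<^bsub>V\<^esub> w) = \<phi> v \<oplus>\<^bsub>class_ring\<^esub> \<phi> w"
    using form unfolding quasilinear_form_def by (elim conjE)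
  then have "\<phi> (v \<oplus>\<^bsub>V\<^esub> w) = \<phi> v + \<phi> w" using assms by simp
  then show "\<rho> (v \<oplus>\<^bsub>V\<^esub> w) ^ p = (\<rho> v + \<rho> w) ^ p"
    unfolding frobenius_add \<rho>_power hom_add[symmetric] by (rule arg_cong)
qed

lemma \<rho>_smult:
  assumes "v \<in> carrier V"
  shows "\<rho> (a \<odot>\<^bsub>V\<^esub> v) = \<iota> a * \<rho> v"
proof (rule frobenius_inj)
  have "\<forall>a\<in>carrier class_ring. \<forall>v\<in>carrier V. \<phi> (a \<odot>\<^bsub>V\<^esub> v) = (a [^]\<^bsub>class_ring\<^esub> p) \<otimes>\<^bsub>class_ring\<^esub> \<phi> v"
    using form unfolding quasilinear_form_def by (elim conjE)
  then have "\<phi> (a \<odot>\<^bsub>V\<^esub> v) = a ^ p * \<phi> v" using assms by (simp add: class_ring_simps)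
  then show "\<rho> (a \<odot>\<^bsub>V\<^esub> v) ^ p = (\<iota> a * \<rho> v) ^ p"
    unfolding power_mult_distrib \<rho>_power hom_power[symmetric] hom_mult[symmetric] by (rule arg_cong)
qed

lemma \<rho>_eq_0: "v \<in> carrier V \<Longrightarrow> \<rho> v = 0 \<Longrightarrow> v = \<zero>\<^bsub>V\<^esub>"
  using aniso \<rho>_power[of v] p_pos by (auto simp: isotropic_def zero_power)

lemma \<rho>_lincomb:
  assumes "finite A" "A \<subseteq> carrier V"
  shows "\<rho> (V.lincomb a A) = (\<Sum>v\<in>A. \<iota> (a v) * \<rho> v)"
  using assms
proof (induct A rule: finite_induct)
  case empty
  have "\<rho> (0 \<odot>\<^bsub>V\<^esub> \<zero>\<^bsub>V\<^esub>) = \<iota> 0 * \<rho> \<zero>\<^bsub>V\<^esub>" by (rule \<rho>_smult) simp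
  moreover have "0 \<odot>\<^bsub>V\<^esub> \<zero>\<^bsub>V\<^esub> = \<zero>\<^bsub>V\<^esub>" using V.lmult_0[of "\<zero>\<^bsub>V\<^esub>"] by simp
  ultimately show ?case by simp
next
  case (insert w A)
  then have "V.lincomb a (insert w A) = a w \<odot>\<^bsub>V\<^esub> w \<oplus>\<^bsub>V\<^esub> V.lincomb a A"
    by (intro V.lincomb_insert2) auto
  moreover have "V.lincomb a A \<in> carrier V" using insert by (intro V.lincomb_closed) auto
  moreover have "a w \<odot>\<^bsub>V\<^esub> w \<in> carrier V" using insert by (intro V.smult_closed) auto
  ultimately show ?case using insert by (simp add: \<rho>_add \<rho>_smult)
qed

lemma \<rho>_lincomb_list:
  assumes "distinct bs" "set bs \<subseteq> carrier V"
  shows "\<rho> (V.lincomb a (set bs)) = (\<Sum>i<length bs. \<iota> (a (bs ! i)) * \<rho> (bs ! i))"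
  unfolding \<rho>_lincomb[OF finite_set assms(2)]
  using sum.reindex_bij_betw[OF bij_betw_nth[OF assms(1) refl refl], of "\<lambda>v. \<iota> (a v) * \<rho> v"] by simp

text \<open>A relation with coefficients in the base field says that \<open>\<rho>\<close>, hence
  \<open>\<phi>\<close>, vanishes at the corresponding combination of the vectors. By anisotropy
  that combination is \<open>0\<close>.\<close>

lemma lin_indep_over_\<rho>:
  assumes bs: "distinct bs" "set bs \<subseteq> carrier V" and li: "V.lin_indpt (set bs)"
  shows "lin_indep_over \<iota> (length bs) (\<lambda>i. \<rho> (bs ! i))"
  unfolding lin_indep_over_def
proof (intro allI impI)
  fix c i assume sum: "(\<Sum>i<length bs. \<iota> (c i) * \<rho> (bs ! i)) = 0" and i: "i < length bs"
  define a where "a = (\<lambda>v. c (the_inv_into {..<length bs} ((!) bs) v))"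
  have inj: "inj_on ((!) bs) {..<length bs}" using bs(1) by (simp add: inj_on_nth)
  have a: "a (bs ! i) = c i" if "i < length bs" for i
    using that by (simp add: a_def the_inv_into_f_f[OF inj])
  have "\<rho> (V.lincomb a (set bs)) = 0"
    unfolding \<rho>_lincomb_list[OF bs] using sum by (simp add: a)
  then have "V.lincomb a (set bs) = \<zero>\<^bsub>V\<^esub>"
    using bs(2) by (intro \<rho>_eq_0 V.lincomb_closed) auto
  then have "a \<in> set bs \<rightarrow> {0}" using V.not_lindepD[OF li finite_set subset_refl, of a] by simp
  then show "c i = 0" using a[OF i] i by (auto simp: Pi_iff)
qed

lemma \<rho>_in_span:
  assumes bs: "ordered_basis class_ring V bs" and v: "v \<in> carrier V"
  shows "\<exists>c. \<rho> v = (\<Sum>i<length bs. \<iota> (c i) * \<rho> (bs ! i))"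
proof -
  have *: "distinct bs" "set bs \<subseteq> carrier V" "V.span (set bs) = carrier V"
    using bs by (auto simp: ordered_basis_def V.basis_def)
  then have "v \<in> V.span (set bs)" using v by simp
  then obtain a where "v = V.lincomb a (set bs)" unfolding V.finite_span[OF finite_set *(2)] by blast
  with \<rho>_lincomb_list[OF *(1,2)] show ?thesis by auto
qed

end

theorem corollary5p14:
  fixes p :: nat
    and V :: "('a::field, 'v) module"
    and \<phi> \<psi> :: "'v \<Rightarrow> 'a"
    and U :: "'v set"
    and bs cs :: "'v list"
  assumes "prime p" and "CHAR('a) = p"
    and non_perfect: "\<not> surj (\<lambda>x::'a. x ^ p)"
    and form: "quasilinear_form p class_ring V \<phi>"
    and anisotropic: "anisotropic class_ring V \<phi>"
    and dim: "vectorspace.dim class_ring V \<ge> 2"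
    and subform: "subform class_ring U \<psi> V \<phi>"
    and basis_V: "ordered_basis class_ring V bs"
    and basis_U: "ordered_basis class_ring (V\<lparr>carrier := U\<rparr>) cs"
  shows "(isotropic_over_function_field p \<phi> bs \<psi> cs \<longleftrightarrow>
            int (codim class_ring U V) \<le> int (first_defect_index p \<phi> bs) - 1) \<and>
         (int (codim class_ring U V) = int (first_defect_index p \<phi> bs) - 1 \<longrightarrow>
            (\<exists>!r. r \<in> rational_morphisms p \<phi> bs \<psi> cs) \<and>
            (\<forall>r \<in> rational_morphisms p \<phi> bs \<psi> cs. dominant p \<phi> bs \<psi> cs r))"
proof -
  have V: "vectorspace class_ring V" "vectorspace.fin_dim class_ring V"
    using form by (simp_all add: quasilinear_form_def)
  interpret V: vectorspace class_ring V by (rule V(1))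
  have p_pos: "p > 0" using \<open>prime p\<close> by (simp add: prime_gt_0_nat)
  \<comment> \<open>The algebraic closure of the base field serves as the perfect extension.\<close>
  interpret anisotropic_form "to_ac :: 'a \<Rightarrow> 'a alg_closure" p V \<phi>
  proof unfold_locales
    show "CHAR('a alg_closure) = p" using \<open>CHAR('a) = p\<close> by simp
    show "\<exists>z. z ^ p = y" for y :: "'a alg_closure" using nth_root_exists[OF p_pos, of y] by blast
  qed (fact \<open>prime p\<close> form anisotropic | simp)+
  have bs: "distinct bs" "V.basis (set bs)" "set bs \<subseteq> carrier V" "V.lin_indpt (set bs)"
    using basis_V by (simp_all add: ordered_basis_def V.basis_def)
  have dim_V: "V.dim = length bs" using V.dim_basis[OF finite_set bs(2)] distinct_card[OF bs(1)] by simp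
  have U: "subspace class_ring U V" and \<psi>: "\<And>u. u \<in> U \<Longrightarrow> \<psi> u = \<phi> u"
    using subform by (simp_all add: subform_def)
  note cs = V.ordered_basis_subspace[OF U basis_U]
  have dist_cs: "distinct cs" using basis_U by (simp add: ordered_basis_def)
  have UV: "U \<subseteq> carrier V" using U unfolding subspace_def submodule_def by blast
  define \<alpha> where "\<alpha> i = \<rho> (bs ! i)" for i
  define \<gamma> where "\<gamma> j = \<rho> (cs ! j)" for j
  interpret H: anisotropic_hypersurface "to_ac :: 'a \<Rightarrow> 'a alg_closure" p bs \<alpha> \<phi>
  proof unfold_locales
    show "2 \<le> length bs" using dim dim_V by simp
    show "\<alpha> i ^ p = to_ac (\<phi> (bs ! i))" for i unfolding \<alpha>_def by (rule \<rho>_power)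
    show "lin_indep_over to_ac (length bs) \<alpha>" unfolding \<alpha>_def by (rule lin_indep_over_\<rho>[OF bs(1,3,4)])
  qed
  let ?n = "length bs" and ?m = "length cs"
  \<comment> \<open>\<open>k\<close> is the defect index of \<open>\<psi>\<close> over
    \<open>F(\<phi>)\<close>.\<close>
  define k where "k = H.FF.relations_dim ?m (\<lambda>j. H.cst (\<gamma> j))"
  have root: "\<forall>j<?m. \<gamma> j ^ p = to_ac (\<psi> (cs ! j))"
    unfolding \<gamma>_def \<rho>_power using \<psi> cs(1) by (metis nth_mem subset_iff)
  have \<gamma>: "lin_indep_over to_ac ?m \<gamma>"
    unfolding \<gamma>_def by (rule lin_indep_over_\<rho>[OF dist_cs _ cs(2)]) (use cs(1) UV in blast)
  have "\<forall>j<?m. \<exists>c. \<gamma> j = (\<Sum>i<?n. to_ac (c i) * \<alpha> i)"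
    unfolding \<gamma>_def \<alpha>_def using \<rho>_in_span[OF basis_V] cs(1) UV by (meson nth_mem subset_iff)
  \<comment> \<open>With \<open>i\<close> for the first defect index and \<open>c\<close> for the
    codimension, \<open>ge\<close> says \<open>k \<ge> i - c\<close>, and \<open>le\<close> adds the
    reverse inequality unless \<open>k = 0\<close>.\<close>
  from H.relations_dim_span[OF this]
  have ge: "?m + first_defect_index p \<phi> bs \<le> ?n + k" unfolding H.first_defect_index_eq k_def .
  have le: "?n + k \<le> ?m + first_defect_index p \<phi> bs" if "k \<noteq> 0"
    using H.relations_dim_isotropic[OF \<gamma>] that unfolding H.first_defect_index_eq k_def by simp
  have iso: "isotropic_over_function_field p \<phi> bs \<psi> cs \<longleftrightarrow> k \<noteq> 0"
    using H.isotropic_over_function_field_iff[OF root] unfolding k_def .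
  have "?m \<le> ?n"
  proof -
    have "card (set cs) \<le> V.dim" by (rule V.li_le_dim(2)[OF V(2) _ cs(2)]) (use cs(1) UV in blast)
    then show ?thesis using distinct_card[OF dist_cs] dim_V by simp
  qed
  then have codim: "int (codim class_ring U V) = int ?n - int ?m"
    unfolding codim_def dim_V cs(3) by simp
  show ?thesis
  proof (intro conjI impI ballI)
    \<comment> \<open>If \<open>k = 0\<close>, then \<open>ge\<close> makes the codimension at least
      the first defect index. Otherwise the codimension is the first defect index minus
      \<open>k\<close>, and \<open>k \<ge> 1\<close>.\<close>
    show "isotropic_over_function_field p \<phi> bs \<psi> cs \<longleftrightarrow>
        int (codim class_ring U V) \<le> int (first_defect_index p \<phi> bs) - 1"
      unfolding iso codim using ge le by (cases "k = 0") auto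
    assume eq: "int (codim class_ring U V) = int (first_defect_index p \<phi> bs) - 1"
    then have *: "?m + first_defect_index p \<phi> bs = ?n + 1" unfolding codim by simp
    \<comment> \<open>By \<open>*\<close>, \<open>ge\<close> reads
      \<open>?n + 1 \<le> ?n + k\<close>, which excludes \<open>k = 0\<close>, and \<open>le\<close>
      then gives the reverse inequality.\<close>
    with ge le have k: "k = 1" by (cases "k = 0") auto
    then show "\<exists>!r. r \<in> rational_morphisms p \<phi> bs \<psi> cs"
      using H.ex1_rational_morphism[OF root] unfolding k_def by blast
    fix r assume "r \<in> rational_morphisms p \<phi> bs \<psi> cs"
    then show "dominant p \<phi> bs \<psi> cs r"
      by (rule H.dominant_rational_morphism[OF root \<gamma> k[unfolded k_def] *[unfolded H.first_defect_index_eq]])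
  qed
qed

end
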